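(* Let $\mathcal{B}(X)$ be the set of pure quartic fields $K=\mathbb{Q}(\sqrt[4]{a})$, where $a\ne\pm1$ is an integer such that for every prime $p$ with $p^\nu\parallel a$ one has $\gcd(\nu,4)=1$, with $|\mathcal{D}_K|\le X$. Then for every integer $a\ge0$, $$\lim_{X\to\infty}\frac{\#\{K\in\mathcal{B}(X): g_K=2^a\}}{|\mathcal{B}(X)|}=0.$$
   Context: For a number field $K$, $\mathcal{D}_K$ is its discriminant. The genus field $K^*$ of $K$ is the maximal extension of $K$ of the form $Kk$ with $k/\mathbb{Q}$ abelian such that $Kk/K$ is unramified at all finite places; the genus number is $g_K=[K^*:K]$. *)

theory Defs
  imports
    "HOL-Algebra.Algebra"
    "HOL-Algebra.Algebraic_Closure_Type"
    "HOL-Computational_Algebra.Computational_Algebra"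
    "Jordan_Normal_Form.Determinant"
    Complex_Main
begin

section \<open>Number fields inside the complex numbers\<close>

abbreviation complex_ring :: "complex ring" where
  "complex_ring \<equiv> ring_of_type_algebra"

abbreviation sub_ring :: "complex set \<Rightarrow> complex ring" where
  "sub_ring S \<equiv> complex_ring\<lparr>carrier := S\<rparr>"

definition ext_degree :: "complex set \<Rightarrow> complex set \<Rightarrow> nat" where
  \<comment> \<open>\<open>[L : K]\<close>, with value 0 for infinite extensions (the library's \<open>dim\<close> is a bare
      definite description)\<close>
  "ext_degree L K =
     (if ring.finite_dimension complex_ring K L then ring.dim complex_ring K L else 0)"

definition number_field :: "complex set \<Rightarrow> bool" where
  "number_field K \<longleftrightarrow>
     subfield K complex_ring \<and> ring.finite_dimension complex_ring \<rat> K"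

definition ring_of_integers :: "complex set \<Rightarrow> complex set" where
  "ring_of_integers K = {x \<in> K. algebraic_int x}"

definition compositum :: "complex set \<Rightarrow> complex set \<Rightarrow> complex set" where
  "compositum K k = generate_field complex_ring (K \<union> k)"


section \<open>Discriminant\<close>

definition embeddings :: "complex set \<Rightarrow> (complex \<Rightarrow> complex) set" where
  \<comment> \<open>extensionality makes distinct elements distinct as maps on \<open>K\<close>\<close>
  "embeddings K = Ring.ring_hom (sub_ring K) complex_ring \<inter> extensional K"

definition field_trace :: "complex set \<Rightarrow> complex \<Rightarrow> complex" where
  "field_trace K x = (\<Sum>\<sigma>\<in>embeddings K. \<sigma> x)"

definition integral_basis :: "complex set \<Rightarrow> complex list \<Rightarrow> bool" where
  "integral_basis K bs \<longleftrightarrow>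
     set bs \<subseteq> ring_of_integers K \<and>
     (\<forall>x\<in>ring_of_integers K.
        \<exists>!c :: int list. length c = length bs \<and> x = (\<Sum>i<length bs. of_int (c ! i) * bs ! i))"

definition discriminant :: "complex set \<Rightarrow> int" where
  "discriminant K =
     (THE d. \<exists>bs. integral_basis K bs \<and>
        of_int d = det (mat (length bs) (length bs)
                          (\<lambda>(i, j). field_trace K (bs ! i * bs ! j))))"


section \<open>Ramification\<close>

definition ramification_index :: "complex set \<Rightarrow> complex set \<Rightarrow> complex set \<Rightarrow> nat" where
  \<comment> \<open>for a nonzero prime \<open>P\<close> of the integers of \<open>L\<close> over \<open>p = P \<inter> K\<close>: the exponent of \<open>P\<close> in the
      ideal generated by \<open>p\<close>, where divisibility of ideals is reverse inclusion\<close>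
  "ramification_index L K P =
     (let OL = sub_ring (ring_of_integers L)
      in GREATEST e :: nat.
           genideal OL (P \<inter> ring_of_integers K) \<subseteq> P [^]\<^bsub>ideals_set OL\<^esub> e)"

definition unramified :: "complex set \<Rightarrow> complex set \<Rightarrow> bool" where
  \<comment> \<open>unramified at all finite places; residue fields are finite, so separability is automatic\<close>
  "unramified L K \<longleftrightarrow>
     (\<forall>P. primeideal P (sub_ring (ring_of_integers L)) \<and> P \<noteq> {0} \<longrightarrow>
        ramification_index L K P = 1)"


section \<open>Abelian number fields, genus field and genus number\<close>

definition galois_group :: "complex set \<Rightarrow> complex set \<Rightarrow> (complex \<Rightarrow> complex) monoid" where
  "galois_group L K = (BijGroup L)\<lparr>carrier :=
     {\<sigma> \<in> Bij L. \<sigma> \<in> Ring.ring_hom (sub_ring L) (sub_ring L) \<and> (\<forall>x\<in>K. \<sigma> x = x)}\<rparr>"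

definition galois_extension :: "complex set \<Rightarrow> complex set \<Rightarrow> bool" where
  \<comment> \<open>for a finite extension \<open>L\<close> of \<open>K\<close>\<close>
  "galois_extension L K \<longleftrightarrow>
     {x \<in> L. \<forall>\<sigma>\<in>carrier (galois_group L K). \<sigma> x = x} = K"

definition abelian_field :: "complex set \<Rightarrow> bool" where
  "abelian_field k \<longleftrightarrow>
     number_field k \<and> galois_extension k \<rat> \<and> comm_group (galois_group k \<rat>)"

definition genus_extensions :: "complex set \<Rightarrow> complex set set" where
  "genus_extensions K =
     {compositum K k | k. abelian_field k \<and> unramified (compositum K k) K}"

definition is_genus_field :: "complex set \<Rightarrow> complex set \<Rightarrow> bool" where
  "is_genus_field K F \<longleftrightarrow>
     F \<in> genus_extensions K \<and> (\<forall>F'\<in>genus_extensions K. F' \<subseteq> F)"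

definition genus_number :: "complex set \<Rightarrow> nat" where
  \<comment> \<open>a number field has exactly one genus field; elsewhere the value is 0 by convention\<close>
  "genus_number K =
     (if \<exists>F. is_genus_field K F then ext_degree (THE F. is_genus_field K F) K else 0)"


section \<open>The family of pure quartic fields\<close>

definition admissible :: "int \<Rightarrow> bool" where
  \<comment> \<open>\<open>a = 0\<close> does not give a quartic field; for all other admissible \<open>a\<close> the
      polynomial \<open>x\<^sup>4 - a\<close> is irreducible\<close>
  "admissible a \<longleftrightarrow>
     a \<noteq> 0 \<and> a \<noteq> 1 \<and> a \<noteq> -1 \<and> (\<forall>p. Factorial_Ring.prime p \<and> p dvd a \<longrightarrow> gcd (multiplicity p a) 4 = 1)"

definition pure_quartic_fields :: "real \<Rightarrow> complex set set" where
  \<comment> \<open>all complex fourth roots of \<open>a\<close> are allowed, so every conjugate of such a field occurs\<close>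
  "pure_quartic_fields x =
     {K. (\<exists>a \<alpha>. admissible a \<and> \<alpha> ^ 4 = of_int a \<and>
            K = generate_field complex_ring (insert \<alpha> \<rat>)) \<and>
         real_of_int \<bar>discriminant K\<bar> \<le> x}"

definition iso_classes :: "complex set set \<Rightarrow> complex set set set" where
  "iso_classes \<F> = \<F> // {(K, L). K \<in> \<F> \<and> L \<in> \<F> \<and> sub_ring K \<simeq> sub_ring L}"

end

theory Submission
  imports Defs "Jordan_Normal_Form.Char_Poly"
begin

text \<open>Modulo fourth powers every admissible integer is \<open>b c\<^sup>3\<close> with \<open>b c\<close> squarefree, and the field it defines has
  discriminant \<open>-256 (b c)\<^sup>3\<close> up to a bounded power of \<open>2\<close>. Every odd prime \<open>p\<close> dividing \<open>b c\<close> is totally and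
  tamely ramified, so adjoining the square root of \<open>\<plusminus>p \<equiv> 1 (mod 4)\<close> is unramified. Hence the genus number is at
  least \<open>2\<^bsup>k-2\<^esup>\<close>, where \<open>k\<close> is the number of these primes, and a fixed genus number \<open>2\<^bsup>a\<^esup>\<close> bounds \<open>k\<close> and therefore the
  number of pairs \<open>(b, c)\<close> with given product. So only \<open>O(x\<^bsup>1/3\<^esup>)\<close> of the fields have this genus number, whereas
  the pairs with \<open>c\<close> prime alone give, for every \<open>M\<close>, more than \<open>M x\<^bsup>1/3\<^esup>\<close> isomorphism classes for large \<open>x\<close>,
  because the sum of the reciprocals of the primes diverges.\<close>


section \<open>Subfields of the complex numbers and algebraic integers\<close>

text \<open>The order x^(1/3) comes from the discriminant being comparable to (b c)^3. When c runs
  over a fixed finite set of primes q, each q contributes about x^(1/3)/q values of b, which is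
  where the divergent sum enters. The count is up to isomorphism, which affects the two sides
  differently. The numerator may be bounded by the number of fields, but the denominator needs
  pairwise nonisomorphic ones. There t is taken to be the real fourth root, and b is kept larger
  than every q, because (b, c) and (c, b) give isomorphic real fields. The loss of 2 in the exponent
  k - 2 is the degree 4 of K: the k square roots generate degree 2^k over the rationals inside the
  genus field, whose degree over the rationals is at most 4 times the genus number. The ring of
  integers is enclosed between the lattice spanned by the explicit basis and a quarter of that
  lattice. Traces bound the denominators by 4 b c, and an Eisenstein argument at each prime of b c
  removes the factor b c. Unramifiedness is tested at each prime ideal P by finding an element of P
  that lies in K but not in the square of P.\<close>

lemma complex_ring_simps [simp]:
  "carrier complex_ring = UNIV" "x \<otimes>\<^bsub>complex_ring\<^esub> y = x * y"
  "\<one>\<^bsub>complex_ring\<^esub> = 1" "\<zero>\<^bsub>complex_ring\<^esub> = 0" "x \<oplus>\<^bsub>complex_ring\<^esub> y = x + y"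
  by (simp_all add: ring_of_type_algebra_def)

lemma field_complex_ring: "field complex_ring"
  by (rule field_from_type_algebra)

lemma ring_complex_ring: "ring complex_ring"
  by (rule ring_from_type_algebra)

lemma complex_ring_a_inv [simp]: "\<ominus>\<^bsub>complex_ring\<^esub> x = - x"
proof -
  interpret ring complex_ring by (rule ring_complex_ring)
  show ?thesis using minus_equality[of "-x" x] by simp
qed

lemma complex_ring_m_inv [simp]: "x \<noteq> 0 \<Longrightarrow> inv\<^bsub>complex_ring\<^esub> x = inverse x"
proof -
  interpret field complex_ring by (rule field_complex_ring)
  show "x \<noteq> 0 \<Longrightarrow> inv\<^bsub>complex_ring\<^esub> x = inverse x"
    using comm_inv_char[of x "inverse x"] by simp
qed

lemma subfield_complexI:
  assumes "1 \<in> K" "\<And>x y. x \<in> K \<Longrightarrow> y \<in> K \<Longrightarrow> x + y \<in> K" "\<And>x y. x \<in> K \<Longrightarrow> y \<in> K \<Longrightarrow> x * y \<in> K"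
    "\<And>x. x \<in> K \<Longrightarrow> - x \<in> K" "\<And>x. x \<in> K \<Longrightarrow> inverse x \<in> K"
  shows "subfield K complex_ring"
proof -
  interpret field complex_ring by (rule field_complex_ring)
  show ?thesis
    by (rule subfieldI', rule subringI) (use assms in auto)
qed

lemma subfield_complexD:
  assumes "subfield K complex_ring"
  shows "0 \<in> K" "1 \<in> K" "\<And>x y. x \<in> K \<Longrightarrow> y \<in> K \<Longrightarrow> x + y \<in> K"
    "\<And>x y. x \<in> K \<Longrightarrow> y \<in> K \<Longrightarrow> x * y \<in> K" "\<And>x. x \<in> K \<Longrightarrow> - x \<in> K"
    "\<And>x. x \<in> K \<Longrightarrow> inverse x \<in> K" "\<And>x y. x \<in> K \<Longrightarrow> y \<in> K \<Longrightarrow> x - y \<in> K"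
    "\<And>x y. x \<in> K \<Longrightarrow> y \<in> K \<Longrightarrow> x / y \<in> K" "\<And>x n. x \<in> K \<Longrightarrow> x ^ n \<in> K"
    "\<And>n. of_int n \<in> K" "\<rat> \<subseteq> K"
proof -
  interpret field complex_ring by (rule field_complex_ring)
  note r = subringE[OF subfieldE(1)[OF assms]]
  show 0: "0 \<in> K" and 1: "1 \<in> K" using r(2,3) by auto
  show add: "x + y \<in> K" if "x \<in> K" "y \<in> K" for x y using r(7)[OF that] by simp
  show mult: "x * y \<in> K" if "x \<in> K" "y \<in> K" for x y using r(6)[OF that] by simp
  show neg: "- x \<in> K" if "x \<in> K" for x using r(5)[OF that] by simp
  show inv: "inverse x \<in> K" if "x \<in> K" for x
    using subfield_m_inv(1)[OF assms, of x] that 0 by (cases "x = 0") auto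
  show "x - y \<in> K" if "x \<in> K" "y \<in> K" for x y using add[OF that(1) neg[OF that(2)]] by simp
  show "x / y \<in> K" if "x \<in> K" "y \<in> K" for x y
    using mult[OF that(1) inv[OF that(2)]] by (simp add: divide_inverse)
  show "x ^ n \<in> K" if "x \<in> K" for x n by (induction n) (use 1 mult that in auto)
  have nat: "of_nat n \<in> K" for n by (induction n) (use 0 1 add in auto)
  show int: "of_int n \<in> K" for n by (cases n) (use nat neg in \<open>auto simp del: of_nat_Suc\<close>)
  show "\<rat> \<subseteq> K" using int mult inv by (auto elim!: Rats_cases' simp: divide_inverse)
qed

lemma subfield_Rats: "subfield \<rat> complex_ring"
  by (rule subfield_complexI) auto

lemma generate_field_complex:
  "subfield (generate_field complex_ring S) complex_ring"
  "S \<subseteq> generate_field complex_ring S"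
  "subfield K complex_ring \<Longrightarrow> S \<subseteq> K \<Longrightarrow> generate_field complex_ring S \<subseteq> K"
proof -
  interpret field complex_ring by (rule field_complex_ring)
  show "subfield (generate_field complex_ring S) complex_ring"
    by (rule generate_field_is_subfield) simp
  show "S \<subseteq> generate_field complex_ring S" by (auto intro: generate_field.incl)
  show "subfield K complex_ring \<Longrightarrow> S \<subseteq> K \<Longrightarrow> generate_field complex_ring S \<subseteq> K"
    by (rule generate_field_min_subfield1) auto
qed

lemma generate_field_complex_eqI:
  assumes "subfield K complex_ring" "S \<subseteq> K"
    "\<And>F. subfield F complex_ring \<Longrightarrow> S \<subseteq> F \<Longrightarrow> K \<subseteq> F"
  shows "generate_field complex_ring S = K"
  using assms generate_field_complex by (metis subset_antisym)

section \<open>Integrality through finitely generated Z-modules\<close>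

interpretation zmod: Modules.module "\<lambda>(n::int) (x::complex). of_int n * x"
  by unfold_locales (auto simp: algebra_simps)

declare zmod.scale_scale [simp del] \<comment> \<open>loops against \<open>of_int_mult\<close>\<close>

text \<open>Multiplication by \<open>z\<close> acts on the generators \<open>B\<close> through an
  integer matrix. The vector listing \<open>B\<close> is an eigenvector for \<open>z\<close>, so
  \<open>z\<close> is a root of a monic integral characteristic polynomial.\<close>

lemma algebraic_int_stable_lattice:
  assumes "finite B" "b \<in> B" "b \<noteq> 0" "\<And>b. b \<in> B \<Longrightarrow> z * b \<in> zmod.span B"
  shows "algebraic_int z"
proof -
  define n where "n = card B"
  obtain f where f: "bij_betw f {..<n} B"
    using ex_bij_betw_nat_finite[OF assms(1)] unfolding n_def atLeast0LessThan by blast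
  have fin: "f i \<in> B" if "i < n" for i using f that by (auto simp: bij_betw_def)
  have "\<exists>u. z * b = (\<Sum>c\<in>B. of_int (u c) * c)" if "b \<in> B" for b
    using assms(4)[OF that] zmod.span_finite[OF assms(1)] by auto
  then obtain u where u: "\<And>b. b \<in> B \<Longrightarrow> z * b = (\<Sum>c\<in>B. of_int (u b c) * c)"
    by metis
  define A where "A = mat n n (\<lambda>(i,j). u (f i) (f j))"
  define C where "C = map_mat (of_int :: int \<Rightarrow> complex) A"
  have A: "A \<in> carrier_mat n n" and C: "C \<in> carrier_mat n n" by (auto simp: A_def C_def)
  define v where "v = vec n f"
  have eq: "C *\<^sub>v v = z \<cdot>\<^sub>v v"
  proof (rule eq_vecI)
    fix i assume i: "i < dim_vec (z \<cdot>\<^sub>v v)"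
    then have i: "i < n" by (simp add: v_def)
    have "(C *\<^sub>v v) $ i = (\<Sum>j<n. of_int (u (f i) (f j)) * f j)"
      using i by (simp add: C_def A_def v_def scalar_prod_def atLeast0LessThan)
    also have "\<dots> = (\<Sum>c\<in>B. of_int (u (f i) c) * c)"
      by (rule sum.reindex_bij_betw[OF f])
    also have "\<dots> = z * f i" using u[OF fin[OF i]] by simp
    finally show "(C *\<^sub>v v) $ i = (z \<cdot>\<^sub>v v) $ i" using i by (simp add: v_def)
  qed (auto simp: C_def A_def v_def)
  obtain i where i: "i < n" "f i = b" using f assms(2) by (auto simp: bij_betw_def)
  have "v \<noteq> 0\<^sub>v n"
  proof
    assume "v = 0\<^sub>v n"
    then have "v $ i = 0" using i by simp
    then show False using i assms(3) by (simp add: v_def)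
  qed
  then have "eigenvector C v z" using eq unfolding eigenvector_def by (auto simp: C_def A_def v_def)
  then have root: "poly (char_poly C) z = 0"
    using eigenvalue_root_char_poly[OF C] eigenvalue_def by blast
  have "char_poly C = map_poly of_int (char_poly A)"
    unfolding C_def by (rule of_int_hom.char_poly_hom[OF A])
  moreover have "lead_coeff (char_poly A) = 1" using degree_monic_char_poly[OF A] by auto
  ultimately show ?thesis using root by (auto simp: algebraic_int_altdef_ipoly)
qed

lemma algebraic_int_power_in_span:
  assumes "algebraic_int (x :: complex)"
  obtains n where "n > 0" "x ^ n \<in> zmod.span {x ^ i | i. i < n}"
proof -
  obtain p where p: "poly (map_poly of_int p) x = 0" "lead_coeff p = 1"
    using assms by (auto simp: algebraic_int_altdef_ipoly)
  define n where "n = degree p"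
  have "n > 0"
  proof (rule ccontr)
    assume "\<not> n > 0"
    then have "p = 1" using p(2) by (auto simp: n_def elim!: degree_eq_zeroE)
    then show False using p(1) by simp
  qed
  have "0 = (\<Sum>i\<le>n. of_int (coeff p i) * x ^ i)"
    using p(1) by (simp add: poly_altdef n_def coeff_map_poly degree_map_poly)
  also have "\<dots> = (\<Sum>i<n. of_int (coeff p i) * x ^ i) + x ^ n"
    using p(2) by (simp add: n_def lessThan_Suc_atMost[symmetric])
  finally have "x ^ n = - (\<Sum>i<n. of_int (coeff p i) * x ^ i)" by (simp add: eq_neg_iff_add_eq_0 add.commute)
  also have "\<dots> \<in> zmod.span {x ^ i | i. i < n}"
    by (intro zmod.span_neg zmod.span_sum zmod.span_scale zmod.span_base) auto
  finally show ?thesis using that \<open>n > 0\<close> by blast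
qed

text \<open>The finitely many products \<open>x ^ i * y ^ j\<close> of low exponents span a Z-module
  stable under multiplication by \<open>x\<close> and by \<open>y\<close>, hence by their sum and
  product.\<close>

lemma algebraic_int_add_mult:
  assumes "algebraic_int x" "algebraic_int (y :: complex)"
  shows algebraic_int_add: "algebraic_int (x + y)" and algebraic_int_mult: "algebraic_int (x * y)"
proof -
  obtain m where m: "m > 0" "x ^ m \<in> zmod.span {x ^ i | i. i < m}"
    using algebraic_int_power_in_span[OF assms(1)] .
  obtain n where n: "n > 0" "y ^ n \<in> zmod.span {y ^ i | i. i < n}"
    using algebraic_int_power_in_span[OF assms(2)] .
  define B where "B = (\<lambda>(i,j). x ^ i * y ^ j) ` ({..<m} \<times> {..<n})"
  have mult_span: "z * w \<in> zmod.span B"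
    if "w \<in> zmod.span S" "\<And>s. s \<in> S \<Longrightarrow> z * s \<in> zmod.span B" for z w S
    using that(1)
  proof (induction rule: zmod.span_induct_alt)
    case base then show ?case by (simp add: zmod.span_zero)
  next
    case (step c s w)
    have "z * (of_int c * s + w) = of_int c * (z * s) + z * w" by (simp add: algebra_simps)
    then show ?case using step that(2)[of s] by (simp add: zmod.span_add zmod.span_scale)
  qed
  have base: "x ^ i * y ^ j \<in> zmod.span B" if "i < m" "j < n" for i j
    using that by (intro zmod.span_base) (auto simp: B_def)
  have xB: "x * b \<in> zmod.span B" if b: "b \<in> B" for b
  proof -
    obtain i j where ij: "b = x ^ i * y ^ j" "i < m" "j < n" using b by (auto simp: B_def)
    show ?thesis
    proof (cases "Suc i < m")
      case True then show ?thesis using base[OF True ij(3)] ij by (simp add: mult_ac)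
    next
      case False
      \<comment> \<open>The exponent has reached the degree of the monic relation of
        \<open>x\<close>, which rewrites \<open>x ^ m\<close> in lower powers.\<close>
      then have "Suc i = m" using ij by simp
      then have "x * b = y ^ j * x ^ m" using ij(1) by (auto simp: mult_ac)
      moreover have "y ^ j * x ^ m \<in> zmod.span B"
        by (rule mult_span[OF m(2)]) (use base ij in \<open>auto simp: mult.commute[of "y ^ j"]\<close>)
      ultimately show ?thesis by simp
    qed
  qed
  have yB: "y * b \<in> zmod.span B" if b: "b \<in> B" for b
  proof -
    obtain i j where ij: "b = x ^ i * y ^ j" "i < m" "j < n" using b by (auto simp: B_def)
    show ?thesis
    proof (cases "Suc j < n")
      case True then show ?thesis using base[OF ij(2) True] ij by (simp add: mult_ac)
    next
      case False
      then have "Suc j = n" using ij by simp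
      then have "y * b = x ^ i * y ^ n" using ij(1) by (auto simp: mult_ac)
      moreover have "x ^ i * y ^ n \<in> zmod.span B"
        by (rule mult_span[OF n(2)]) (use base ij in auto)
      ultimately show ?thesis by simp
    qed
  qed
  have fin: "finite B" by (simp add: B_def)
  have "1 \<in> B" using m(1) n(1) by (auto simp: B_def intro!: image_eqI[of _ _ "(0,0)"])
  note st = algebraic_int_stable_lattice[OF fin this]
  show "algebraic_int (x + y)"
    by (rule st) (auto simp: distrib_right intro!: zmod.span_add xB yB)
  show "algebraic_int (x * y)"
    by (rule st) (auto simp: mult.assoc intro: mult_span[OF yB xB])
qed

lemma algebraic_int_diff: "algebraic_int x \<Longrightarrow> algebraic_int y \<Longrightarrow> algebraic_int (x - y :: complex)"
  using algebraic_int_add[of x "-y"] by auto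

lemma algebraic_int_power: "algebraic_int x \<Longrightarrow> algebraic_int (x ^ n :: complex)"
  by (induction n) (auto intro: algebraic_int_mult)

lemma algebraic_int_sum: "(\<And>i. i \<in> A \<Longrightarrow> algebraic_int (f i :: complex)) \<Longrightarrow> algebraic_int (sum f A)"
  by (induction A rule: infinite_finite_induct) (auto intro: algebraic_int_add)

lemma algebraic_int_of_power:
  assumes "algebraic_int (x ^ n :: complex)" "n > 0"
  shows "algebraic_int x"
  by (rule algebraic_int_root[OF assms(1), of "Polynomial.monom 1 n"])
     (use assms(2) in \<open>auto simp: poly_monom degree_monom_eq\<close>)

lemmas algebraic_int_intros =
  algebraic_int_add algebraic_int_mult algebraic_int_diff algebraic_int_power algebraic_int_minus

lemma ring_of_integers_closed:
  assumes "subfield K complex_ring"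
  defines "R \<equiv> ring_of_integers K"
  shows "0 \<in> R" "1 \<in> R" "\<And>x y. x \<in> R \<Longrightarrow> y \<in> R \<Longrightarrow> x + y \<in> R"
    "\<And>x y. x \<in> R \<Longrightarrow> y \<in> R \<Longrightarrow> x * y \<in> R" "\<And>x. x \<in> R \<Longrightarrow> - x \<in> R"
    "\<And>x y. x \<in> R \<Longrightarrow> y \<in> R \<Longrightarrow> x - y \<in> R" "\<And>x n. x \<in> R \<Longrightarrow> x ^ n \<in> R" "\<And>n. of_int n \<in> R"
  using subfield_complexD[OF assms(1)]
  by (auto simp: R_def ring_of_integers_def intro: algebraic_int_intros)

section \<open>Quadratic extensions\<close>

text \<open>The field F(t) when the square of \<open>t\<close> lies in \<open>F\<close>. The
  degenerate case \<open>t \<in> F\<close> is allowed and returns \<open>F\<close>, so later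
  arguments need not decide whether a square root already lies in the base field.\<close>

definition quad_ext :: "complex set \<Rightarrow> complex \<Rightarrow> complex set" where
  "quad_ext F t = {u + v * t | u v. u \<in> F \<and> v \<in> F}"

lemma quad_extI: "u \<in> F \<Longrightarrow> v \<in> F \<Longrightarrow> u + v * t \<in> quad_ext F t"
  by (auto simp: quad_ext_def)

lemma quad_ext_unique:
  assumes "subfield F complex_ring" "t \<notin> F" "u \<in> F" "v \<in> F" "u' \<in> F" "v' \<in> F"
    "u + v * t = u' + v' * t"
  shows "u = u' \<and> v = v'"
proof (cases "v = v'")
  case False
  have "t = (u' - u) / (v - v')" using assms(7) False by (simp add: field_simps)
  then have "t \<in> F" using assms subfield_complexD(7,8)[OF assms(1)] by auto
  then show ?thesis using assms by simp
qed (use assms in auto)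

lemma quad_ext_base: "subfield F complex_ring \<Longrightarrow> F \<subseteq> quad_ext F t"
  using quad_extI[of _ F 0 t] subfield_complexD(1)[of F] by auto

lemma quad_ext_gen: "subfield F complex_ring \<Longrightarrow> t \<in> quad_ext F t"
  using quad_extI[of 0 F 1 t] subfield_complexD(1,2)[of F] by auto

lemma quad_ext_subfield:
  assumes F: "subfield F complex_ring" and t: "t\<^sup>2 \<in> F"
  shows "subfield (quad_ext F t) complex_ring"
proof (cases "t \<in> F")
  case True
  have "quad_ext F t = F"
    using quad_ext_base[OF F] True subfield_complexD(3,4)[OF F] by (auto simp: quad_ext_def)
  then show ?thesis using F by simp
next
  case False
  note Fs = subfield_complexD[OF F]
  show ?thesis
  proof (rule subfield_complexI)
    show "1 \<in> quad_ext F t" using quad_ext_base[OF F] Fs by auto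
  next
    fix x y assume "x \<in> quad_ext F t" "y \<in> quad_ext F t"
    then obtain u v u' v' where uv: "x = u + v * t" "y = u' + v' * t" "u \<in> F" "v \<in> F" "u' \<in> F" "v' \<in> F"
      by (auto simp: quad_ext_def)
    have "x + y = (u + u') + (v + v') * t" using uv by (simp add: algebra_simps)
    then show "x + y \<in> quad_ext F t" using Fs(3) uv(3-) by (simp only: quad_extI)
    have "x * y = (u * u' + v * v' * t\<^sup>2) + (u * v' + v * u') * t"
      using uv by (simp add: algebra_simps power2_eq_square)
    then show "x * y \<in> quad_ext F t" using Fs(3,4) t uv(3-) by (simp only: quad_extI)
  next
    fix x assume "x \<in> quad_ext F t"
    then obtain u v where uv: "x = u + v * t" "u \<in> F" "v \<in> F" by (auto simp: quad_ext_def)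
    have "- x = (- u) + (- v) * t" using uv by simp
    then show "- x \<in> quad_ext F t" using Fs(5) uv by (metis quad_extI)
    show "inverse x \<in> quad_ext F t"
    proof (cases "x = 0")
      case True then show ?thesis using quad_ext_base[OF F] Fs(1) by auto
    next
      case x0: False
      \<comment> \<open>The conjugate is nonzero by independence of 1 and \<open>t\<close>, so
        inverses are obtained by rationalizing the denominator.\<close>
      have "u - v * t \<noteq> 0"
      proof
        assume "u - v * t = 0"
        then have "u + (- v) * t = 0 + 0 * t" by simp
        from quad_ext_unique[OF F False _ _ _ _ this] have "u = 0" "v = 0" using Fs uv by auto
        then show False using x0 uv by simp
      qed
      then have "x * (u - v * t) \<noteq> 0" using x0 by simp
      moreover have "x * (u - v * t) = u\<^sup>2 - v\<^sup>2 * t\<^sup>2" using uv by (simp add: algebra_simps power2_eq_square)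
      ultimately have N: "u\<^sup>2 - v\<^sup>2 * t\<^sup>2 \<noteq> 0" by simp
      have "inverse x = (u - v * t) / (x * (u - v * t))"
        using x0 \<open>u - v * t \<noteq> 0\<close> by (simp add: field_simps)
      also have "\<dots> = u / (u\<^sup>2 - v\<^sup>2 * t\<^sup>2) + (- v / (u\<^sup>2 - v\<^sup>2 * t\<^sup>2)) * t"
        unfolding \<open>x * (u - v * t) = _\<close> by (simp add: diff_divide_distrib)
      finally have "inverse x = u / (u\<^sup>2 - v\<^sup>2 * t\<^sup>2) + (- v / (u\<^sup>2 - v\<^sup>2 * t\<^sup>2)) * t" .
      moreover have "u / (u\<^sup>2 - v\<^sup>2 * t\<^sup>2) \<in> F" "- v / (u\<^sup>2 - v\<^sup>2 * t\<^sup>2) \<in> F"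
        using Fs uv(2,3) t by simp_all
      ultimately show ?thesis using quad_extI by metis
    qed
  qed
qed

lemma quad_ext_least:
  "subfield E complex_ring \<Longrightarrow> F \<subseteq> E \<Longrightarrow> t \<in> E \<Longrightarrow> quad_ext F t \<subseteq> E"
  using subfield_complexD(3,4)[of E] by (auto simp: quad_ext_def subset_iff)

text \<open>Conjugation is well defined because coordinates with respect to 1 and \<open>t\<close>
  are unique. It serves both for integrality of conjugates and for the Galois group of a quadratic
  field.\<close>

lemma quad_ext_conj:
  assumes F: "subfield F complex_ring" and t: "t\<^sup>2 \<in> F" "t \<notin> F"
  obtains c where "\<forall>u\<in>F. \<forall>v\<in>F. c (u + v * t) = u - v * t"
    "\<forall>x\<in>quad_ext F t. \<forall>y\<in>quad_ext F t. c (x + y) = c x + c y"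
    "\<forall>x\<in>quad_ext F t. \<forall>y\<in>quad_ext F t. c (x * y) = c x * c y"
    "\<forall>x\<in>F. c x = x" "\<forall>x\<in>quad_ext F t. c x \<in> quad_ext F t"
proof -
  note Fs = subfield_complexD[OF F]
  define c where "c x = (THE y. \<exists>u v. u \<in> F \<and> v \<in> F \<and> x = u + v * t \<and> y = u - v * t)" for x
  have c: "c (u + v * t) = u - v * t" if "u \<in> F" "v \<in> F" for u v
    unfolding c_def by (rule the_equality) (use that quad_ext_unique[OF F t(2)] in blast)+
  show ?thesis
  proof (rule that[of c]; intro ballI)
    fix x y assume "x \<in> quad_ext F t" "y \<in> quad_ext F t"
    then obtain u v u' v' where uv: "x = u + v * t" "y = u' + v' * t" "u \<in> F" "v \<in> F" "u' \<in> F" "v' \<in> F"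
      by (auto simp: quad_ext_def)
    have "x + y = (u + u') + (v + v') * t" using uv by (simp add: algebra_simps)
    then have "c (x + y) = (u + u') - (v + v') * t" using c Fs(3) uv(3-) by (simp only:)
    also have "\<dots> = (u - v * t) + (u' - v' * t)" by (simp add: algebra_simps)
    also have "\<dots> = c x + c y" using uv(3-) c by (simp only: uv(1,2))
    finally show "c (x + y) = c x + c y" .
    have "x * y = (u * u' + v * v' * t\<^sup>2) + (u * v' + v * u') * t"
      using uv by (simp add: algebra_simps power2_eq_square)
    then have "c (x * y) = (u * u' + v * v' * t\<^sup>2) - (u * v' + v * u') * t"
      using Fs(3,4) t uv(3-) c by (simp only:)
    also have "\<dots> = (u - v * t) * (u' - v' * t)" by (simp add: algebra_simps power2_eq_square)
    also have "\<dots> = c x * c y" using uv(3-) c by (simp only: uv(1,2))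
    finally show "c (x * y) = c x * c y" .
  next
    show "c x = x" if "x \<in> F" for x using c[of x 0] Fs that by simp
  next
    fix x assume "x \<in> quad_ext F t"
    then obtain u v where uv: "x = u + v * t" "u \<in> F" "v \<in> F" by (auto simp: quad_ext_def)
    then have "c x = u + (- v) * t" using c by simp
    then show "c x \<in> quad_ext F t" using uv Fs(5) by (metis quad_extI)
  qed (use c in auto)
qed

section \<open>Embeddings of subfields of the complex numbers\<close>

definition field_emb :: "complex set \<Rightarrow> (complex \<Rightarrow> complex) \<Rightarrow> bool" where
  "field_emb K s \<longleftrightarrow>
     s 1 = 1 \<and> (\<forall>x\<in>K. \<forall>y\<in>K. s (x + y) = s x + s y \<and> s (x * y) = s x * s y)"

text \<open>Embeddings in the trace, field automorphisms and isomorphisms of fields all reduce to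
  \<open>field_emb\<close>; extensionality and bijectivity are treated separately.\<close>

lemma field_emb_iff_ring_hom:
  "s \<in> Ring.ring_hom (sub_ring K) complex_ring \<longleftrightarrow> field_emb K s"
  "s \<in> Ring.ring_hom (sub_ring K) (sub_ring L) \<longleftrightarrow> field_emb K s \<and> s \<in> K \<rightarrow> L"
  by (auto simp: Ring.ring_hom_def field_emb_def)

lemma field_emb_fixes:
  assumes K: "subfield K complex_ring" and s: "field_emb K s"
  shows "s (of_int n) = of_int n" "q \<in> \<rat> \<Longrightarrow> s q = q" "x \<in> K \<Longrightarrow> s (x ^ m) = s x ^ m"
proof -
  note Ks = subfield_complexD[OF K]
  have s1: "s 1 = 1" and sadd: "\<And>x y. x \<in> K \<Longrightarrow> y \<in> K \<Longrightarrow> s (x + y) = s x + s y"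
    and smult: "\<And>x y. x \<in> K \<Longrightarrow> y \<in> K \<Longrightarrow> s (x * y) = s x * s y"
    using s by (auto simp: field_emb_def)
  have s0: "s 0 = 0" using sadd[of 0 0] Ks(1) by simp
  have nat: "of_nat n \<in> K \<and> s (of_nat n) = of_nat n" for n
    by (induction n) (use s0 s1 sadd Ks in \<open>simp_all\<close>)
  have neg: "s (- x) = - s x" if "x \<in> K" for x
    using sadd[of x "- x"] Ks(5)[OF that] that s0 by (simp add: eq_neg_iff_add_eq_0 add.commute)
  show int: "s (of_int n) = of_int n" for n
    by (cases n) (use nat neg in \<open>auto simp del: of_nat_Suc\<close>)
  show "s q = q" if "q \<in> \<rat>"
  proof -
    obtain a d where ad: "d > 0" "q = of_int a / of_int d" using \<open>q \<in> \<rat>\<close> by (auto elim: Rats_cases')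
    have "q \<in> K" using that Ks(11) by auto
    then have "s q * of_int d = s (q * of_int d)" using smult int Ks(10) by simp
    also have "\<dots> = of_int a" using ad int by simp
    finally have "s q = of_int a / of_int d" using ad(1) by (simp add: field_simps)
    then show ?thesis using ad(2) by simp
  qed
  show "s (x ^ m) = s x ^ m" if "x \<in> K"
    by (induction m) (use s1 smult that Ks(9) in auto)
qed

lemma field_emb_algebraic_int:
  assumes K: "subfield K complex_ring" and s: "field_emb K s" and x: "x \<in> K" "algebraic_int x"
  shows "algebraic_int (s x)"
proof -
  note Ks = subfield_complexD[OF K] and fx = field_emb_fixes[OF K s]
  have sadd: "\<And>x y. x \<in> K \<Longrightarrow> y \<in> K \<Longrightarrow> s (x + y) = s x + s y"
    and smult: "\<And>x y. x \<in> K \<Longrightarrow> y \<in> K \<Longrightarrow> s (x * y) = s x * s y"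
    using s by (auto simp: field_emb_def)
  obtain p where p: "poly (map_poly of_int p) x = 0" "lead_coeff p = 1"
    using x(2) by (auto simp: algebraic_int_altdef_ipoly)
  have "poly (map_poly of_int q) x \<in> K \<and>
      s (poly (map_poly of_int q) x) = poly (map_poly of_int q) (s x)" for q
  proof (induction q rule: pCons_induct)
    case 0 then show ?case using Ks(1) fx(1)[of 0] by simp
  next
    case (pCons a q)
    have "poly (map_poly of_int (pCons a q)) y = of_int a + y * poly (map_poly of_int q) y"
      for y :: complex
      using pCons.hyps by (simp add: map_poly_pCons)
    then show ?case using pCons.IH Ks(3,4,10) fx(1) x(1) by (simp add: sadd smult)
  qed
  then have "poly (map_poly of_int p) (s x) = 0" using p(1) fx(1)[of 0] by (metis of_int_0)
  then show ?thesis using p(2) by (auto simp: algebraic_int_altdef_ipoly)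
qed

text \<open>Makes the trace and the difference of an integral element and its conjugate integral,
  although \<open>u\<close> and \<open>v\<close> themselves may have denominators.\<close>

lemma quad_ext_conj_algebraic_int:
  assumes F: "subfield F complex_ring" and t: "t\<^sup>2 \<in> F" "t \<notin> F" and uv: "u \<in> F" "v \<in> F"
    and int: "algebraic_int (u + v * t)"
  shows "algebraic_int (u - v * t)"
proof -
  note Fs = subfield_complexD[OF F]
  obtain c where c: "\<forall>u\<in>F. \<forall>v\<in>F. c (u + v * t) = u - v * t"
    "\<forall>x\<in>quad_ext F t. \<forall>y\<in>quad_ext F t. c (x + y) = c x + c y"
    "\<forall>x\<in>quad_ext F t. \<forall>y\<in>quad_ext F t. c (x * y) = c x * c y"
    "\<forall>x\<in>F. c x = x" "\<forall>x\<in>quad_ext F t. c x \<in> quad_ext F t"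
    using quad_ext_conj[OF F t] .
  then have "field_emb (quad_ext F t) c" using Fs(2) by (auto simp: field_emb_def)
  from field_emb_algebraic_int[OF quad_ext_subfield[OF F t(1)] this _ int] quad_extI[OF uv] uv c
  show ?thesis by auto
qed

section \<open>Pure quartic fields\<close>

text \<open>If \<open>t\<^sup>4 = b c\<^sup>3\<close> with \<open>b c\<close> squarefree, then \<open>1, t, t\<^sup>2/c, t\<^sup>3/c\<^sup>2\<close> are integral and span an order of
  discriminant \<open>-256 (b c)\<^sup>3\<close>; \<open>qel c t\<close> takes coordinates in this basis.\<close>

definition qel :: "int \<Rightarrow> complex \<Rightarrow> complex \<Rightarrow> complex \<Rightarrow> complex \<Rightarrow> complex \<Rightarrow> complex" where
  "qel c t w x y z = w + x * t + y * (t ^ 2 / of_int c) + z * (t ^ 3 / of_int c ^ 2)"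

definition qfield :: "int \<Rightarrow> complex \<Rightarrow> complex set" where
  "qfield c t = {qel c t w x y z | w x y z. w \<in> \<rat> \<and> x \<in> \<rat> \<and> y \<in> \<rat> \<and> z \<in> \<rat>}"

text \<open>The fourth power of \<open>k t^3 / p\<close> is \<open>k^4 m^3 / p\<close>. Being
  rational and integral it is an integer, and \<open>p\<close> does not divide
  \<open>m\<close>.\<close>

lemma prime_dvd_if_algebraic_int_quartic:
  fixes p k m :: int
  assumes "Factorial_Ring.prime p" "\<not> p dvd m" "t ^ 4 = of_int (p * m)"
    and int: "algebraic_int (of_int k * t ^ 3 / of_int p :: complex)"
  shows "p dvd k"
proof -
  have p: "p \<noteq> 0" using assms(1) by auto
  have t12: "t ^ 12 = of_int (p ^ 3 * m ^ 3)"
    using arg_cong[OF assms(3), of "\<lambda>x. x ^ 3"] by (simp add: power_mult_distrib flip: power_mult)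
  have eq: "(of_int k * t ^ 3 / of_int p) ^ 4 = (of_int (k ^ 4 * m ^ 3) / of_int p :: complex)"
    using p by (simp add: power_mult_distrib power_divide t12 flip: power_mult)
      (use p in \<open>simp add: frac_eq_eq eval_nat_numeral\<close>)
  have "algebraic_int (of_int (k ^ 4 * m ^ 3) / of_int p :: complex)"
    using algebraic_int_power[OF int, of 4] eq by simp
  moreover have "of_int (k ^ 4 * m ^ 3) / of_int p \<in> (\<rat> :: complex set)" by auto
  ultimately have "of_int (k ^ 4 * m ^ 3) / of_int p \<in> (\<int> :: complex set)"
    by (rule rational_algebraic_int_is_int)
  then obtain j where "of_int (k ^ 4 * m ^ 3) / of_int p = (of_int j :: complex)" by (auto elim: Ints_cases)
  then have "(of_int (k ^ 4 * m ^ 3) :: complex) = of_int (p * j)" using p by (simp add: field_simps)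
  then have "k ^ 4 * m ^ 3 = p * j" by (simp only: of_int_eq_iff)
  then have "p dvd k ^ 4 * m ^ 3" by simp
  then show ?thesis using assms(1,2) by (auto simp: prime_dvd_mult_iff prime_dvd_power_iff)
qed

text \<open>Multiplying by \<open>t\<^bsup>3-i\<^esup>\<close> isolates the \<open>i\<close>-th coefficient, since \<open>t\<^sup>4/p\<close> is integral.\<close>

lemma eisenstein_saturated:
  fixes p m w x y z :: int
  assumes p: "Factorial_Ring.prime p" "\<not> p dvd m" and t: "t ^ 4 = of_int (p * m)"
    and int: "algebraic_int ((of_int w + of_int x * t + of_int y * t ^ 2 + of_int z * t ^ 3) / of_int p :: complex)"
  shows "p dvd w \<and> p dvd x \<and> p dvd y \<and> p dvd z"
proof -
  have p0: "of_int p \<noteq> (0 :: complex)" using p(1) by auto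
  note key = prime_dvd_if_algebraic_int_quartic[OF p t]
  have "algebraic_int (t ^ 4)" unfolding t by (rule algebraic_int_of_int)
  then have at: "algebraic_int t" by (rule algebraic_int_of_power) simp
  note ai = algebraic_int_intros at algebraic_int_of_int
  have shift: "algebraic_int (C / of_int p)"
    if "algebraic_int (A / of_int p)" "algebraic_int T" "algebraic_int B" "A * T = C + t ^ 4 * B"
    for A B C T :: complex
  proof -
    have "C / of_int p = A / of_int p * T - of_int m * B"
      using that(4) p0 by (simp add: t field_simps)
    then show ?thesis using that ai by metis
  qed
  \<comment> \<open>A coefficient already known to be divisible by \<open>p\<close> contributes an
    integral term, which is removed before the next coefficient is isolated.\<close>
  have drop: "algebraic_int (B / of_int p)"
    if "algebraic_int (A / of_int p)" "algebraic_int T" "A = of_int (p * k) * T + B"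
    for A B T :: complex and k
  proof -
    have "B / of_int p = A / of_int p - of_int k * T"
      using that(3) p0 by (simp add: field_simps)
    then show ?thesis using that ai by metis
  qed
  note ring = algebra_simps eval_nat_numeral
  have "algebraic_int (of_int w * t ^ 3 / of_int p)"
    by (rule shift[OF int, of "t ^ 3" "of_int x + of_int y * t + of_int z * t ^ 2"])
       (intro ai, intro ai, simp add: ring)
  then have w: "p dvd w" by (rule key)
  then obtain w' where w': "w = p * w'" by auto
  have int: "algebraic_int ((of_int x * t + of_int y * t ^ 2 + of_int z * t ^ 3) / of_int p)"
    by (rule drop[OF int, of 1 w']) (simp_all add: w')
  have "algebraic_int (of_int x * t ^ 3 / of_int p)"
    by (rule shift[OF int, of "t ^ 2" "of_int y + of_int z * t"])
       (intro ai, intro ai, simp add: ring)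
  then have x: "p dvd x" by (rule key)
  then obtain x' where x': "x = p * x'" by auto
  have int: "algebraic_int ((of_int y * t ^ 2 + of_int z * t ^ 3) / of_int p)"
    by (rule drop[OF int, of t x']) (use at in \<open>simp_all add: x'\<close>)
  have "algebraic_int (of_int y * t ^ 3 / of_int p)"
    by (rule shift[OF int, of t "of_int z"]) (intro ai, intro ai, simp add: ring)
  then have y: "p dvd y" by (rule key)
  then obtain y' where y': "y = p * y'" by auto
  have "algebraic_int (of_int z * t ^ 3 / of_int p)"
    by (rule drop[OF int, of "t ^ 2" y']) (use ai in \<open>simp_all add: y'\<close>)
  then have z: "p dvd z" by (rule key)
  show ?thesis using w x y z by blast
qed

lemma common_denominator4:
  assumes "w \<in> \<rat>" "x \<in> \<rat>" "y \<in> \<rat>" "z \<in> (\<rat> :: complex set)"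
  obtains N w' x' y' z' :: int where "N > 0" "of_int N * w = of_int w'" "of_int N * x = of_int x'"
    "of_int N * y = of_int y'" "of_int N * z = of_int z'"
proof -
  obtain a1 d1 where 1: "d1 > 0" "w = of_int a1 / of_int d1" using assms(1) by (auto elim: Rats_cases')
  obtain a2 d2 where 2: "d2 > 0" "x = of_int a2 / of_int d2" using assms(2) by (auto elim: Rats_cases')
  obtain a3 d3 where 3: "d3 > 0" "y = of_int a3 / of_int d3" using assms(3) by (auto elim: Rats_cases')
  obtain a4 d4 where 4: "d4 > 0" "z = of_int a4 / of_int d4" using assms(4) by (auto elim: Rats_cases')
  show ?thesis
    by (rule that[of "d1 * d2 * d3 * d4" "a1 * d2 * d3 * d4" "a2 * d1 * d3 * d4" "a3 * d1 * d2 * d4" "a4 * d1 * d2 * d3"])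
      (use 1 2 3 4 in simp_all)
qed

text \<open>\<open>nonunit\<close> supplies a prime of \<open>b * c\<close>. There the quartic is
  Eisenstein, possibly after exchanging \<open>b\<close> and \<open>c\<close>, and this yields the
  independence of the basis. Both \<open>b\<close> and \<open>c\<close> may be negative.\<close>

locale pure_quartic =
  fixes b c :: int and t :: complex
  assumes root: "t ^ 4 = of_int (b * c ^ 3)" and sqfree: "squarefree (b * c)"
    and nonunit: "\<not> is_unit (b * c)"
begin

lemma bc_nz: "b \<noteq> 0" "c \<noteq> 0" using sqfree by auto

lemma t_nz: "t \<noteq> 0" using root bc_nz by auto

text \<open>Exchanges the primes dividing \<open>b\<close> with those dividing \<open>c\<close>, so only the former need an argument.\<close>

lemma swap: "pure_quartic c b (t ^ 3 / of_int c ^ 2)"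
proof
  have "(t ^ 3 / of_int c ^ 2) ^ 4 = t ^ 4 * t ^ 4 * t ^ 4 / of_int c ^ 8"
    by (simp add: power_divide eval_nat_numeral mult.assoc)
  also have "\<dots> = of_int (c * b ^ 3)"
    unfolding root using bc_nz by (subst divide_eq_eq) (simp add: algebra_simps eval_nat_numeral)
  finally show "(t ^ 3 / of_int c ^ 2) ^ 4 = of_int (c * b ^ 3)" .
qed (use sqfree nonunit in \<open>simp_all add: mult.commute\<close>)

lemma beta_sq: "(t ^ 2 / of_int c)\<^sup>2 = of_int (b * c)"
proof -
  have "(t ^ 2 / of_int c)\<^sup>2 = t ^ 4 / of_int c ^ 2" by (simp add: power_divide flip: power_mult)
  also have "\<dots> = of_int (b * c)"
    unfolding root using bc_nz by (subst divide_eq_eq) (simp add: algebra_simps eval_nat_numeral)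
  finally show ?thesis .
qed

lemma qel_swap: "qel b (t ^ 3 / of_int c ^ 2) w z y x = qel c t w x y z"
proof -
  have "(t ^ 3 / of_int c ^ 2) ^ 2 / of_int b = t ^ 4 * t ^ 2 / (of_int c ^ 4 * of_int b)"
    by (simp add: power_divide eval_nat_numeral mult.assoc)
  also have "\<dots> = t ^ 2 / of_int c"
    unfolding root using bc_nz by (subst frac_eq_eq) (simp_all add: algebra_simps eval_nat_numeral)
  finally have 1: "(t ^ 3 / of_int c ^ 2) ^ 2 / of_int b = t ^ 2 / of_int c" .
  have "(t ^ 3 / of_int c ^ 2) ^ 3 / of_int b ^ 2 = t ^ 4 * t ^ 4 * t / (of_int c ^ 6 * of_int b ^ 2)"
    by (simp add: power_divide eval_nat_numeral mult.assoc)
  also have "\<dots> = t"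
    unfolding root using bc_nz by (subst divide_eq_eq) (simp add: algebra_simps eval_nat_numeral)
  finally have 2: "(t ^ 3 / of_int c ^ 2) ^ 3 / of_int b ^ 2 = t" .
  show ?thesis unfolding qel_def 1 2 by (simp add: algebra_simps)
qed

text \<open>At a prime \<open>p\<close> of \<open>b\<close> the number \<open>c\<close> is a unit,
  so multiplication by the square of \<open>c\<close> turns the basis into powers of
  \<open>t\<close> without affecting divisibility by \<open>p\<close>; then \<open>t ^ 4\<close> is
  exactly divisible by \<open>p\<close>.\<close>

lemma saturated_b:
  assumes p: "Factorial_Ring.prime p" "p dvd b"
    and int: "algebraic_int (qel c t (of_int w) (of_int x) (of_int y) (of_int z) / of_int p)"
  shows "p dvd w \<and> p dvd x \<and> p dvd y \<and> p dvd z"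
proof -
  obtain b' where b': "b = p * b'" using p by auto
  have p2: "\<not> p\<^sup>2 dvd b * c"
    using sqfree p(1) not_prime_unit unfolding squarefree_def by blast
  have "p\<^sup>2 dvd b * c" if "p dvd c" using mult_dvd_mono[OF p(2) that] by (simp add: power2_eq_square)
  moreover have "p\<^sup>2 dvd b * c" if "p dvd b'"
    using mult_dvd_mono[OF dvd_refl[of p] that] unfolding b' by (simp add: power2_eq_square)
  ultimately have ndvd: "\<not> p dvd c" "\<not> p dvd b'" using p2 by auto
  have m: "\<not> p dvd b' * c ^ 3" using ndvd p(1) by (auto simp: prime_dvd_mult_iff prime_dvd_power_iff)
  have t4: "t ^ 4 = of_int (p * (b' * c ^ 3))" using root b' by simp
  have "algebraic_int (of_int c ^ 2 * (qel c t (of_int w) (of_int x) (of_int y) (of_int z) / of_int p))"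
    by (intro algebraic_int_intros int) auto
  also have "of_int c ^ 2 * (qel c t (of_int w) (of_int x) (of_int y) (of_int z) / of_int p) =
    (of_int (c\<^sup>2 * w) + of_int (c\<^sup>2 * x) * t + of_int (c * y) * t ^ 2 + of_int z * t ^ 3) / of_int p"
  proof -
    define B D where "B = t ^ 2 / of_int c" and "D = t ^ 3 / of_int c ^ 2"
    have e: "of_int c ^ 2 * B = of_int c * t ^ 2" "of_int c ^ 2 * D = t ^ 3"
      using bc_nz by (simp_all add: B_def D_def power2_eq_square[of "of_int c"])
    have "of_int c ^ 2 * qel c t (of_int w) (of_int x) (of_int y) (of_int z) =
      of_int (c\<^sup>2 * w) + of_int (c\<^sup>2 * x) * t + of_int y * (of_int c ^ 2 * B) + of_int z * (of_int c ^ 2 * D)"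
      unfolding qel_def B_def[symmetric] D_def[symmetric] by (simp add: algebra_simps)
    then show ?thesis unfolding e by (simp add: mult_ac)
  qed
  finally have "p dvd c\<^sup>2 * w \<and> p dvd c\<^sup>2 * x \<and> p dvd c * y \<and> p dvd z"
    by (rule eisenstein_saturated[OF p(1) m t4])
  then show ?thesis using ndvd p(1) by (auto simp: prime_dvd_mult_iff prime_dvd_power_iff)
qed

lemma saturated:
  assumes p: "Factorial_Ring.prime p" "p dvd b * c"
    and int: "algebraic_int (qel c t (of_int w) (of_int x) (of_int y) (of_int z) / of_int p)"
  shows "p dvd w \<and> p dvd x \<and> p dvd y \<and> p dvd z"
proof (cases "p dvd b")
  case True then show ?thesis using saturated_b p(1) int by blast
next
  case False
  interpret s: pure_quartic c b "t ^ 3 / of_int c ^ 2" by (rule swap)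
  have "p dvd c" using p False by (auto simp: prime_dvd_mult_iff)
  then show ?thesis using s.saturated_b[OF p(1), of w z y x] int by (auto simp: qel_swap)
qed

lemma obtain_prime: obtains p :: int where "Factorial_Ring.prime p" "p dvd b * c"
  using nonunit bc_nz prime_divisor_exists[of "b * c"] by auto

text \<open>Infinite descent: 0 divided by a prime \<open>p\<close> of \<open>b * c\<close> is still
  integral, so by saturation all four coordinates of a relation can be divided by \<open>p\<close>,
  which shrinks the sum of their absolute values.\<close>

lemma qel_eq_0_int:
  "qel c t (of_int w) (of_int x) (of_int y) (of_int z) = 0 \<Longrightarrow> w = 0 \<and> x = 0 \<and> y = 0 \<and> z = 0"
proof (induction "nat \<bar>w\<bar> + nat \<bar>x\<bar> + nat \<bar>y\<bar> + nat \<bar>z\<bar>" arbitrary: w x y z rule: less_induct)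
  case less
  define h :: "int \<Rightarrow> nat" where "h k = nat \<bar>k\<bar>" for k
  note hyps = less.hyps[folded h_def]
  obtain p :: int where p: "Factorial_Ring.prime p" "p dvd b * c" by (rule obtain_prime)
  have p1: "p > 1" using p(1) prime_gt_1_int by blast
  have "algebraic_int (qel c t (of_int w) (of_int x) (of_int y) (of_int z) / of_int p)"
    using less.prems by simp
  from saturated[OF p this] obtain w' x' y' z' where e: "w = p * w'" "x = p * x'" "y = p * y'" "z = p * z'"
    by (auto elim!: dvdE)
  have "of_int p * qel c t (of_int w') (of_int x') (of_int y') (of_int z') = 0"
    using less.prems by (simp add: e qel_def algebra_simps)
  then have 0: "qel c t (of_int w') (of_int x') (of_int y') (of_int z') = 0" using p1 by simp
  show ?case
  proof (rule ccontr)
    assume nz: "\<not> ?thesis"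
    have h0: "h k = 0 \<longleftrightarrow> k = 0" for k by (simp add: h_def)
    have le: "2 * h k \<le> h (p * k)" for k
      using p1 by (auto simp: h_def abs_mult nat_mult_distrib)
    have "h w' \<noteq> 0 \<or> h x' \<noteq> 0 \<or> h y' \<noteq> 0 \<or> h z' \<noteq> 0" using nz e unfolding h0 by auto
    then have "h w' + h x' + h y' + h z' < h w + h x + h y + h z"
      using le[of w'] le[of x'] le[of y'] le[of z'] unfolding e by linarith
    then have "w' = 0 \<and> x' = 0 \<and> y' = 0 \<and> z' = 0" by (intro hyps 0) auto
    then show False using nz e by simp
  qed
qed

lemma qel_eq_0:
  assumes "w \<in> \<rat>" "x \<in> \<rat>" "y \<in> \<rat>" "z \<in> \<rat>" "qel c t w x y z = 0"
  shows "w = 0 \<and> x = 0 \<and> y = 0 \<and> z = 0"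
proof -
  obtain N w' x' y' z' :: int where N: "N > 0" "of_int N * w = of_int w'" "of_int N * x = of_int x'"
    "of_int N * y = of_int y'" "of_int N * z = of_int z'"
    by (rule common_denominator4[OF assms(1-4)])
  have "qel c t (of_int w') (of_int x') (of_int y') (of_int z') = of_int N * qel c t w x y z"
    unfolding N(2-5)[symmetric] by (simp add: qel_def algebra_simps)
  then have "w' = 0 \<and> x' = 0 \<and> y' = 0 \<and> z' = 0" using assms(5) qel_eq_0_int by simp
  then show ?thesis using N by simp
qed

lemma qel_unique:
  assumes "w \<in> \<rat>" "x \<in> \<rat>" "y \<in> \<rat>" "z \<in> \<rat>" "w' \<in> \<rat>" "x' \<in> \<rat>" "y' \<in> \<rat>" "z' \<in> \<rat>"
    "qel c t w x y z = qel c t w' x' y' z'"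
  shows "w = w' \<and> x = x' \<and> y = y' \<and> z = z'"
proof -
  have "qel c t (w - w') (x - x') (y - y') (z - z') = qel c t w x y z - qel c t w' x' y' z'"
    by (simp add: qel_def algebra_simps diff_divide_distrib)
  then show ?thesis using qel_eq_0[of "w - w'" "x - x'" "y - y'" "z - z'"] assms by simp
qed

abbreviation "K \<equiv> qfield c t"

text \<open>Stated for every fourth root \<open>s\<close> and not only for \<open>t\<close>: the
  equality of the structure constants is what makes \<open>cemb s\<close> multiplicative.\<close>

lemma qel_mult:
  assumes "s ^ 4 = of_int (b * c ^ 3)"
  shows "qel c s w x y z * qel c s w' x' y' z' =
    qel c s (w * w' + of_int (b * c) * (x * z' + z * x' + y * y'))
      (w * x' + x * w' + of_int b * (y * z' + z * y'))
      (w * y' + y * w' + of_int c * x * x' + of_int b * z * z')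
      (w * z' + z * w' + of_int c * (x * y' + y * x'))" (is "?l = ?r")
proof -
  have nz: "of_int c \<noteq> (0 :: complex)" using bc_nz by simp
  have p: "s * s = of_int c * (s ^ 2 / of_int c)" "s * (s ^ 2 / of_int c) = of_int c * (s ^ 3 / of_int c ^ 2)"
    using bc_nz by (simp_all add: eval_nat_numeral)
  have "s * (s ^ 3 / of_int c ^ 2) = s ^ 4 / of_int c ^ 2" by (simp add: eval_nat_numeral)
  also have "\<dots> = of_int (b * c)" unfolding assms using nz by (subst divide_eq_eq) (simp add: algebra_simps eval_nat_numeral)
  finally have p3: "s * (s ^ 3 / of_int c ^ 2) = of_int (b * c)" .
  have "(s ^ 2 / of_int c) * (s ^ 2 / of_int c) = s ^ 4 / of_int c ^ 2" by (simp add: eval_nat_numeral)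
  also have "\<dots> = of_int (b * c)" unfolding assms using nz by (subst divide_eq_eq) (simp add: algebra_simps eval_nat_numeral)
  finally have p4: "(s ^ 2 / of_int c) * (s ^ 2 / of_int c) = of_int (b * c)" .
  have "(s ^ 2 / of_int c) * (s ^ 3 / of_int c ^ 2) = s ^ 4 * s / of_int c ^ 3" by (simp add: eval_nat_numeral mult.assoc)
  also have "\<dots> = of_int b * s" unfolding assms using nz by (subst divide_eq_eq) (simp add: algebra_simps eval_nat_numeral)
  finally have p5: "(s ^ 2 / of_int c) * (s ^ 3 / of_int c ^ 2) = of_int b * s" .
  have "(s ^ 3 / of_int c ^ 2) * (s ^ 3 / of_int c ^ 2) = s ^ 4 * s ^ 2 / of_int c ^ 4" by (simp add: eval_nat_numeral mult.assoc)
  also have "\<dots> = of_int b * (s ^ 2 / of_int c)" unfolding assms times_divide_eq_right using bc_nz by (subst frac_eq_eq) (simp_all add: algebra_simps eval_nat_numeral)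
  finally have p6: "(s ^ 3 / of_int c ^ 2) * (s ^ 3 / of_int c ^ 2) = of_int b * (s ^ 2 / of_int c)" .
  note p = p p3 p4 p5 p6
  define B C where "B = s ^ 2 / of_int c" and "C = s ^ 3 / of_int c ^ 2"
  note p = p[folded B_def C_def]
  have "?l = w * w' + (w * x' + x * w') * s + (w * y' + y * w') * B + (w * z' + z * w') * C
     + x * x' * (s * s) + (x * y' + y * x') * (s * B) + (x * z' + z * x') * (s * C)
     + y * y' * (B * B) + (y * z' + z * y') * (B * C) + z * z' * (C * C)"
    unfolding qel_def B_def[symmetric] C_def[symmetric] by (simp add: algebra_simps)
  also have "\<dots> = ?r"
    unfolding p unfolding qel_def B_def[symmetric] C_def[symmetric] by (simp add: algebra_simps)
  finally show ?thesis .
qed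

text \<open>A tower of two quadratic steps through a square root of \<open>b * c\<close>; closure
  under inverses then follows from \<open>quad_ext_subfield\<close>.\<close>

lemma qfield_eq_quad_ext: "K = quad_ext (quad_ext \<rat> (t ^ 2 / of_int c)) t"
proof -
  have cR: "of_int c \<in> (\<rat> :: complex set)" by simp
  have g: "t ^ 3 / of_int c ^ 2 = (t ^ 2 / of_int c) * t / of_int c" by (simp add: eval_nat_numeral)
  have e1: "qel c t w x y z = (w + y * (t ^ 2 / of_int c)) + (x + (z / of_int c) * (t ^ 2 / of_int c)) * t" for w x y z
    unfolding qel_def g by (simp add: algebra_simps)
  have e2: "(w + y * (t ^ 2 / of_int c)) + (x + z * (t ^ 2 / of_int c)) * t = qel c t w x y (z * of_int c)" for w x y z
    unfolding qel_def g using bc_nz by (simp add: algebra_simps)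
  show ?thesis
  proof (intro equalityI subsetI)
    fix s assume "s \<in> K"
    then obtain w x y z where "s = qel c t w x y z" and R: "w \<in> \<rat>" "x \<in> \<rat>" "y \<in> \<rat>" "z \<in> \<rat>"
      by (auto simp: qfield_def)
    then have "s = (w + y * (t ^ 2 / of_int c)) + (x + (z / of_int c) * (t ^ 2 / of_int c)) * t"
      using e1 by simp
    then show "s \<in> quad_ext (quad_ext \<rat> (t ^ 2 / of_int c)) t"
      using R by (simp only: quad_extI Rats_divide cR)
  next
    fix s assume "s \<in> quad_ext (quad_ext \<rat> (t ^ 2 / of_int c)) t"
    then obtain w x y z where "s = (w + y * (t ^ 2 / of_int c)) + (x + z * (t ^ 2 / of_int c)) * t"
      and R: "w \<in> \<rat>" "x \<in> \<rat>" "y \<in> \<rat>" "z \<in> \<rat>"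
      unfolding quad_ext_def by blast
    then have "s = qel c t w x y (z * of_int c)" using e2 by simp
    then show "s \<in> K" unfolding qfield_def using R Rats_mult[OF R(4) cR] by blast
  qed
qed

lemma qfield_subfield: "subfield K complex_ring"
proof -
  have 1: "subfield (quad_ext \<rat> (t ^ 2 / of_int c)) complex_ring"
    by (rule quad_ext_subfield[OF subfield_Rats]) (simp only: beta_sq Rats_of_int)
  have "t\<^sup>2 = 0 + of_int c * (t ^ 2 / of_int c)" using bc_nz by simp
  then have "t\<^sup>2 \<in> quad_ext \<rat> (t ^ 2 / of_int c)" by (metis quad_extI Rats_0 Rats_of_int)
  then show ?thesis unfolding qfield_eq_quad_ext by (rule quad_ext_subfield[OF 1])
qed

lemma qelI: "w \<in> \<rat> \<Longrightarrow> x \<in> \<rat> \<Longrightarrow> y \<in> \<rat> \<Longrightarrow> z \<in> \<rat> \<Longrightarrow> qel c s w x y z \<in> qfield c s"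
  by (auto simp: qfield_def)

lemma t_in: "t \<in> K" using qelI[of 0 1 0 0 t] by (simp add: qel_def)

lemma qfield_eq: "K = generate_field complex_ring (insert t \<rat>)"
proof (rule sym, rule generate_field_complex_eqI[OF qfield_subfield])
  show "insert t \<rat> \<subseteq> K" using t_in subfield_complexD(11)[OF qfield_subfield] by auto
next
  fix F assume F: "subfield F complex_ring" "insert t \<rat> \<subseteq> F"
  note Fs = subfield_complexD[OF F(1)]
  have "t \<in> F" using F by auto
  then show "K \<subseteq> F" using Fs by (auto simp: qfield_def qel_def intro!: Fs(3,4,8,9))
qed

end

section \<open>Conjugates of the radical, embeddings and the trace\<close>

context pure_quartic begin

definition roots :: "complex set" where "roots = {t, \<i> * t, - t, - (\<i> * t)}"

lemma roots_iff: "s \<in> roots \<longleftrightarrow> s ^ 4 = of_int (b * c ^ 3)"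
proof -
  have "s ^ 4 - t ^ 4 = (s - t) * (s + t) * ((s - \<i> * t) * (s + \<i> * t))"
    by (simp add: algebra_simps eval_nat_numeral)
  then have "s ^ 4 = t ^ 4 \<longleftrightarrow> s - t = 0 \<or> s + t = 0 \<or> s - \<i> * t = 0 \<or> s + \<i> * t = 0"
    by (metis mult_eq_0_iff right_minus_eq)
  then show ?thesis unfolding root roots_def by (auto simp: add_eq_0_iff)
qed

text \<open>The first, second and third powers of the four roots each sum to zero, so only the
  constant coordinate survives.\<close>

lemma sum_roots:
  "(\<Sum>s\<in>roots. qel c s w x y z) = 4 * w"
proof -
  have "t \<noteq> \<i> * t" "t \<noteq> - t" "t \<noteq> - (\<i> * t)" "\<i> * t \<noteq> - t" "\<i> * t \<noteq> - (\<i> * t)" "- t \<noteq> - (\<i> * t)"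
    using t_nz mult_cancel_right[of \<i> t 1] mult_cancel_right[of \<i> t "-1"]
    by (auto simp: complex_eq_iff)
  then show ?thesis
    by (simp add: roots_def qel_def power_mult_distrib eval_nat_numeral algebra_simps)
qed

text \<open>The embedding that sends \<open>t\<close> to \<open>s\<close>, well defined because
  coordinates are unique. It is restricted to \<open>K\<close> to match the extensionality in
  \<open>embeddings\<close>.\<close>

definition cemb :: "complex \<Rightarrow> complex \<Rightarrow> complex" where
  "cemb s = (\<lambda>u\<in>K. THE v. \<exists>w\<in>\<rat>. \<exists>x\<in>\<rat>. \<exists>y\<in>\<rat>. \<exists>z\<in>\<rat>.
     u = qel c t w x y z \<and> v = qel c s w x y z)"

lemma cemb_qel:
  assumes "w \<in> \<rat>" "x \<in> \<rat>" "y \<in> \<rat>" "z \<in> \<rat>"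
  shows "cemb s (qel c t w x y z) = qel c s w x y z"
proof -
  have "(THE v. \<exists>w'\<in>\<rat>. \<exists>x'\<in>\<rat>. \<exists>y'\<in>\<rat>. \<exists>z'\<in>\<rat>. qel c t w x y z = qel c t w' x' y' z' \<and> v = qel c s w' x' y' z')
      = qel c s w x y z"
  proof (rule the_equality)
    fix v assume "\<exists>w'\<in>\<rat>. \<exists>x'\<in>\<rat>. \<exists>y'\<in>\<rat>. \<exists>z'\<in>\<rat>. qel c t w x y z = qel c t w' x' y' z' \<and> v = qel c s w' x' y' z'"
    then obtain w' x' y' z' where *: "w' \<in> \<rat>" "x' \<in> \<rat>" "y' \<in> \<rat>" "z' \<in> \<rat>"
      "qel c t w x y z = qel c t w' x' y' z'" "v = qel c s w' x' y' z'" by blast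
    then show "v = qel c s w x y z" using qel_unique[OF assms *(1-5)] by simp
  qed (use assms in blast)
  then show ?thesis using qelI[OF assms, of t] by (simp add: cemb_def)
qed

lemma qel_add: "qel c s w x y z + qel c s w' x' y' z' = qel c s (w + w') (x + x') (y + y') (z + z')"
  by (simp add: qel_def algebra_simps add_divide_distrib)

lemma qel_scale: "k * qel c s w x y z = qel c s (k * w) (k * x) (k * y) (k * z)"
  by (simp add: qel_def algebra_simps)

lemma qel_basis: "qel c s 1 0 0 0 = 1" "qel c s 0 1 0 0 = s" "qel c s q 0 0 0 = q" "qel c s 0 0 0 0 = 0"
  "qel c s 0 0 1 0 = s ^ 2 / of_int c" "qel c s 0 0 0 1 = s ^ 3 / of_int c ^ 2"
  by (simp_all add: qel_def)

lemma qfieldE: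
  assumes "u \<in> K"
  obtains w x y z where "u = qel c t w x y z" "w \<in> \<rat>" "x \<in> \<rat>" "y \<in> \<rat>" "z \<in> \<rat>"
  using assms by (auto simp: qfield_def)

lemma cemb_field_emb:
  assumes s: "s \<in> roots"
  shows "field_emb K (cemb s)"
proof -
  have st: "s ^ 4 = of_int (b * c ^ 3)" using s by (simp add: roots_iff)
  show ?thesis
    unfolding field_emb_def
  proof (intro conjI ballI)
    show "cemb s 1 = 1" using cemb_qel[of 1 0 0 0 s] by (simp add: qel_basis)
  next
    fix u v assume "u \<in> K" "v \<in> K"
    obtain w x y z where u: "u = qel c t w x y z" "w \<in> \<rat>" "x \<in> \<rat>" "y \<in> \<rat>" "z \<in> \<rat>"
      using \<open>u \<in> K\<close> by (rule qfieldE)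
    obtain w' x' y' z' where v: "v = qel c t w' x' y' z'" "w' \<in> \<rat>" "x' \<in> \<rat>" "y' \<in> \<rat>" "z' \<in> \<rat>"
      using \<open>v \<in> K\<close> by (rule qfieldE)
    show "cemb s (u + v) = cemb s u + cemb s v"
      unfolding u(1) v(1) qel_add using u(2-) v(2-) by (simp add: cemb_qel qel_add)
    show "cemb s (u * v) = cemb s u * cemb s v"
      unfolding u(1) v(1) using u(2-) v(2-)
      by (simp add: cemb_qel qel_mult[OF root] qel_mult[OF st] del: of_int_mult)
  qed
qed

text \<open>An embedding fixes the rationals, so it is determined by the image of \<open>t\<close>,
  which is again a fourth root of the same integer.\<close>

lemma embeddings_eq: "embeddings K = cemb ` roots"
proof (intro equalityI subsetI)
  fix e assume "e \<in> cemb ` roots"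
  then obtain s where s: "e = cemb s" "s \<in> roots" by auto
  then show "e \<in> embeddings K"
    using cemb_field_emb[OF s(2)] by (simp add: embeddings_def field_emb_iff_ring_hom cemb_def)
next
  fix e assume "e \<in> embeddings K"
  then have e: "field_emb K e" "e \<in> extensional K"
    by (auto simp: embeddings_def field_emb_iff_ring_hom)
  note Ks = subfield_complexD[OF qfield_subfield] and fx = field_emb_fixes[OF qfield_subfield e(1)]
  have eadd: "\<And>x y. x \<in> K \<Longrightarrow> y \<in> K \<Longrightarrow> e (x + y) = e x + e y"
    and emult: "\<And>x y. x \<in> K \<Longrightarrow> y \<in> K \<Longrightarrow> e (x * y) = e x * e y"
    using e(1) by (auto simp: field_emb_def)
  have "e (t ^ 4) = of_int (b * c ^ 3)" unfolding root by (rule fx(1))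
  then have "e t ^ 4 = of_int (b * c ^ 3)" using fx(3)[OF t_in, of 4] by simp
  then have r: "e t \<in> roots" by (simp add: roots_iff)
  have "e u = cemb (e t) u" for u
  proof (cases "u \<in> K")
    case True
    then obtain w x y z where u: "u = qel c t w x y z" "w \<in> \<rat>" "x \<in> \<rat>" "y \<in> \<rat>" "z \<in> \<rat>"
      by (rule qfieldE)
    define Y Z where "Y = y / of_int c" and "Z = z / of_int c ^ 2"
    have c: "Y \<in> \<rat>" "Z \<in> \<rat>" using u by (auto simp: Y_def Z_def)
    have QK: "q \<in> K" if "q \<in> \<rat>" for q using that Ks(11) by auto
    have "u = w + x * t + Y * t ^ 2 + Z * t ^ 3"
      by (simp add: u(1) qel_def Y_def Z_def)
    then have "e u = w + x * e t + Y * e t ^ 2 + Z * e t ^ 3"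
      using u(2-) c t_in Ks(3,4,9) by (simp add: eadd emult fx(2,3) QK)
    also have "\<dots> = cemb (e t) u" unfolding u(1) cemb_qel[OF u(2-)] by (simp add: qel_def Y_def Z_def)
    finally show ?thesis .
  next
    case False
    then show ?thesis using e(2) by (simp add: cemb_def extensional_def)
  qed
  then have "e = cemb (e t)" by blast
  then show "e \<in> cemb ` roots" using r by blast
qed

lemma trace_qel:
  assumes "w \<in> \<rat>" "x \<in> \<rat>" "y \<in> \<rat>" "z \<in> \<rat>"
  shows "field_trace K (qel c t w x y z) = 4 * w"
proof -
  have "inj_on cemb roots"
  proof (rule inj_onI)
    fix s s' assume "cemb s = cemb s'"
    then have "cemb s (qel c t 0 1 0 0) = cemb s' (qel c t 0 1 0 0)" by simp
    then show "s = s'" by (simp only: cemb_qel Rats_0 Rats_1) (simp add: qel_basis)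
  qed
  then have "field_trace K (qel c t w x y z) = (\<Sum>s\<in>roots. cemb s (qel c t w x y z))"
    unfolding field_trace_def embeddings_eq by (simp add: sum.reindex)
  also have "\<dots> = 4 * w" using assms by (simp add: cemb_qel sum_roots)
  finally show ?thesis .
qed

lemma basis_integral: "algebraic_int t" "algebraic_int (t ^ 2 / of_int c)" "algebraic_int (t ^ 3 / of_int c ^ 2)"
proof -
  show "algebraic_int t"
    by (rule algebraic_int_of_power[of _ 4]) (simp_all only: root algebraic_int_of_int zero_less_numeral)
  show "algebraic_int (t ^ 2 / of_int c)"
    by (rule algebraic_int_of_power[of _ 2]) (simp_all only: beta_sq algebraic_int_of_int zero_less_numeral)
  show "algebraic_int (t ^ 3 / of_int c ^ 2)"
    by (rule algebraic_int_of_power[of _ 4])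
      (simp_all only: pure_quartic.root[OF swap] algebraic_int_of_int zero_less_numeral)
qed

lemma qel_integral: "qel c t (of_int w) (of_int x) (of_int y) (of_int z) \<in> ring_of_integers K"
proof -
  have "algebraic_int (qel c t (of_int w) (of_int x) (of_int y) (of_int z))"
    unfolding qel_def by (intro algebraic_int_add algebraic_int_mult basis_integral algebraic_int_of_int)
  then show ?thesis unfolding ring_of_integers_def by (simp add: qelI)
qed

lemma trace_integral: "u \<in> ring_of_integers K \<Longrightarrow> field_trace K u \<in> \<int>"
proof -
  assume u: "u \<in> ring_of_integers K"
  then have uK: "u \<in> K" and ui: "algebraic_int u" by (auto simp: ring_of_integers_def)
  have "algebraic_int (field_trace K u)"
    unfolding field_trace_def
  proof (rule algebraic_int_sum)
    fix e assume "e \<in> embeddings K"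
    then have "field_emb K e" by (auto simp: embeddings_def field_emb_iff_ring_hom)
    then show "algebraic_int (e u)" using field_emb_algebraic_int[OF qfield_subfield] uK ui by blast
  qed
  moreover have "field_trace K u \<in> \<rat>"
    using uK by (auto elim!: qfieldE simp: trace_qel)
  ultimately show ?thesis by (rule rational_algebraic_int_is_int)
qed

text \<open>Removes one prime of \<open>b * c\<close> from a common denominator: after
  multiplication by \<open>p * k\<close> the coordinates are integers whose combination is
  \<open>p\<close> times an algebraic integer, and saturation divides them by
  \<open>p\<close>.\<close>

lemma coords_descent:
  assumes R: "w \<in> \<rat>" "x \<in> \<rat>" "y \<in> \<rat>" "z \<in> \<rat>" and p: "Factorial_Ring.prime p" "p dvd b * c"
    and int: "algebraic_int (qel c t w x y z)"
    and m: "\<forall>q\<in>{w,x,y,z}. of_int (p * k) * q \<in> \<int>"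
  shows "\<forall>q\<in>{w,x,y,z}. of_int k * q \<in> \<int>"
proof -
  obtain w' x' y' z' where e: "of_int (p * k) * w = of_int w'" "of_int (p * k) * x = of_int x'"
    "of_int (p * k) * y = of_int y'" "of_int (p * k) * z = of_int z'"
    using m by (fastforce elim!: Ints_cases)
  have p0: "(of_int p :: complex) \<noteq> 0" using p(1) by auto
  have "qel c t (of_int w') (of_int x') (of_int y') (of_int z') = of_int p * (of_int k * qel c t w x y z)"
    unfolding e[symmetric] qel_scale by (simp add: mult.assoc)
  then have "qel c t (of_int w') (of_int x') (of_int y') (of_int z') / of_int p = of_int k * qel c t w x y z"
    using p0 by simp
  then have "algebraic_int (qel c t (of_int w') (of_int x') (of_int y') (of_int z') / of_int p)"
    using int by (auto intro: algebraic_int_intros)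
  from saturated[OF p this] have d: "p dvd w'" "p dvd x'" "p dvd y'" "p dvd z'" by auto
  have "of_int k * q \<in> \<int>" if "of_int (p * k) * q = of_int q'" "p dvd q'" for q :: complex and q'
  proof -
    obtain q'' where "q' = p * q''" using \<open>p dvd q'\<close> by auto
    then have "of_int k * q = of_int q''" using that(1) p0 by simp
    then show ?thesis by simp
  qed
  from this[OF e(1) d(1)] this[OF e(2) d(2)] this[OF e(3) d(3)] this[OF e(4) d(4)]
  show ?thesis by simp
qed

text \<open>Traces against the basis leave at most the denominator \<open>4 * (b * c)\<close>; the
  primes of \<open>b * c\<close> are then stripped one after the other by
  \<open>coords_descent\<close>.\<close>

lemma four_coords:
  assumes R: "w \<in> \<rat>" "x \<in> \<rat>" "y \<in> \<rat>" "z \<in> \<rat>" and u: "qel c t w x y z \<in> ring_of_integers K"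
  shows "\<forall>q\<in>{w,x,y,z}. of_int 4 * q \<in> \<int>"
proof -
  have int: "algebraic_int (qel c t w x y z)" using u by (simp add: ring_of_integers_def)
  note RI = ring_of_integers_closed[OF qfield_subfield]
  have tr: "4 * (w * w' + of_int (b * c) * (x * z' + z * x' + y * y')) \<in> \<int>"
    if "w' \<in> \<int>" "x' \<in> \<int>" "y' \<in> \<int>" "z' \<in> \<int>" for w' x' y' z'
  proof -
    have "qel c t w' x' y' z' \<in> ring_of_integers K" using that by (auto elim!: Ints_cases intro: qel_integral)
    then have "field_trace K (qel c t w x y z * qel c t w' x' y' z') \<in> \<int>"
      using trace_integral RI(4) u by blast
    moreover have "w' \<in> \<rat>" "x' \<in> \<rat>" "y' \<in> \<rat>" "z' \<in> \<rat>" using that Ints_subset_Rats by blast+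
    ultimately show ?thesis using R by (simp add: qel_mult[OF root] trace_qel del: of_int_mult)
  qed
  \<comment> \<open>Pairing with the four basis elements picks out \<open>w\<close>,
    \<open>x\<close>, \<open>y\<close>, \<open>z\<close>: up to the factor \<open>b * c\<close> the
    trace form pairs the second with the fourth element and the third with itself. For
    \<open>w\<close> the factor is inserted only for uniformity.\<close>
  have start: "\<forall>q\<in>{w,x,y,z}. of_int ((b * c) * 4) * q \<in> \<int>"
    using tr[of 1 0 0 0] tr[of 0 0 0 1] tr[of 0 0 1 0] tr[of 0 1 0 0]
      Ints_mult[of "4 * w" "of_int (b * c)"]
    by (auto simp: mult_ac)
  have "m dvd b * c \<longrightarrow> (\<forall>q\<in>{w,x,y,z}. of_int (m * 4) * q \<in> \<int>) \<longrightarrow> (\<forall>q\<in>{w,x,y,z}. of_int 4 * q \<in> \<int>)" for m :: int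
  proof (induction m rule: prime_divisors_induct)
    case zero then show ?case using bc_nz by simp
  next
    case (unit m)
    then have "m = 1 \<or> m = -1" by auto
    then show ?case by auto
  next
    case (factor p m)
    show ?case
    proof (intro impI)
      assume d: "p * m dvd b * c" and i: "\<forall>q\<in>{w,x,y,z}. of_int (p * m * 4) * q \<in> \<int>"
      have "p dvd b * c" "m dvd b * c" using d dvd_mult_left dvd_mult_right by blast+
      then show "\<forall>q\<in>{w,x,y,z}. of_int 4 * q \<in> \<int>"
        using factor(2) coords_descent[OF R factor(1) \<open>p dvd b * c\<close> int i[unfolded mult.assoc]] by blast
    qed
  qed
  from mp[OF mp[OF this[of "b * c"] dvd_refl] start] show ?thesis .
qed

end

section \<open>Integral bases and discriminants\<close>

text \<open>Just an additive subgroup; discreteness enters through integer-valued coordinate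
  functions.\<close>

locale int_lattice =
  fixes G :: "complex set"
  assumes zero: "0 \<in> G" and add: "\<And>x y. x \<in> G \<Longrightarrow> y \<in> G \<Longrightarrow> x + y \<in> G"
    and neg: "\<And>x. x \<in> G \<Longrightarrow> - x \<in> G"
begin

lemma scale: "x \<in> G \<Longrightarrow> of_int n * x \<in> G"
proof (induction n rule: int_induct[of _ 0])
  case (step1 i) then show ?case using add[of "of_int i * x" x] by (simp add: algebra_simps)
next
  case (step2 i) then show ?case using add[of "of_int i * x" "- x"] neg[of x] by (simp add: algebra_simps)
qed (use zero in simp)

lemma sum: "(\<And>i. i \<in> A \<Longrightarrow> f i \<in> G) \<Longrightarrow> sum f A \<in> G"
  by (induction A rule: infinite_finite_induct) (use zero add in auto)

end

lemma int_lattice_additive: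
  fixes k :: "complex \<Rightarrow> int"
  assumes "int_lattice G" "\<And>x y. x \<in> G \<Longrightarrow> y \<in> G \<Longrightarrow> k (x + y) = k x + k y"
  shows "k 0 = 0" "x \<in> G \<Longrightarrow> k (- x) = - k x" "x \<in> G \<Longrightarrow> k (of_int n * x) = n * k x"
    "(\<And>i. i \<in> A \<Longrightarrow> f i \<in> G) \<Longrightarrow> k (sum f A) = (\<Sum>i\<in>A. k (f i))"
proof -
  interpret int_lattice G by fact
  show k0: "k 0 = 0" using assms(2)[of 0 0] zero by simp
  show kn: "k (- x) = - k x" if "x \<in> G" for x using assms(2)[of x "- x"] neg that k0 by simp
  show "k (of_int n * x) = n * k x" if "x \<in> G"
  proof (induction n rule: int_induct[of _ 0])
    case (step1 i)
    have "k (of_int (i + 1) * x) = k (of_int i * x + x)" by (simp add: algebra_simps)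
    then show ?case using step1 assms(2)[of "of_int i * x" x] scale that by (simp add: algebra_simps)
  next
    case (step2 i)
    have "k (of_int (i - 1) * x) = k (of_int i * x + - x)" by (simp add: algebra_simps)
    then show ?case using step2 assms(2)[of "of_int i * x" "- x"] scale that neg kn by (simp add: algebra_simps)
  qed (use k0 in simp)
  show "k (sum f A) = (\<Sum>i\<in>A. k (f i))" if "\<And>i. i \<in> A \<Longrightarrow> f i \<in> G"
    using that
  proof (induction A rule: infinite_finite_induct)
    case (insert x F)
    then have "sum f F \<in> G" by (intro sum) auto
    then show ?case using insert assms(2)[of "f x" "sum f F"] by simp
  qed (use k0 in simp_all)
qed

text \<open>In each coordinate, an element with least positive entry among those vanishing in all later
  coordinates extends the basis found so far.\<close>

lemma triangular_lattice_basis_aux: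
  fixes k :: "nat \<Rightarrow> complex \<Rightarrow> int" and e :: "nat \<Rightarrow> complex"
  assumes G: "int_lattice G" and kadd: "\<And>i x y. x \<in> G \<Longrightarrow> y \<in> G \<Longrightarrow> k i (x + y) = k i x + k i y"
    and e: "\<And>i. i < n \<Longrightarrow> e i \<in> G \<and> k i (e i) \<noteq> 0 \<and> (\<forall>j. i < j \<and> j < n \<longrightarrow> k j (e i) = 0)"
    and inj: "\<And>x. x \<in> G \<Longrightarrow> (\<forall>i<n. k i x = 0) \<Longrightarrow> x = 0"
    and "m \<le> n"
  shows "\<exists>B. (\<forall>i<m. B i \<in> G \<and> (\<forall>j. m \<le> j \<and> j < n \<longrightarrow> k j (B i) = 0)) \<and>
     (\<forall>x\<in>G. (\<forall>j. m \<le> j \<and> j < n \<longrightarrow> k j x = 0) \<longrightarrow> (\<exists>a. x = (\<Sum>i<m. of_int (a i) * B i))) \<and>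
     (\<forall>a. (\<Sum>i<m. of_int (a i) * B i) = 0 \<longrightarrow> (\<forall>i<m. a i = 0))"
  using \<open>m \<le> n\<close>
proof (induction m)
  case 0
  then show ?case using inj by auto
next
  case (Suc m)
  interpret int_lattice G by (rule G)
  have lin: "k i 0 = 0" "x \<in> G \<Longrightarrow> k i (- x) = - k i x" "x \<in> G \<Longrightarrow> k i (of_int q * x) = q * k i x"
    "(\<And>l. l \<in> A \<Longrightarrow> f l \<in> G) \<Longrightarrow> k i (sum f A) = (\<Sum>l\<in>A. k i (f l))"
    for i x q and A :: "nat set" and f
    by (rule int_lattice_additive[OF G, of "k i"]; simp add: kadd)+
  obtain B where IH: "\<forall>i<m. B i \<in> G \<and> (\<forall>j. m \<le> j \<and> j < n \<longrightarrow> k j (B i) = 0)"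
     "\<forall>x\<in>G. (\<forall>j. m \<le> j \<and> j < n \<longrightarrow> k j x = 0) \<longrightarrow> (\<exists>a. x = (\<Sum>i<m. of_int (a i) * B i))"
     "\<forall>a. (\<Sum>i<m. of_int (a i) * B i) = 0 \<longrightarrow> (\<forall>i<m. a i = 0)"
    using Suc.IH Suc.prems by (auto simp del: of_int_mult)
  have B: "\<And>i. i < m \<Longrightarrow> B i \<in> G" "\<And>i j. i < m \<Longrightarrow> m \<le> j \<Longrightarrow> j < n \<Longrightarrow> k j (B i) = 0"
    and span: "\<And>x. x \<in> G \<Longrightarrow> (\<And>j. m \<le> j \<Longrightarrow> j < n \<Longrightarrow> k j x = 0) \<Longrightarrow> \<exists>a. x = (\<Sum>i<m. of_int (a i) * B i)"
    and ind: "\<And>a i. (\<Sum>i<m. of_int (a i) * B i) = 0 \<Longrightarrow> i < m \<Longrightarrow> a i = 0"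
    using IH by blast+
  define H where "H = {x \<in> G. \<forall>j. Suc m \<le> j \<and> j < n \<longrightarrow> k j x = 0}"
  have m: "m < n" using Suc.prems by simp
  have eH: "e m \<in> H" "- e m \<in> H" using e[OF m] neg lin(2) by (auto simp: H_def)
  define P where "P g \<longleftrightarrow> (\<exists>x\<in>H. k m x = int g \<and> g > 0)" for g :: nat
  have "\<exists>g. P g"
  proof (cases "k m (e m) > 0")
    case True
    then show ?thesis using eH unfolding P_def by (intro exI[of _ "nat (k m (e m))"]) auto
  next
    case False
    then show ?thesis using eH e[OF m] lin(2)[of "e m" m] unfolding P_def
      by (intro exI[of _ "nat (k m (- e m))"]) auto
  qed
  then have "P (LEAST g. P g)" by (rule LeastI_ex)
  then obtain y where y: "y \<in> H" "k m y = int (LEAST g. P g)" "(LEAST g. P g) > 0" by (auto simp: P_def)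
  define g where "g = k m y"
  have g: "g > 0" and least: "\<And>x. x \<in> H \<Longrightarrow> k m x > 0 \<Longrightarrow> g \<le> k m x"
  proof -
    show "g > 0" using y by (simp add: g_def)
    fix x assume "x \<in> H" "k m x > 0"
    then have "P (nat (k m x))" unfolding P_def by (intro bexI[of _ x]) auto
    then have "(LEAST g. P g) \<le> nat (k m x)" by (rule Least_le)
    then show "g \<le> k m x" using y \<open>k m x > 0\<close> by (simp add: g_def)
  qed
  have yG: "y \<in> G" using y by (simp add: H_def)
  define B' where "B' = B(m := y)"
  have B': "B' i \<in> G" if "i < Suc m" for i using that B(1) yG by (auto simp: B'_def less_Suc_eq)
  have sum_B': "(\<Sum>i<Suc m. of_int (a i) * B' i) = (\<Sum>i<m. of_int (a i) * B i) + of_int (a m) * y" for a :: "nat \<Rightarrow> int"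
    by (simp add: B'_def)
  show ?case
  proof (rule exI[of _ B'], intro conjI allI ballI impI)
    fix i assume "i < Suc m" then show "B' i \<in> G" by (rule B')
  next
    fix i j assume "i < Suc m" "Suc m \<le> j \<and> j < n"
    then show "k j (B' i) = 0" using B(2)[of i j] y(1) by (cases "i = m") (auto simp: B'_def H_def)
  next
    fix x assume x: "x \<in> G" "\<forall>j. Suc m \<le> j \<and> j < n \<longrightarrow> k j x = 0"
    define q where "q = k m x div g"
    define x' where "x' = x + of_int (- q) * y"
    have x'G: "x' \<in> G" unfolding x'_def by (intro add scale x yG)
    have kx': "k j x' = k j x - q * k j y" for j
      unfolding x'_def using kadd[OF x(1) scale[OF yG, of "- q"]] lin(3)[OF yG, of "j" "- q"] by simp
    have x'H: "x' \<in> H" using x x'G y(1) by (auto simp: H_def kx')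
    have "k m x' = k m x mod g" by (simp add: kx' q_def g_def[symmetric] minus_div_mult_eq_mod)
    then have "k m x' \<ge> 0" "k m x' < g" using g by auto
    then have "k m x' = 0" using least[OF x'H] by linarith
    then have "k j x' = 0" if "m \<le> j" "j < n" for j using x'H that by (cases "j = m") (auto simp: H_def)
    then obtain a where a: "x' = (\<Sum>i<m. of_int (a i) * B i)" using span[OF x'G] by blast
    have "x = (\<Sum>i<Suc m. of_int ((a(m := q)) i) * B' i)"
      unfolding sum_B' using a by (simp add: x'_def algebra_simps)
    then show "\<exists>a. x = (\<Sum>i<Suc m. of_int (a i) * B' i)" by blast
  next
    fix a i assume 0: "(\<Sum>i<Suc m. of_int (a i) * B' i) = 0" and i: "i < Suc m"
    have "k m (\<Sum>i<Suc m. of_int (a i) * B' i) = (\<Sum>i<Suc m. k m (of_int (a i) * B' i))"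
      by (rule lin(4)) (use B' scale in auto)
    also have "\<dots> = (\<Sum>i<Suc m. a i * k m (B' i))" by (intro sum.cong) (use lin(3) B' in auto)
    also have "\<dots> = a m * g" using B(2) m by (simp add: B'_def g_def)
    finally have "a m = 0" using 0 lin(1) g by simp
    then have "(\<Sum>i<m. of_int (a i) * B i) = 0" using 0[unfolded sum_B'] \<open>a m = 0\<close> by simp
    then show "a i = 0" using ind \<open>a m = 0\<close> i by (cases "i = m") auto
  qed
qed

text \<open>Trades unique coefficient lists for spanning and independence with coefficient
  functions, the form in which bases are built and compared.\<close>

lemma integral_basis_altdef:
  assumes "int_lattice (ring_of_integers K)"
  shows "integral_basis K bs \<longleftrightarrow> set bs \<subseteq> ring_of_integers K \<and>
     (\<forall>x\<in>ring_of_integers K. \<exists>a. x = (\<Sum>i<length bs. of_int (a i) * bs ! i)) \<and>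
     (\<forall>a. (\<Sum>i<length bs. of_int (a i) * bs ! i) = 0 \<longrightarrow> (\<forall>i<length bs. a i = 0))"
    (is "?l \<longleftrightarrow> ?sub \<and> ?span \<and> ?ind")
proof
  assume l: ?l
  then have ex: "\<exists>!c :: int list. length c = length bs \<and> x = (\<Sum>i<length bs. of_int (c ! i) * bs ! i)"
    if "x \<in> ring_of_integers K" for x using that by (auto simp: integral_basis_def)
  have ?span
  proof
    fix x assume "x \<in> ring_of_integers K"
    from ex[OF this] obtain c :: "int list" where "x = (\<Sum>i<length bs. of_int (c ! i) * bs ! i)" by blast
    then show "\<exists>a. x = (\<Sum>i<length bs. of_int (a i) * bs ! i)" by (intro exI[of _ "\<lambda>i. c ! i"])
  qed
  moreover have ?ind
  proof (intro allI impI)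
    fix a i assume 0: "(\<Sum>i<length bs. of_int (a i) * bs ! i) = 0" and i: "i < length bs"
    have "0 \<in> ring_of_integers K" using assms int_lattice.zero by blast
    from ex1_implies_ex[OF ex[OF this]] ex[OF this]
    have u: "\<And>c d :: int list. length c = length bs \<Longrightarrow> 0 = (\<Sum>i<length bs. of_int (c ! i) * bs ! i) \<Longrightarrow>
      length d = length bs \<Longrightarrow> 0 = (\<Sum>i<length bs. of_int (d ! i) * bs ! i) \<Longrightarrow> c = d" by blast
    have "map a [0..<length bs] = replicate (length bs) 0"
      by (rule u) (use 0 in auto)
    then have "map a [0..<length bs] ! i = replicate (length bs) 0 ! i" by simp
    then show "a i = 0" using i by simp
  qed
  ultimately show "?sub \<and> ?span \<and> ?ind" using l by (simp add: integral_basis_def)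
next
  assume r: "?sub \<and> ?span \<and> ?ind"
  then have ind: ?ind by simp
  show ?l unfolding integral_basis_def
  proof (intro conjI ballI)
    fix x assume "x \<in> ring_of_integers K"
    then obtain a where a: "x = (\<Sum>i<length bs. of_int (a i) * bs ! i)" using r by blast
    show "\<exists>!c :: int list. length c = length bs \<and> x = (\<Sum>i<length bs. of_int (c ! i) * bs ! i)"
    proof (rule ex1I[of _ "map a [0..<length bs]"])
      show "length (map a [0..<length bs]) = length bs \<and> x = (\<Sum>i<length bs. of_int (map a [0..<length bs] ! i) * bs ! i)"
        using a by simp
      fix c :: "int list" assume c: "length c = length bs \<and> x = (\<Sum>i<length bs. of_int (c ! i) * bs ! i)"
      have "(\<Sum>i<length bs. of_int (c ! i - a i) * bs ! i) = 0"
        using c a by (simp add: left_diff_distrib sum_subtractf)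
      from mp[OF spec[OF ind] this] have "\<forall>i<length bs. c ! i - a i = 0" .
      then show "c = map a [0..<length bs]" using c by (intro nth_equalityI) auto
    qed
  qed (use r in blast)
qed

lemma triangular_integral_basis:
  fixes k :: "nat \<Rightarrow> complex \<Rightarrow> int" and e :: "nat \<Rightarrow> complex"
  assumes G: "int_lattice (ring_of_integers K)"
    and "\<And>i x y. x \<in> ring_of_integers K \<Longrightarrow> y \<in> ring_of_integers K \<Longrightarrow> k i (x + y) = k i x + k i y"
    and "\<And>i. i < n \<Longrightarrow> e i \<in> ring_of_integers K \<and> k i (e i) \<noteq> 0 \<and> (\<forall>j. i < j \<and> j < n \<longrightarrow> k j (e i) = 0)"
    and "\<And>x. x \<in> ring_of_integers K \<Longrightarrow> (\<forall>i<n. k i x = 0) \<Longrightarrow> x = 0"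
  shows "\<exists>bs. integral_basis K bs"
proof -
  have triv: "(\<forall>j. n \<le> j \<and> j < n \<longrightarrow> P j) = True" for P :: "nat \<Rightarrow> bool" by auto
  have "\<exists>B. (\<forall>i<n. B i \<in> ring_of_integers K) \<and>
     (\<forall>x\<in>ring_of_integers K. \<exists>a. x = (\<Sum>i<n. of_int (a i) * B i)) \<and>
     (\<forall>a. (\<Sum>i<n. of_int (a i) * B i) = 0 \<longrightarrow> (\<forall>i<n. a i = 0))"
    by (rule triangular_lattice_basis_aux[where m = n and n = n and G = "ring_of_integers K", unfolded triv simp_thms])
      (fact assms order_refl)+
  then obtain B where B: "\<forall>i<n. B i \<in> ring_of_integers K"
     "\<forall>x\<in>ring_of_integers K. \<exists>a. x = (\<Sum>i<n. of_int (a i) * B i)"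
     "\<forall>a. (\<Sum>i<n. of_int (a i) * B i) = 0 \<longrightarrow> (\<forall>i<n. a i = 0)"
    by (elim exE conjE)
  have "(\<Sum>i<n. of_int (a i) * map B [0..<n] ! i) = (\<Sum>i<n. of_int (a i) * B i)" for a
    by (rule sum.cong) auto
  moreover have "set (map B [0..<n]) \<subseteq> ring_of_integers K" using B(1) by auto
  ultimately have "integral_basis K (map B [0..<n])"
    unfolding integral_basis_altdef[OF G] length_map length_upt diff_zero using B(2,3) by (simp only: simp_thms)
  then show ?thesis by blast
qed

section \<open>Trace forms under a change of basis\<close>

definition trace_form :: "complex set \<Rightarrow> complex list \<Rightarrow> complex mat" where
  "trace_form K bs = mat (length bs) (length bs) (\<lambda>(i, j). field_trace K (bs ! i * bs ! j))"

text \<open>Linearity over the integers as a property of the field, so that the change of basis is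
  proved for any field and the pure quartic case supplies it from \<open>trace_qel\<close>.\<close>

definition trace_linear :: "complex set \<Rightarrow> bool" where
  "trace_linear K \<longleftrightarrow> (\<forall>(A::nat set) a x. finite A \<longrightarrow> (\<forall>i\<in>A. x i \<in> K) \<longrightarrow>
     field_trace K (\<Sum>i\<in>A. of_int (a i) * x i) = (\<Sum>i\<in>A. of_int (a i) * field_trace K (x i)))"

text \<open>The Gram matrix transforms as W G W^T, which contributes the square of the determinant
  of W.\<close>

lemma trace_form_change:
  fixes W :: "nat \<Rightarrow> nat \<Rightarrow> int"
  assumes K: "subfield K complex_ring" "trace_linear K" and len: "length xs = n" "length ys = n" and sub: "set xs \<subseteq> K" "set ys \<subseteq> K"
    and W: "\<And>i. i < n \<Longrightarrow> xs ! i = (\<Sum>j<n. of_int (W i j) * ys ! j)"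
  shows "det (trace_form K xs) = of_int ((det (mat n n (\<lambda>(i,j). W i j)))\<^sup>2) * det (trace_form K ys)"
proof -
  define M where "M = mat n n (\<lambda>(i,j). W i j)"
  define C where "C = map_mat (of_int :: int \<Rightarrow> complex) M"
  have C: "C \<in> carrier_mat n n" by (simp add: C_def M_def)
  have Y: "trace_form K ys \<in> carrier_mat n n" by (simp add: trace_form_def len)
  note Ks = subfield_complexD[OF K(1)]
  have yK: "ys ! j \<in> K" if "j < n" for j using sub len that by (auto simp: nth_mem subset_iff)
  have xK: "xs ! j \<in> K" if "j < n" for j using sub len that by (auto simp: nth_mem subset_iff)
  have entry: "field_trace K (xs ! i * xs ! j) =
      (\<Sum>l<n. of_int (W i l) * (\<Sum>m<n. of_int (W j m) * field_trace K (ys ! l * ys ! m)))" if "i < n" "j < n" for i j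
  proof -
    have "xs ! i * xs ! j = (\<Sum>l<n. of_int (W i l) * (ys ! l * xs ! j))"
      unfolding W[OF that(1)] by (simp add: sum_distrib_right mult.assoc)
    then have "field_trace K (xs ! i * xs ! j) = (\<Sum>l<n. of_int (W i l) * field_trace K (ys ! l * xs ! j))"
      using K(2) yK xK[OF that(2)] Ks(4) by (simp add: trace_linear_def)
    also have "\<dots> = (\<Sum>l<n. of_int (W i l) * (\<Sum>m<n. of_int (W j m) * field_trace K (ys ! l * ys ! m)))"
    proof (intro sum.cong refl arg_cong2[of _ _ _ _ "(*)"])
      fix l assume l: "l \<in> {..<n}"
      have "ys ! l * xs ! j = (\<Sum>m<n. of_int (W j m) * (ys ! l * ys ! m))"
        unfolding W[OF that(2)] by (simp add: sum_distrib_left mult_ac)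
      then show "field_trace K (ys ! l * xs ! j) = (\<Sum>m<n. of_int (W j m) * field_trace K (ys ! l * ys ! m))"
        using K(2) yK l Ks(4) by (simp add: trace_linear_def)
    qed
    finally show ?thesis .
  qed
  have "trace_form K xs = C * trace_form K ys * C\<^sup>T"
  proof (rule eq_matI)
    fix i j assume "i < dim_row (C * trace_form K ys * C\<^sup>T)" "j < dim_col (C * trace_form K ys * C\<^sup>T)"
    then have ij: "i < n" "j < n" using C by auto
    have "(C * trace_form K ys * C\<^sup>T) $$ (i,j) = (C * (trace_form K ys * C\<^sup>T)) $$ (i,j)"
      using C Y by (simp add: assoc_mult_mat[of _ n n _ n _ n])
    also have "\<dots> = (\<Sum>l<n. of_int (W i l) * (\<Sum>m<n. field_trace K (ys ! l * ys ! m) * of_int (W j m)))"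
      using ij len by (simp add: C_def M_def trace_form_def scalar_prod_def atLeast0LessThan)
    also have "\<dots> = field_trace K (xs ! i * xs ! j)" unfolding entry[OF ij] by (simp add: mult.commute)
    finally show "trace_form K xs $$ (i,j) = (C * trace_form K ys * C\<^sup>T) $$ (i,j)"
      using ij len by (simp add: trace_form_def)
  qed (use C len in \<open>auto simp: trace_form_def\<close>)
  then have "det (trace_form K xs) = det C * det (trace_form K ys) * det C"
    using C Y det_mult[of "C * trace_form K ys" n "C\<^sup>T"] det_mult[of C n "trace_form K ys"] det_transpose[OF C] by simp
  moreover have "det C = of_int (det M)" by (simp add: C_def of_int_hom.hom_det)
  ultimately show ?thesis by (simp add: M_def power2_eq_square)
qed

text \<open>Used with \<open>k = 1\<close> for two integral bases and with \<open>k = 4\<close> for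
  the explicit basis against an integral one.\<close>

lemma det_mult_eq_if_inverse:
  fixes U V :: "nat \<Rightarrow> nat \<Rightarrow> int"
  assumes "\<And>i j. i < n \<Longrightarrow> j < n \<Longrightarrow> (\<Sum>l<n. U i l * V l j) = (if i = j then k else 0)"
  shows "det (mat n n (\<lambda>(i,j). U i j)) * det (mat n n (\<lambda>(i,j). V i j)) = k ^ n"
proof -
  have "mat n n (\<lambda>(i,j). U i j) * mat n n (\<lambda>(i,j). V i j) = k \<cdot>\<^sub>m 1\<^sub>m n"
    by (rule eq_matI) (use assms in \<open>auto simp: scalar_prod_def atLeast0LessThan\<close>)
  moreover have "det (mat n n (\<lambda>(i,j). U i j) * mat n n (\<lambda>(i,j). V i j)) =
     det (mat n n (\<lambda>(i,j). U i j)) * det (mat n n (\<lambda>(i,j). V i j))"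
    by (rule det_mult[of _ n]) auto
  ultimately show ?thesis by (simp add: det_smult)
qed

text \<open>The definite description in \<open>discriminant\<close> needs all integral bases to give
  the same determinant. Two bases of equal length differ by a unimodular matrix, whose squared
  determinant is 1.\<close>

lemma discriminant_unique:
  assumes K: "subfield K complex_ring" "trace_linear K" and bs: "integral_basis K bs"
    and same: "\<And>cs. integral_basis K cs \<Longrightarrow> length cs = length bs"
    and d: "of_int d = det (trace_form K bs)"
  shows "discriminant K = d"
  unfolding discriminant_def trace_form_def[symmetric]
proof (rule the_equality)
  show "\<exists>bs. integral_basis K bs \<and> of_int d = det (trace_form K bs)" using bs d by blast
next
  fix d' assume "\<exists>bs. integral_basis K bs \<and> of_int d' = det (trace_form K bs)"
  then obtain cs where cs: "integral_basis K cs" "of_int d' = det (trace_form K cs)" by blast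
  have G: "int_lattice (ring_of_integers K)"
    using ring_of_integers_closed[OF K(1)] by unfold_locales auto
  define n where "n = length bs"
  have n: "length cs = n" "length bs = n" using same[OF cs(1)] by (auto simp: n_def)
  note bs' = bs[unfolded integral_basis_altdef[OF G] n] and cs' = cs(1)[unfolded integral_basis_altdef[OF G] n]
  have sub: "set bs \<subseteq> ring_of_integers K" "set cs \<subseteq> ring_of_integers K" using bs' cs' by auto
  then have sub': "set bs \<subseteq> K" "set cs \<subseteq> K" by (auto simp: ring_of_integers_def)
  have cs_ind: "a i = 0" if "(\<Sum>i<n. of_int (a i) * cs ! i) = 0" "i < n" for a i
    using cs' that by blast
  have mem: "bs ! i \<in> ring_of_integers K" "cs ! i \<in> ring_of_integers K" if "i < n" for i
    using sub n that by (auto simp: subset_iff)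
  have "\<forall>i. \<exists>a. i < n \<longrightarrow> cs ! i = (\<Sum>j<n. of_int (a j) * bs ! j)"
    using bs' mem(2) by blast
  then obtain W :: "nat \<Rightarrow> nat \<Rightarrow> int" where W: "\<And>i. i < n \<Longrightarrow> cs ! i = (\<Sum>j<n. of_int (W i j) * bs ! j)"
    by metis
  have "\<forall>i. \<exists>a. i < n \<longrightarrow> bs ! i = (\<Sum>j<n. of_int (a j) * cs ! j)"
    using cs' mem(1) by blast
  then obtain V :: "nat \<Rightarrow> nat \<Rightarrow> int" where V: "\<And>i. i < n \<Longrightarrow> bs ! i = (\<Sum>j<n. of_int (V i j) * cs ! j)"
    by metis
  have "(\<Sum>l<n. W i l * V l j) = (if i = j then 1 else 0)" if ij: "i < n" "j < n" for i j
  proof -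
    have "(\<Sum>j<n. of_int ((\<Sum>l<n. W i l * V l j) - (if i = j then 1 else 0)) * cs ! j) =
       (\<Sum>j<n. \<Sum>l<n. of_int (W i l) * (of_int (V l j) * cs ! j)) - (\<Sum>j<n. of_int (if i = j then 1 else 0) * cs ! j)"
      by (simp add: left_diff_distrib sum_subtractf sum_distrib_right mult.assoc)
    also have "(\<Sum>j<n. \<Sum>l<n. of_int (W i l) * (of_int (V l j) * cs ! j)) = (\<Sum>l<n. of_int (W i l) * bs ! l)"
      by (subst sum.swap) (simp add: V sum_distrib_left)
    also have "\<dots> = cs ! i" using W ij by simp
    also have "(\<Sum>j<n. of_int (if i = j then 1 else 0) * cs ! j) = (\<Sum>j<n. if i = j then cs ! j else 0)"
      by (rule sum.cong) auto
    also have "\<dots> = cs ! i" using ij by simp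
    finally have "(\<Sum>j<n. of_int ((\<Sum>l<n. W i l * V l j) - (if i = j then 1 else 0)) * cs ! j) = 0" by simp
    from cs_ind[OF this ij(2)] show ?thesis by simp
  qed
  from det_mult_eq_if_inverse[OF this] have "is_unit (det (mat n n (\<lambda>(i,j). W i j)))" by (metis (no_types) dvd_triv_left power_one)
  then have "(det (mat n n (\<lambda>(i,j). W i j)))\<^sup>2 = 1"
    unfolding zdvd1_eq by (metis power2_abs one_power2)
  then have "det (trace_form K cs) = det (trace_form K bs)"
    using trace_form_change[OF K n sub'(2,1) W] by simp
  then have "(of_int d' :: complex) = of_int d" using cs(2) d by simp
  then show "d' = d" by (simp only: of_int_eq_iff)
qed

section \<open>The discriminant of a pure quartic field\<close>

context pure_quartic begin

text \<open>Four times the coordinate with index \<open>i\<close>, an integer by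
  \<open>four_coords\<close>. On algebraic integers of \<open>K\<close> the chosen list is the only
  one, by \<open>qel_unique\<close>.\<close>

definition crd :: "nat \<Rightarrow> complex \<Rightarrow> int" where
  "crd i u = (SOME k :: int list. length k = 4 \<and>
     u = qel c t (of_int (k ! 0) / 4) (of_int (k ! 1) / 4) (of_int (k ! 2) / 4) (of_int (k ! 3) / 4)) ! i"

abbreviation "R \<equiv> ring_of_integers K"

lemma crd:
  assumes "u \<in> R"
  shows "u = qel c t (of_int (crd 0 u) / 4) (of_int (crd 1 u) / 4) (of_int (crd 2 u) / 4) (of_int (crd 3 u) / 4)"
proof -
  have "u \<in> K" using assms by (simp add: ring_of_integers_def)
  then obtain w x y z where u: "u = qel c t w x y z" "w \<in> \<rat>" "x \<in> \<rat>" "y \<in> \<rat>" "z \<in> \<rat>"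
    by (rule qfieldE)
  have "\<forall>q\<in>{w,x,y,z}. of_int 4 * q \<in> \<int>" using four_coords u assms by blast
  then have "4 * w \<in> \<int>" "4 * x \<in> \<int>" "4 * y \<in> \<int>" "4 * z \<in> \<int>" by auto
  then obtain w' x' y' z' where "4 * w = of_int w'" "4 * x = of_int x'" "4 * y = of_int y'" "4 * z = of_int z'"
    by (auto elim!: Ints_cases)
  then have "w = of_int w' / 4" "x = of_int x' / 4" "y = of_int y' / 4" "z = of_int z' / 4"
    by (simp_all add: mult.commute eq_divide_eq)
  then have "qel c t w x y z = qel c t (of_int w' / 4) (of_int x' / 4) (of_int y' / 4) (of_int z' / 4)"
    by (simp only:)
  then have "length [w',x',y',z'] = 4 \<and> u = qel c t (of_int ([w',x',y',z'] ! 0) / 4) (of_int ([w',x',y',z'] ! 1) / 4)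
     (of_int ([w',x',y',z'] ! 2) / 4) (of_int ([w',x',y',z'] ! 3) / 4)"
    unfolding u(1) by simp
  from someI[where P = "\<lambda>k. length k = 4 \<and>
     u = qel c t (of_int (k ! 0) / 4) (of_int (k ! 1) / 4) (of_int (k ! 2) / 4) (of_int (k ! 3) / 4)", OF this]
  show ?thesis unfolding crd_def by blast
qed

lemma crd_eqI:
  assumes "u \<in> R" "u = qel c t (of_int w / 4) (of_int x / 4) (of_int y / 4) (of_int z / 4)"
  shows "crd 0 u = w" "crd 1 u = x" "crd 2 u = y" "crd 3 u = z"
proof -
  have "qel c t (of_int (crd 0 u) / 4) (of_int (crd 1 u) / 4) (of_int (crd 2 u) / 4) (of_int (crd 3 u) / 4)
     = qel c t (of_int w / 4) (of_int x / 4) (of_int y / 4) (of_int z / 4)"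
    using crd[OF assms(1)] assms(2) by simp
  from qel_unique[OF _ _ _ _ _ _ _ _ this]
  show "crd 0 u = w" "crd 1 u = x" "crd 2 u = y" "crd 3 u = z" by simp_all
qed

lemma less_4_iff: "i < (4::nat) \<longleftrightarrow> i = 0 \<or> i = 1 \<or> i = 2 \<or> i = 3" by auto

lemma crd_add:
  assumes "u \<in> R" "v \<in> R" "i < 4"
  shows "crd i (u + v) = crd i u + crd i v"
proof -
  have "u + v \<in> R" using assms ring_of_integers_closed(3)[OF qfield_subfield] by blast
  moreover have "u + v = qel c t (of_int (crd 0 u + crd 0 v) / 4) (of_int (crd 1 u + crd 1 v) / 4)
     (of_int (crd 2 u + crd 2 v) / 4) (of_int (crd 3 u + crd 3 v) / 4)"
    by (subst crd[OF assms(1)], subst crd[OF assms(2)]) (simp add: qel_add add_divide_distrib)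
  ultimately show ?thesis using crd_eqI assms(3) unfolding less_4_iff by blast
qed

definition base :: "complex list" where
  "base = [qel c t 1 0 0 0, qel c t 0 1 0 0, qel c t 0 0 1 0, qel c t 0 0 0 1]"

lemma base_length: "length base = 4" by (simp add: base_def)

lemma base_integral: "set base \<subseteq> R"
  using qel_integral[of 1 0 0 0] qel_integral[of 0 1 0 0] qel_integral[of 0 0 1 0] qel_integral[of 0 0 0 1]
  by (simp add: base_def)

lemma base_nth: "i < 4 \<Longrightarrow> base ! i \<in> R"
  using base_integral base_length nth_mem by fastforce

lemma crd_base: "i < 4 \<Longrightarrow> j < 4 \<Longrightarrow> crd i (base ! j) = (if i = j then 4 else 0)"
proof -
  have b: "base ! 0 = qel c t (of_int 4 / 4) (of_int 0 / 4) (of_int 0 / 4) (of_int 0 / 4)"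
    "base ! 1 = qel c t (of_int 0 / 4) (of_int 4 / 4) (of_int 0 / 4) (of_int 0 / 4)"
    "base ! 2 = qel c t (of_int 0 / 4) (of_int 0 / 4) (of_int 4 / 4) (of_int 0 / 4)"
    "base ! 3 = qel c t (of_int 0 / 4) (of_int 0 / 4) (of_int 0 / 4) (of_int 4 / 4)"
    by (simp_all add: base_def numeral_3_eq_3)
  note e = crd_eqI[OF base_nth b(1)] crd_eqI[OF base_nth b(2)] crd_eqI[OF base_nth b(3)] crd_eqI[OF base_nth b(4)]
  assume "i < 4" "j < 4"
  then show ?thesis unfolding less_4_iff by (elim disjE) (simp_all only: e, simp_all)
qed

lemma sum_less_4: "(\<Sum>i<4. f i) = f 0 + f 1 + f 2 + f (3::nat)"
  by (simp add: eval_nat_numeral)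

lemma base_comb: "(\<Sum>i<4. a i * base ! i) = qel c t (a 0) (a 1) (a 2) (a 3)"
  unfolding sum_less_4 by (simp add: base_def qel_def numeral_3_eq_3)

lemma base_expand: "u \<in> R \<Longrightarrow> 4 * u = (\<Sum>i<4. of_int (crd i u) * base ! i)"
proof -
  assume u: "u \<in> R"
  have "4 * u = 4 * qel c t (of_int (crd 0 u) / 4) (of_int (crd 1 u) / 4) (of_int (crd 2 u) / 4) (of_int (crd 3 u) / 4)"
    using crd[OF u] by simp
  also have "\<dots> = (\<Sum>i<4. of_int (crd i u) * base ! i)" by (simp add: qel_scale base_comb)
  finally show ?thesis .
qed

lemma base_independent: "(\<Sum>i<4. of_int (a i) * base ! i) = 0 \<Longrightarrow> i < 4 \<Longrightarrow> a i = (0::int)"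
  unfolding base_comb less_4_iff using qel_eq_0_int by blast

lemma R_lattice: "int_lattice R"
  using ring_of_integers_closed[OF qfield_subfield] by unfold_locales auto

lemma exists_integral_basis: "\<exists>bs. integral_basis K bs"
\<comment> \<open>For indices from 4 on \<open>crd\<close> reads beyond the end of a list, so the
  coordinates are cut to 0 there to be additive for every index.\<close>
proof (rule triangular_integral_basis[where n = 4 and k = "\<lambda>i u. if i < 4 then crd i u else 0" and e = "\<lambda>i. base ! i"])
  show "int_lattice R" by (rule R_lattice)
  show "u = 0" if "u \<in> R" "\<forall>i<4. (if i < 4 then crd i u else 0) = 0" for u
    using base_expand[OF that(1)] that(2) by simp
  show "(if i < 4 then crd i (u + v) else 0) = (if i < 4 then crd i u else 0) + (if i < 4 then crd i v else 0)"
    if "u \<in> R" "v \<in> R" for i u v using crd_add[OF that] by simp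
  show "base ! i \<in> R \<and> (if i < 4 then crd i (base ! i) else 0) \<noteq> 0 \<and>
      (\<forall>j. i < j \<and> j < 4 \<longrightarrow> (if j < 4 then crd j (base ! i) else 0) = 0)" if "i < 4" for i
    using that base_nth[OF that] crd_base[of _ i] by simp
qed

lemma trace_linear: "trace_linear K"
  unfolding trace_linear_def
proof (intro allI impI)
  fix A :: "nat set" and a :: "nat \<Rightarrow> int" and x
  assume "finite A" "\<forall>i\<in>A. x i \<in> K"
  then show "field_trace K (\<Sum>i\<in>A. of_int (a i) * x i) = (\<Sum>i\<in>A. of_int (a i) * field_trace K (x i))"
  proof (induction A rule: finite_induct)
    case empty
    show ?case using trace_qel[of 0 0 0 0] by (simp add: qel_basis)
  next
    case (insert j A)
    note Ks = subfield_complexD[OF qfield_subfield]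
    have lin: "field_trace K (of_int n * u + v) = of_int n * field_trace K u + field_trace K v" if "u \<in> K" "v \<in> K" for n u v
    proof -
      obtain w x y z where u: "u = qel c t w x y z" "w \<in> \<rat>" "x \<in> \<rat>" "y \<in> \<rat>" "z \<in> \<rat>"
        using \<open>u \<in> K\<close> by (rule qfieldE)
      obtain w' x' y' z' where v: "v = qel c t w' x' y' z'" "w' \<in> \<rat>" "x' \<in> \<rat>" "y' \<in> \<rat>" "z' \<in> \<rat>"
        using \<open>v \<in> K\<close> by (rule qfieldE)
      show ?thesis using u v by (simp add: qel_scale qel_add trace_qel algebra_simps)
    qed
    interpret KL: int_lattice K using Ks by unfold_locales auto
    have "(\<Sum>i\<in>A. of_int (a i) * x i) \<in> K" using insert.prems by (intro KL.sum KL.scale) auto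
    then show ?case using insert lin by simp
  qed
qed

text \<open>Squaring avoids both the sign and a determinant expansion: the trace matrix is, apart
  from its corner entry, supported on an antidiagonal, so its square is the diagonal matrix
  \<open>D\<close>.\<close>

lemma trace_form_base: "(det (trace_form K base))\<^sup>2 = of_int ((256 * (b * c) ^ 3)\<^sup>2)"
proof -
  define n where "n = (of_int (b * c) :: complex)"
  define M where "M = mat 4 4 (\<lambda>(i,j). if i = 0 \<and> j = 0 then 4 else if i + j = 4 then 4 * n else 0 :: complex)"
  have tr: "field_trace K (qel c t w x y z * qel c t w' x' y' z') = 4 * (w * w' + n * (x * z' + z * x' + y * y'))"
    if "w \<in> \<rat>" "x \<in> \<rat>" "y \<in> \<rat>" "z \<in> \<rat>" "w' \<in> \<rat>" "x' \<in> \<rat>" "y' \<in> \<rat>" "z' \<in> \<rat>" for w x y z w' x' y' z'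
    unfolding qel_mult[OF root] n_def by (rule trace_qel) (use that in auto)
  have M: "trace_form K base = M"
    by (rule eq_matI) (auto simp: trace_form_def base_length M_def less_4_iff, simp_all add: base_def tr numeral_3_eq_3)
  define D where "D = mat 4 4 (\<lambda>(i,j). if i = j then (if i = 0 then 16 else (4 * n)\<^sup>2) else 0 :: complex)"
  have "M * M = D"
    by (rule eq_matI)
       (auto simp: M_def D_def scalar_prod_def atLeast0LessThan less_4_iff, simp_all add: sum_less_4 power2_eq_square)
  moreover have "det (M * M) = det M * det M" by (rule det_mult[of _ 4]) (auto simp: M_def)
  moreover have "det D = prod_list (diag_mat D)"
    by (rule det_upper_triangular[of _ 4]) (auto simp: D_def upper_triangular_def)
  moreover have "diag_mat D = [16, (4 * n)\<^sup>2, (4 * n)\<^sup>2, (4 * n)\<^sup>2]"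
    by (simp add: diag_mat_def D_def upt_conv_Cons)
  ultimately have "(det M)\<^sup>2 = 16 * ((4 * n)\<^sup>2 * ((4 * n)\<^sup>2 * (4 * n)\<^sup>2))" by (simp add: power2_eq_square)
  also have "\<dots> = (256 * n ^ 3)\<^sup>2" by (simp add: power_mult_distrib eval_nat_numeral)
  finally show ?thesis unfolding M by (simp add: n_def)
qed

text \<open>The coordinates of an integral basis lie in \<open>1/4 \<int>\<close>, so both transition matrices are integral up to a
  factor \<open>4\<close>; comparing the traces of their two products shows that they are square.\<close>

lemma integral_basis_index:
  assumes bs: "integral_basis K bs"
  shows "length bs = 4" "\<exists>u. u dvd 256 \<and> det (trace_form K base) = of_int (u\<^sup>2) * det (trace_form K bs)"
proof -
  define m where "m = length bs"
  note bs' = bs[unfolded integral_basis_altdef[OF R_lattice] m_def[symmetric]]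
  have sub: "set bs \<subseteq> R" using bs' by simp
  have ind: "a i = 0" if "(\<Sum>i<m. of_int (a i) * bs ! i) = 0" "i < m" for a i using bs' that by blast
  have bR: "bs ! j \<in> R" if "j < m" for j using sub that by (auto simp: m_def)
  have "\<forall>i. \<exists>a. i < 4 \<longrightarrow> base ! i = (\<Sum>j<m. of_int (a j) * bs ! j)" using bs' base_nth by blast
  then obtain U :: "nat \<Rightarrow> nat \<Rightarrow> int" where U: "\<And>i. i < 4 \<Longrightarrow> base ! i = (\<Sum>j<m. of_int (U i j) * bs ! j)"
    by metis
  define T where "T j i = crd i (bs ! j)" for j i
  have T: "4 * bs ! j = (\<Sum>i<4. of_int (T j i) * base ! i)" if "j < m" for j
    using base_expand[OF bR[OF that]] by (simp add: T_def)
  have UT: "(\<Sum>l<m. U i l * T l j) = (if i = j then 4 else 0)" if ij: "i < 4" "j < 4" for i j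
  proof -
    have "(\<Sum>k<4. of_int ((\<Sum>l<m. U i l * T l k) - (if i = k then 4 else 0)) * base ! k) =
       (\<Sum>k<4. \<Sum>l<m. of_int (U i l) * (of_int (T l k) * base ! k)) - (\<Sum>k<4. of_int (if i = k then 4 else 0) * base ! k)"
      by (simp add: left_diff_distrib sum_subtractf sum_distrib_right mult.assoc)
    also have "(\<Sum>k<4. \<Sum>l<m. of_int (U i l) * (of_int (T l k) * base ! k)) = (\<Sum>l<m. of_int (U i l) * (4 * bs ! l))"
      by (subst sum.swap) (simp add: T sum_distrib_left)
    also have "\<dots> = 4 * base ! i" using U ij by (simp add: sum_distrib_left mult_ac)
    also have "(\<Sum>k<4. of_int (if i = k then 4 else 0) * base ! k) = (\<Sum>k<4. if i = k then 4 * base ! k else 0)"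
      by (rule sum.cong) auto
    also have "\<dots> = 4 * base ! i" using ij by simp
    finally have "(\<Sum>k<4. of_int ((\<Sum>l<m. U i l * T l k) - (if i = k then 4 else 0)) * base ! k) = 0" by simp
    from base_independent[OF this ij(2)] show ?thesis by simp
  qed
  have TU: "(\<Sum>l<4. T i l * U l j) = (if i = j then 4 else 0)" if ij: "i < m" "j < m" for i j
  proof -
    have "(\<Sum>k<m. of_int ((\<Sum>l<4. T i l * U l k) - (if i = k then 4 else 0)) * bs ! k) =
       (\<Sum>k<m. \<Sum>l<4. of_int (T i l) * (of_int (U l k) * bs ! k)) - (\<Sum>k<m. of_int (if i = k then 4 else 0) * bs ! k)"
      by (simp add: left_diff_distrib sum_subtractf sum_distrib_right mult.assoc)
    also have "(\<Sum>k<m. \<Sum>l<4. of_int (T i l) * (of_int (U l k) * bs ! k)) = (\<Sum>l<4. of_int (T i l) * base ! l)"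
      by (subst sum.swap) (simp add: U sum_distrib_left)
    also have "\<dots> = 4 * bs ! i" using T ij by simp
    also have "(\<Sum>k<m. of_int (if i = k then 4 else 0) * bs ! k) = (\<Sum>k<m. if i = k then 4 * bs ! k else 0)"
      by (rule sum.cong) auto
    also have "\<dots> = 4 * bs ! i" using ij by simp
    finally have "(\<Sum>k<m. of_int ((\<Sum>l<4. T i l * U l k) - (if i = k then 4 else 0)) * bs ! k) = 0" by simp
    from ind[OF this ij(2)] show ?thesis by simp
  qed
  have "int (4 * m) = (\<Sum>j<m. \<Sum>i<4. T j i * U i j)" using TU by simp
  also have "\<dots> = (\<Sum>i<4. \<Sum>j<m. U i j * T j i)" by (subst sum.swap) (simp add: mult.commute)
  also have "\<dots> = 16" using UT by simp
  finally have m: "m = 4" by simp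
  show "length bs = 4" using m by (simp add: m_def)
  have "det (mat 4 4 (\<lambda>(i,j). U i j)) * det (mat 4 4 (\<lambda>(i,j). T i j)) = 4 ^ 4"
    by (rule det_mult_eq_if_inverse) (use UT m in simp)
  then have "256 = det (mat 4 4 (\<lambda>(i,j). U i j)) * det (mat 4 4 (\<lambda>(i,j). T i j))" by simp
  then have "det (mat 4 4 (\<lambda>(i,j). U i j)) dvd 256" by (rule dvdI)
  moreover have "det (trace_form K base) = of_int ((det (mat 4 4 (\<lambda>(i,j). U i j)))\<^sup>2) * det (trace_form K bs)"
    by (rule trace_form_change[OF qfield_subfield trace_linear base_length])
      (use m base_integral sub U in \<open>auto simp: m_def ring_of_integers_def\<close>)
  ultimately show "\<exists>u. u dvd 256 \<and> det (trace_form K base) = of_int (u\<^sup>2) * det (trace_form K bs)" by blast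
qed

text \<open>With \<open>u\<close> from \<open>integral_basis_index\<close>, the square of
  \<open>u\<close> times the absolute discriminant is \<open>256 * \<bar>b * c\<bar> ^ 3\<close>.
  Since \<open>u\<close> is a nonzero divisor of 256, its square lies between 1 and the square of
  256, which gives the two bounds.\<close>

lemma discriminant_bounds:
  "\<bar>b * c\<bar> ^ 3 \<le> 256 * \<bar>discriminant K\<bar>" "\<bar>discriminant K\<bar> \<le> 256 * \<bar>b * c\<bar> ^ 3"
proof -
  obtain bs where bs: "integral_basis K bs" using exists_integral_basis by blast
  obtain u where u: "u dvd 256" "det (trace_form K base) = of_int (u\<^sup>2) * det (trace_form K bs)"
    using integral_basis_index(2)[OF bs] by blast
  have sub: "set bs \<subseteq> R" using bs by (simp add: integral_basis_def)
  have "\<exists>k. field_trace K (bs ! i * bs ! j) = of_int k" if "i < length bs" "j < length bs" for i j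
  proof -
    have "bs ! i * bs ! j \<in> R"
      using sub that ring_of_integers_closed(4)[OF qfield_subfield] nth_mem by blast
    then show ?thesis using trace_integral by (auto elim: Ints_cases)
  qed
  then obtain k where k: "\<And>i j. i < length bs \<Longrightarrow> j < length bs \<Longrightarrow> field_trace K (bs ! i * bs ! j) = of_int (k i j)"
    by metis
  have "trace_form K bs = map_mat of_int (mat (length bs) (length bs) (\<lambda>(i,j). k i j))"
    by (rule eq_matI) (auto simp: trace_form_def k)
  then obtain d :: int where d: "of_int d = det (trace_form K bs)" by (metis of_int_hom.hom_det)
  have D: "discriminant K = d"
    by (rule discriminant_unique[OF qfield_subfield trace_linear bs _ d])
      (use integral_basis_index(1) bs in simp)
  have "(of_int ((u\<^sup>2 * d)\<^sup>2) :: complex) = of_int ((256 * (b * c) ^ 3)\<^sup>2)"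
    using trace_form_base u(2) d by simp
  then have "(u\<^sup>2 * d)\<^sup>2 = (256 * (b * c) ^ 3)\<^sup>2" by (simp only: of_int_eq_iff)
  then have "\<bar>u\<^sup>2 * d\<bar> = \<bar>256 * (b * c) ^ 3\<bar>" by (simp only: power2_eq_iff abs_eq_iff)
  then have eq: "u\<^sup>2 * \<bar>d\<bar> = 256 * \<bar>b * c\<bar> ^ 3" by (simp add: abs_mult power_abs)
  have u1: "1 \<le> u\<^sup>2" using u(1) by (cases "u = 0") (auto simp: int_one_le_iff_zero_less)
  have "\<bar>u\<bar> \<le> 256" using zdvd_imp_le[of "\<bar>u\<bar>" 256] u(1) by simp
  then have u2: "u\<^sup>2 \<le> 256\<^sup>2" using abs_le_square_iff[of u 256] by simp
  show "\<bar>discriminant K\<bar> \<le> 256 * \<bar>b * c\<bar> ^ 3"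
    using eq mult_right_mono[OF u1, of "\<bar>d\<bar>"] D by simp
  show "\<bar>b * c\<bar> ^ 3 \<le> 256 * \<bar>discriminant K\<bar>"
    using eq mult_right_mono[OF u2, of "\<bar>d\<bar>"] D by simp
qed

end

section \<open>Prime ideals of rings of integers and ramification\<close>

interpretation qvs: vector_space "\<lambda>(q::rat) (x::complex). of_rat q * x"
  by unfold_locales (auto simp: algebra_simps of_rat_add of_rat_mult)

declare qvs.scale_scale [simp del] \<comment> \<open>loops against \<open>of_rat_mult\<close>\<close>

lemma rat_common_denominator:
  fixes u :: "'a \<Rightarrow> rat"
  assumes "finite A"
  shows "\<exists>N>0. \<forall>a\<in>A. of_int N * u a \<in> \<int>"
  using assms
proof (induction A rule: finite_induct)
  case empty then show ?case by (intro exI[of _ 1]) simp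
next
  case (insert x A)
  then obtain N where N: "N > 0" "\<forall>a\<in>A. of_int N * u a \<in> \<int>" by blast
  obtain a d where d: "d > 0" "u x = of_int a / of_int d"
    by (metis Rat_cases Fract_of_int_quotient)
  show ?case
  proof (intro exI[of _ "d * N"] conjI ballI)
    show "d * N > 0" using d N by simp
    fix y assume "y \<in> insert x A"
    then show "of_int (d * N) * u y \<in> \<int>"
    proof
      assume "y = x"
      then have "of_int (d * N) * u y = of_int (N * a)" using d by simp
      then show ?thesis by (simp only: Ints_of_int)
    next
      assume "y \<in> A"
      then have "of_int N * u y \<in> \<int>" using N by blast
      then have "of_int d * (of_int N * u y) \<in> \<int>" by (rule Ints_mult[OF Ints_of_int])
      then show ?thesis by (simp add: mult.assoc)
    qed
  qed
qed

lemma sub_ring_simps [simp]: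
  "carrier (sub_ring S) = S" "x \<otimes>\<^bsub>sub_ring S\<^esub> y = x * y"
  "\<one>\<^bsub>sub_ring S\<^esub> = 1" "\<zero>\<^bsub>sub_ring S\<^esub> = 0" "x \<oplus>\<^bsub>sub_ring S\<^esub> y = x + y"
  by (simp_all add: ring_of_type_algebra_def)

lemma poly_closed:
  fixes S :: "complex set"
  assumes "x \<in> S" "\<And>n. of_int n \<in> S" "\<And>x y. x \<in> S \<Longrightarrow> y \<in> S \<Longrightarrow> x + y \<in> S" "\<And>x y. x \<in> S \<Longrightarrow> y \<in> S \<Longrightarrow> x * y \<in> S"
  shows "poly (map_poly of_int p) x \<in> S"
proof (induction p rule: pCons_induct)
  case 0 then show ?case using assms(2)[of 0] by simp
next
  case (pCons a p)
  then show ?case using assms by (simp add: map_poly_pCons)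
qed

lemma poly_of_int_pCons:
  "poly (map_poly of_int (pCons a p)) x = of_int a + x * (poly (map_poly of_int p) x :: complex)"
  by (cases "a = 0 \<and> p = 0") (auto simp: map_poly_pCons)

section \<open>A nonzero prime ideal of a ring of integers and its square\<close>

locale number_field_prime =
  fixes L P :: "complex set"
  assumes L: "subfield L complex_ring"
    and P: "primeideal P (sub_ring (ring_of_integers L))" and nonzero: "P \<noteq> {0}"
    and fin: "\<exists>B. finite B \<and> L \<subseteq> qvs.span B"
begin

abbreviation "R \<equiv> ring_of_integers L"
abbreviation "PP \<equiv> ideal_prod (sub_ring R) P P"

lemmas Rcl = ring_of_integers_closed[OF L]

lemma P_ideal: "ideal P (sub_ring R)" using P by (simp add: primeideal_def)

lemma ring_R: "ring (sub_ring R)" using P_ideal by (simp add: ideal_def)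

lemma P_sub: "x \<in> P \<Longrightarrow> x \<in> R"
  using ideal.Icarr[OF P_ideal] by simp

lemma P_mult: "a \<in> R \<Longrightarrow> x \<in> P \<Longrightarrow> a * x \<in> P"
  using ideal.I_l_closed[OF P_ideal, of x a] by simp

lemma P_zero: "0 \<in> P"
  using additive_subgroup.zero_closed[OF ideal.axioms(1)[OF P_ideal]] by simp

lemma P_add: "x \<in> P \<Longrightarrow> y \<in> P \<Longrightarrow> x + y \<in> P"
  using additive_subgroup.a_closed[OF ideal.axioms(1)[OF P_ideal]] by simp

lemma P_neg: "x \<in> P \<Longrightarrow> - x \<in> P"
  using P_mult[of "-1" x] Rcl(2,5) by simp

lemma P_diff: "x \<in> P \<Longrightarrow> y \<in> P \<Longrightarrow> x - y \<in> P"
  using P_add[of x "- y"] P_neg by simp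

lemma P_prime: "x \<in> R \<Longrightarrow> y \<in> R \<Longrightarrow> x * y \<in> P \<Longrightarrow> x \<in> P \<or> y \<in> P"
  using primeideal.I_prime[OF P, of x y] by simp

lemma one_notin: "1 \<notin> P"
proof
  assume 1: "1 \<in> P"
  have "R \<subseteq> P" using P_mult[OF _ 1] by auto
  then have "P = R" using P_sub by auto
  then show False using primeideal.I_notcarr[OF P] by simp
qed

lemma PP_ideal: "ideal PP (sub_ring R)"
  by (rule ring.ideal_prod_is_ideal[OF ring_R P_ideal P_ideal])

lemma PP_mult: "a \<in> R \<Longrightarrow> x \<in> PP \<Longrightarrow> a * x \<in> PP"
  using ideal.I_l_closed[OF PP_ideal, of x a] by simp

lemma PP_add: "x \<in> PP \<Longrightarrow> y \<in> PP \<Longrightarrow> x + y \<in> PP"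
  using additive_subgroup.a_closed[OF ideal.axioms(1)[OF PP_ideal]] by simp

lemma PP_diff: "x \<in> PP \<Longrightarrow> y \<in> PP \<Longrightarrow> x - y \<in> PP"
  using PP_add[of x "-1 * y"] PP_mult[of "-1" y] Rcl(2,5) by simp

lemma PP_prod: "x \<in> P \<Longrightarrow> y \<in> P \<Longrightarrow> x * y \<in> PP"
  using ideal_prod.prod[of x P y P "sub_ring R"] by simp

text \<open>In an integral relation for a nonzero \<open>x \<in> P\<close>, powers of
  \<open>x\<close> can be cancelled until the constant term is nonzero. That term is a multiple of
  \<open>x\<close>, so it lies in \<open>P\<close>, and primality passes to one of its prime
  factors.\<close>

lemma obtain_rational_prime: obtains q :: int where "Factorial_Ring.prime q" "of_int q \<in> P"
proof -
  obtain x where x: "x \<in> P" "x \<noteq> 0" using nonzero P_zero by blast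
  then have "algebraic_int x" using P_sub by (auto simp: ring_of_integers_def)
  then obtain p where p: "poly (map_poly of_int p) x = 0" "lead_coeff p = 1"
    by (auto simp: algebraic_int_altdef_ipoly)
  have "p \<noteq> 0 \<longrightarrow> poly (map_poly of_int p) x = 0 \<longrightarrow> (\<exists>a\<noteq>0. of_int a \<in> P)" for p
  proof (induction p rule: pCons_induct)
    case (pCons a p)
    have px: "poly (map_poly of_int p) x \<in> R"
      by (rule poly_closed) (use x P_sub Rcl in auto)
    show ?case
    proof (intro impI)
      assume 0: "poly (map_poly of_int (pCons a p)) x = 0" and nz: "pCons a p \<noteq> 0"
      show "\<exists>a\<noteq>0. of_int a \<in> P"
      proof (cases "a = 0")
        case True
        then show ?thesis using pCons 0 nz x by (simp add: poly_of_int_pCons)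
      next
        case False
        have "of_int a = - (poly (map_poly of_int p) x * x)"
          using 0 by (simp add: poly_of_int_pCons eq_neg_iff_add_eq_0 mult.commute)
        then have "of_int a \<in> P" using P_neg P_mult[OF px x(1)] by simp
        then show ?thesis using False by blast
      qed
    qed
  qed simp
  from this[of p] have "\<exists>a::int. a \<noteq> 0 \<and> of_int a \<in> P" using p by auto
  then obtain a :: int where a: "a \<noteq> 0" "of_int a \<in> P" by blast
  have "a \<noteq> 0 \<longrightarrow> of_int a \<in> P \<longrightarrow> (\<exists>q. Factorial_Ring.prime q \<and> of_int q \<in> P)" for a :: int
  proof (induction a rule: prime_divisors_induct)
    case (unit a)
    then have "a = 1 \<or> a = -1" by auto
    then have "(of_int a :: complex) = 1 \<or> (of_int a :: complex) = - 1" by auto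
    then show ?case using one_notin P_neg[of "- 1"] by auto
  next
    case (factor q a)
    show ?case
    proof (intro impI)
      assume "q * a \<noteq> 0" "of_int (q * a) \<in> P"
      then have "of_int q \<in> P \<or> of_int a \<in> P" using P_prime Rcl(8) by simp
      then show "\<exists>q. Factorial_Ring.prime q \<and> of_int q \<in> P" using factor \<open>q * a \<noteq> 0\<close> by auto
    qed
  qed simp
  then show ?thesis using a that by blast
qed

lemma int_in_prime_iff:
  assumes "Factorial_Ring.prime q" "of_int q \<in> P"
  shows "of_int k \<in> P \<longleftrightarrow> q dvd k"
proof
  assume "q dvd k"
  then obtain j where "k = q * j" by auto
  then show "of_int k \<in> P" using P_mult[of "of_int j" "of_int q"] assms Rcl(8) by (simp add: mult.commute)
next
  assume k: "of_int k \<in> P"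
  show "q dvd k"
  proof (rule ccontr)
    assume "\<not> q dvd k"
    then have "Rings.coprime q k" using assms(1) prime_imp_coprime by blast
    then obtain u v where "u * q + v * k = 1" using bezout_int[of q k] by auto
    then have "of_int u * of_int q + of_int v * of_int k = (1 :: complex)"
      by (metis of_int_1 of_int_add of_int_mult)
    then have "1 \<in> P" using P_add[OF P_mult[OF Rcl(8) assms(2)] P_mult[OF Rcl(8) k]] by metis
    then show False using one_notin by simp
  qed
qed

text \<open>The inverse is an integer polynomial in \<open>x\<close>, so it stays in every subfield
  that contains \<open>x\<close>. The relation of \<open>x\<close> is read modulo \<open>P\<close>:
  a constant term divisible by \<open>q\<close> is dropped and \<open>x\<close> cancelled, until the
  constant term is invertible modulo \<open>q\<close>.\<close>

lemma inverse_mod_P: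
  assumes x: "x \<in> R" "x \<notin> P"
  obtains h :: "int poly" where "poly (map_poly of_int h) x * x - 1 \<in> P"
proof -
  obtain q :: int where q: "Factorial_Ring.prime q" "of_int q \<in> P" by (rule obtain_rational_prime)
  have "algebraic_int x" using x by (auto simp: ring_of_integers_def)
  then obtain p where p: "poly (map_poly of_int p) x = 0" "lead_coeff p = 1"
    by (auto simp: algebraic_int_altdef_ipoly)
  have "lead_coeff p = 1 \<longrightarrow> poly (map_poly of_int p) x \<in> P \<longrightarrow>
     (\<exists>h. poly (map_poly of_int h) x * x - 1 \<in> P)" for p
  proof (induction p rule: pCons_induct)
    case (pCons a p)
    have px: "poly (map_poly of_int p) x \<in> R" by (rule poly_closed) (use x Rcl in auto)
    show ?case
    proof (intro impI)
      assume l: "lead_coeff (pCons a p) = 1" and "poly (map_poly of_int (pCons a p)) x \<in> P"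
      then have inP: "of_int a + x * poly (map_poly of_int p) x \<in> P" by (simp add: poly_of_int_pCons)
      show "\<exists>h. poly (map_poly of_int h) x * x - 1 \<in> P"
      proof (cases "q dvd a")
        case True
        then have aP: "of_int a \<in> P" using int_in_prime_iff[OF q] by simp
        have "p \<noteq> 0"
        proof
          assume "p = 0"
          then have "a = 1" using l by simp
          then show False using aP one_notin by simp
        qed
        then have "lead_coeff p = 1" using l by simp
        moreover have "x * poly (map_poly of_int p) x \<in> P" using P_diff[OF inP aP] by simp
        then have "poly (map_poly of_int p) x \<in> P" using P_prime[OF x(1) px] x(2) by blast
        ultimately show ?thesis using pCons.IH by blast
      next
        case False
        then have "Rings.coprime q a" using q(1) prime_imp_coprime by blast
        then obtain u v where "u * q + v * a = 1" using bezout_int[of q a] by auto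
        then have uv: "of_int u * of_int q + of_int v * of_int a = (1 :: complex)"
          by (metis of_int_1 of_int_add of_int_mult)
        have "- (of_int v * (of_int a + x * poly (map_poly of_int p) x) + of_int u * of_int q) \<in> P"
          by (intro P_neg P_add P_mult Rcl(8) inP q)
        also have "- (of_int v * (of_int a + x * poly (map_poly of_int p) x) + of_int u * of_int q) =
           (- of_int v * poly (map_poly of_int p) x) * x - 1"
          using uv by (simp add: algebra_simps)
        also have "- of_int v * poly (map_poly of_int p) x = poly (map_poly of_int (Polynomial.smult (- v) p)) x"
          by (simp only: of_int_hom.map_poly_hom_smult poly_smult of_int_minus)
        finally show ?thesis by blast
      qed
    qed
  qed simp
  from this[of p] have "\<exists>h. poly (map_poly of_int h) x * x - 1 \<in> P" using p P_zero by simp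
  then show ?thesis using that by blast
qed

text \<open>If \<open>h\<close> inverts \<open>w\<close> modulo \<open>P\<close>, then
  \<open>y\<close> is \<open>h * (w * y)\<close> minus \<open>(h * w - 1) * y\<close>, and both
  terms lie in \<open>PP\<close>.\<close>

lemma PP_cancel:
  assumes "w \<in> R" "w \<notin> P" "y \<in> P" "w * y \<in> PP"
  shows "y \<in> PP"
proof -
  obtain h :: "int poly" where h: "poly (map_poly of_int h) w * w - 1 \<in> P"
    by (rule inverse_mod_P[OF assms(1,2)])
  have hR: "poly (map_poly of_int h) w \<in> R" by (rule poly_closed) (use assms(1) Rcl in auto)
  have "poly (map_poly of_int h) w * (w * y) - (poly (map_poly of_int h) w * w - 1) * y \<in> PP"
    by (intro PP_diff PP_mult[OF hR] PP_prod h assms)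
  also have "poly (map_poly of_int h) w * (w * y) - (poly (map_poly of_int h) w * w - 1) * y = y"
    by (simp add: algebra_simps)
  finally show ?thesis .
qed

text \<open>A substitute for Noetherianity that is enough for Nakayama's argument: generation up to factors
  outside \<open>P\<close>. Elements independent modulo a rational prime \<open>q \<in> P\<close> are independent over \<open>\<rat>\<close>, so a
  maximal such family in \<open>P\<close>, together with \<open>q\<close>, generates \<open>P\<close> in this sense.\<close>

definition locally_generates :: "complex set \<Rightarrow> bool" where
  "locally_generates S \<longleftrightarrow> finite S \<and> S \<subseteq> P \<and>
     (\<forall>y\<in>P. \<exists>s a. s \<in> R \<and> s \<notin> P \<and> (\<forall>x\<in>S. a x \<in> R) \<and> s * y = (\<Sum>x\<in>S. a x * x))"

text \<open>Independence over the field with \<open>q\<close> elements of the images in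
  \<open>R\<close> modulo \<open>q R\<close>, for elements chosen from \<open>P\<close>.\<close>

definition independent_mod :: "int \<Rightarrow> complex set \<Rightarrow> bool" where
  "independent_mod q S \<longleftrightarrow> finite S \<and> S \<subseteq> P \<and>
     (\<forall>k. (\<exists>u\<in>R. (\<Sum>x\<in>S. of_int (k x) * x) = of_int q * u) \<longrightarrow> (\<forall>x\<in>S. q dvd k x))"

text \<open>A rational relation becomes an integral one after clearing denominators. Its
  coefficients can be divided by \<open>q\<close> again and again, so each is divisible by every
  power of \<open>q\<close> and vanishes.\<close>

lemma independent_mod_imp_independent:
  assumes q: "Factorial_Ring.prime q" and S: "independent_mod q S"
  shows "qvs.independent S"
proof
  assume "qvs.dependent S"
  then obtain T u v where T: "finite T" "T \<subseteq> S" "(\<Sum>v\<in>T. of_rat (u v) * v) = 0" "v \<in> T" "u v \<noteq> 0"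
    unfolding qvs.dependent_explicit by blast
  obtain N where N: "N > 0" "\<forall>a\<in>T. of_int N * u a \<in> \<int>"
    using rat_common_denominator[OF T(1), of u] by blast
  define k where "k a = (if a \<in> T then \<lfloor>of_int N * u a\<rfloor> else 0)" for a
  have k: "of_int (k a) = of_int N * u a" if "a \<in> T" for a
    using N(2) that by (auto simp: k_def elim!: Ints_cases)
  have "(\<Sum>x\<in>S. of_int (k x) * x) = (\<Sum>x\<in>T. of_int (k x) * x)"
    using S T by (intro sum.mono_neutral_right) (auto simp: independent_mod_def k_def)
  also have "\<dots> = (\<Sum>x\<in>T. of_int N * (of_rat (u x) * x))"
  proof (rule sum.cong)
    fix x assume "x \<in> T"
    then have "of_rat (of_int (k x)) = (of_rat (of_int N * u x) :: complex)" using k by simp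
    then have "of_int (k x) = (of_int N * of_rat (u x) :: complex)" by (simp add: of_rat_mult)
    then show "of_int (k x) * x = of_int N * (of_rat (u x) * x)" by simp
  qed simp
  also have "\<dots> = 0" using T(3) by (simp flip: sum_distrib_left)
  finally have 0: "(\<Sum>x\<in>S. of_int (k x) * x) = 0" .
  have all: "(\<Sum>x\<in>S. of_int (k x) * x) = 0 \<Longrightarrow> x \<in> S \<Longrightarrow> q ^ n dvd k x" for k n x
  proof (induction n arbitrary: k)
    case (Suc n)
    have "\<forall>x\<in>S. q dvd k x"
      using S Suc.prems(1) Rcl(1) unfolding independent_mod_def by (metis mult_zero_right)
    then have k: "k x = q * (k x div q)" if "x \<in> S" for x using that by auto
    have "(\<Sum>x\<in>S. of_int (k x) * x) = of_int q * (\<Sum>x\<in>S. of_int (k x div q) * x)"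
      unfolding sum_distrib_left
    proof (rule sum.cong)
      fix x assume "x \<in> S"
      then have "(of_int (k x) :: complex) = of_int q * of_int (k x div q)" using k by (metis of_int_mult)
      then show "of_int (k x) * x = of_int q * (of_int (k x div q) * x)" by simp
    qed simp
    then have "(\<Sum>x\<in>S. of_int (k x div q) * x) = 0" using Suc.prems(1) q by auto
    from Suc.IH[OF this Suc.prems(2)] show ?case using k[OF Suc.prems(2)] by (metis mult_dvd_mono dvd_refl power_Suc)
  qed simp
  have "v \<in> S" using T by auto
  have "k v = 0"
  proof (rule ccontr)
    assume "k v \<noteq> 0"
    then have "finite {n. q ^ n dvd k v}" using q not_prime_unit by (intro finite_divisor_powers) auto
    moreover have "{n. q ^ n dvd k v} = UNIV" using all[OF 0 \<open>v \<in> S\<close>] by auto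
    ultimately show False by simp
  qed
  then show False using k[OF T(4)] T(5) N(1) by simp
qed

lemma exists_locally_generates: "\<exists>S. locally_generates S"
proof -
  obtain q :: int where q: "Factorial_Ring.prime q" "of_int q \<in> P" by (rule obtain_rational_prime)
  have q0: "(of_int q :: complex) \<noteq> 0" using q by auto
  obtain B where B: "finite B" "L \<subseteq> qvs.span B" using fin by blast
  \<comment> \<open>The finite rational dimension of \<open>L\<close> bounds these families, so one
    of maximal size exists.\<close>
  have bound: "card S \<le> card B" if "independent_mod q S" for S
  proof -
    have "S \<subseteq> L" using that P_sub by (auto simp: independent_mod_def ring_of_integers_def)
    then show ?thesis
      using qvs.independent_span_bound[OF B(1) independent_mod_imp_independent[OF q(1) that]] B(2) by auto
  qed
  have "independent_mod q {}" by (simp add: independent_mod_def)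
  then obtain S where S: "independent_mod q S" and max: "\<And>Y. independent_mod q Y \<Longrightarrow> card Y \<le> card S"
    using ex_has_greatest_nat[of "independent_mod q" "{}" card "Suc (card B)"] bound less_Suc_eq_le by blast
  have fS: "finite S" and SP: "S \<subseteq> P" using S by (auto simp: independent_mod_def)
  have Si: "q dvd k x" if "(\<Sum>x\<in>S. of_int (k x) * x) = of_int q * u" "u \<in> R" "x \<in> S" for k u x
    using S that unfolding independent_mod_def by blast
  \<comment> \<open>\<open>q\<close> is 0 modulo \<open>q R\<close>, so it cannot belong to an
    independent family.\<close>
  have qS: "of_int q \<notin> S"
  proof
    assume qS: "of_int q \<in> S"
    have "(\<Sum>x\<in>S. of_int (if x = of_int q then 1 else 0) * x) = (\<Sum>x\<in>S. if x = of_int q then x else 0)"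
      by (rule sum.cong) auto
    also have "\<dots> = of_int q * 1" using fS qS by simp
    finally have "q dvd (if of_int q = (of_int q :: complex) then 1 else 0)" by (rule Si[OF _ Rcl(2) qS])
    then show False using q(1) not_prime_unit by auto
  qed
  have "locally_generates (insert (of_int q) S)"
    unfolding locally_generates_def
  proof (intro conjI ballI)
    show "finite (insert (of_int q) S)" "insert (of_int q) S \<subseteq> P" using fS SP q by auto
    fix y assume y: "y \<in> P"
    show "\<exists>s a. s \<in> R \<and> s \<notin> P \<and> (\<forall>x\<in>insert (of_int q) S. a x \<in> R) \<and> s * y = (\<Sum>x\<in>insert (of_int q) S. a x * x)"
    proof (cases "y \<in> S")
      case True
      have "(\<Sum>x\<in>insert (of_int q) S. (if x = y then 1 else 0) * x) = (\<Sum>x\<in>insert (of_int q) S. if x = y then x else 0)"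
        by (rule sum.cong) auto
      also have "\<dots> = 1 * y" using fS True by simp
      finally show ?thesis using one_notin Rcl(1,2)
        by (intro exI[of _ 1] exI[of _ "\<lambda>x. if x = y then 1 else 0"]) auto
    next
      case False
      have "\<not> independent_mod q (insert y S)" using max[of "insert y S"] fS False by auto
      then obtain k u z where k: "u \<in> R" "(\<Sum>x\<in>insert y S. of_int (k x) * x) = of_int q * u" "z \<in> insert y S" "\<not> q dvd k z"
        using fS SP y unfolding independent_mod_def by auto
      have eq: "of_int (k y) * y + (\<Sum>x\<in>S. of_int (k x) * x) = of_int q * u" using k(2) fS False by simp
      \<comment> \<open>Otherwise the term of \<open>y\<close> could be absorbed into
        \<open>q R\<close>, leaving a forbidden relation among the elements of \<open>S\<close>
        alone. So \<open>k y\<close> can serve as the factor outside \<open>P\<close>.\<close>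
      have ndvd: "\<not> q dvd k y"
      proof
        assume "q dvd k y"
        then obtain j where j: "k y = q * j" by auto
        have "(\<Sum>x\<in>S. of_int (k x) * x) = of_int q * (u - of_int j * y)"
          using eq j by (simp add: algebra_simps)
        moreover have "u - of_int j * y \<in> R" using k(1) Rcl(4,6,8) P_sub[OF y] by simp
        ultimately have "\<forall>x\<in>S. q dvd k x" using Si by blast
        then show False using k(3,4) \<open>q dvd k y\<close> by auto
      qed
      define a where "a x = (if x = of_int q then u else - of_int (k x))" for x
      have "(\<Sum>x\<in>insert (of_int q) S. a x * x) = u * of_int q + (\<Sum>x\<in>S. a x * x)"
        using fS qS by (simp add: a_def)
      also have "(\<Sum>x\<in>S. a x * x) = (\<Sum>x\<in>S. - (of_int (k x) * x))"
        by (rule sum.cong) (use qS in \<open>auto simp: a_def\<close>)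
      finally have "(\<Sum>x\<in>insert (of_int q) S. a x * x) = of_int q * u - (\<Sum>x\<in>S. of_int (k x) * x)"
        by (simp add: sum_negf)
      also have "\<dots> = of_int (k y) * y" using eq by (metis add_diff_cancel_right')
      finally have "of_int (k y) * y = (\<Sum>x\<in>insert (of_int q) S. a x * x)" by (rule sym)
      moreover have "\<forall>x\<in>insert (of_int q) S. a x \<in> R" using k(1) Rcl(5,8) by (auto simp: a_def)
      moreover have "of_int (k y) \<notin> P" using ndvd int_in_prime_iff[OF q] by simp
      ultimately show ?thesis using Rcl(8) by blast
    qed
  qed
  then show ?thesis by blast
qed

lemma not_idempotent: "\<exists>x\<in>P. x \<notin> PP"
proof (rule ccontr)
  assume "\<not> ?thesis"
  then have idem: "P \<subseteq> PP" by blast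
  obtain S0 where "locally_generates S0" using exists_locally_generates by blast
  then obtain S where S: "locally_generates S" and min: "\<And>Y. locally_generates Y \<Longrightarrow> card S \<le> card Y"
    using exists_least_iff[of "\<lambda>n. \<exists>S. locally_generates S \<and> card S = n"] by (metis linorder_not_less)
  have fS: "finite S" and SP: "S \<subseteq> P" using S by (auto simp: locally_generates_def)
  have gen: "\<exists>s a. s \<in> R \<and> s \<notin> P \<and> (\<forall>x\<in>S. a x \<in> R) \<and> s * y = (\<Sum>x\<in>S. a x * x)" if "y \<in> P" for y
    using S that by (simp add: locally_generates_def)
  have "S \<noteq> {}"
  proof
    assume e: "S = {}"
    have "y = 0" if y: "y \<in> P" for y
    proof -
      obtain s where "s \<notin> P" "s * y = 0" using gen[OF y] e by auto
      then show ?thesis using P_zero by auto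
    qed
    then show False using nonzero P_zero by blast
  qed
  then obtain x where x: "x \<in> S" by blast
  have genPP: "\<exists>s a. s \<in> R \<and> s \<notin> P \<and> (\<forall>x\<in>S. a x \<in> P) \<and> s * z = (\<Sum>x\<in>S. a x * x)" if "z \<in> PP" for z
    using that
  proof (induction rule: ideal_prod.induct)
    case (prod i j)
    obtain s a where s: "s \<in> R" "s \<notin> P" "\<forall>x\<in>S. a x \<in> R" "s * j = (\<Sum>x\<in>S. a x * x)"
      using gen[OF prod(2)] by blast
    have "s * (i * j) = (\<Sum>x\<in>S. (a x * i) * x)"
    proof -
      have "s * (i * j) = i * (s * j)" by simp
      then show ?thesis unfolding s(4) sum_distrib_left by (simp add: mult_ac)
    qed
    moreover have "\<forall>x\<in>S. a x * i \<in> P" using s(3) P_mult prod(1) by blast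
    ultimately show ?case using s(1,2)
      by (intro exI[of _ s] exI[of _ "\<lambda>x. a x * i"]) simp
  next
    case (sum z1 z2)
    obtain s a where s: "s \<in> R" "s \<notin> P" "\<forall>x\<in>S. a x \<in> P" "s * z1 = (\<Sum>x\<in>S. a x * x)" using sum.IH(1) by blast
    obtain r b where r: "r \<in> R" "r \<notin> P" "\<forall>x\<in>S. b x \<in> P" "r * z2 = (\<Sum>x\<in>S. b x * x)" using sum.IH(2) by blast
    have "(s * r) * (z1 + z2) = r * (s * z1) + s * (r * z2)" by (simp add: algebra_simps)
    also have "\<dots> = (\<Sum>x\<in>S. (r * a x + s * b x) * x)"
      unfolding s(4) r(4) sum_distrib_left by (simp add: sum.distrib algebra_simps)
    finally have "(s * r) * (z1 + z2) = (\<Sum>x\<in>S. (r * a x + s * b x) * x)" .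
    moreover have "s * r \<in> R" "s * r \<notin> P" using s r P_prime Rcl(4) by blast+
    moreover have "\<forall>x\<in>S. r * a x + s * b x \<in> P" using s r P_add P_mult by blast
    ultimately show ?case by (intro exI[of _ "s * r"] exI[of _ "\<lambda>x. r * a x + s * b x"]) simp
  qed
  have "x \<in> PP" using x SP idem by blast
  then obtain s a where s: "s \<in> R" "s \<notin> P" "\<forall>x\<in>S. a x \<in> P" "s * x = (\<Sum>y\<in>S. a y * y)"
    using genPP by blast
  define r where "r = s - a x"
  have aR: "a y \<in> R" if "y \<in> S" for y using s(3) that P_sub by blast
  have rR: "r \<in> R" using s x Rcl(6) aR by (simp add: r_def)
  have rP: "r \<notin> P"
  proof
    assume "r \<in> P"
    then have "r + a x \<in> P" using s(3) x P_add by blast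
    then show False using s(2) by (simp add: r_def)
  qed
  have rx: "r * x = (\<Sum>y\<in>S - {x}. a y * y)"
    using s(4) sum.remove[OF fS x, of "\<lambda>y. a y * y"] by (simp add: r_def algebra_simps)
  have "locally_generates (S - {x})"
    unfolding locally_generates_def
  proof (intro conjI ballI)
    show "finite (S - {x})" "S - {x} \<subseteq> P" using fS SP by auto
    fix y assume "y \<in> P"
    then obtain w b where w: "w \<in> R" "w \<notin> P" "\<forall>x\<in>S. b x \<in> R" "w * y = (\<Sum>x\<in>S. b x * x)" using gen by blast
    have "(r * w) * y = r * (b x * x + (\<Sum>z\<in>S - {x}. b z * z))"
      using w(4) sum.remove[OF fS x, of "\<lambda>z. b z * z"] by (simp add: mult.assoc)
    also have "\<dots> = b x * (r * x) + r * (\<Sum>z\<in>S - {x}. b z * z)" by (simp add: algebra_simps)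
    also have "\<dots> = (\<Sum>z\<in>S - {x}. (b x * a z + r * b z) * z)"
      unfolding rx sum_distrib_left by (simp add: sum.distrib algebra_simps)
    finally have "(r * w) * y = (\<Sum>z\<in>S - {x}. (b x * a z + r * b z) * z)" .
    moreover have "r * w \<in> R" "r * w \<notin> P" using w rR rP P_prime Rcl(4) by blast+
    moreover have "\<forall>z\<in>S - {x}. b x * a z + r * b z \<in> R" using w(3) x aR rR Rcl(3,4) by blast
    ultimately show "\<exists>s a. s \<in> R \<and> s \<notin> P \<and> (\<forall>x\<in>S - {x}. a x \<in> R) \<and> s * y = (\<Sum>x\<in>S - {x}. a x * x)"
      by (intro exI[of _ "r * w"] exI[of _ "\<lambda>z. b x * a z + r * b z"]) simp
  qed
  from min[OF this] show False using fS x by (metis card_Diff1_less linorder_not_less)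
qed

text \<open>Powers of \<open>P\<close> decrease, so the index is below 2 as soon as one element of
  \<open>P\<close> from \<open>K\<close> is missing from \<open>PP\<close>.\<close>

lemma ramification_index_eq_1:
  assumes K: "subfield K complex_ring" "K \<subseteq> L" and x: "x \<in> P" "x \<in> ring_of_integers K" "x \<notin> PP"
  shows "ramification_index L K P = 1"
proof -
  define Q where "Q = (\<lambda>n::nat. P [^]\<^bsub>ideals_set (sub_ring R)\<^esub> n)"
  have Q0: "Q 0 = R" by (simp add: Q_def nat_pow_def ideals_set_def)
  have QS: "Q (Suc n) = ideal_prod (sub_ring R) (Q n) P" for n by (simp add: Q_def nat_pow_def ideals_set_def)
  have Qi: "ideal (Q n) (sub_ring R)" for n
  proof (induction n)
    case 0 then show ?case using ring.oneideal[OF ring_R] by (simp add: Q0)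
  next
    case (Suc n) then show ?case unfolding QS by (rule ring.ideal_prod_is_ideal[OF ring_R _ P_ideal])
  qed
  have Qdec: "Q (Suc n) \<subseteq> Q n" for n
    unfolding QS using ring.ideal_prod_inter[OF ring_R Qi P_ideal] by blast
  have Q1: "Q 1 = P"
  proof
    show "Q 1 \<subseteq> P" using ring.ideal_prod_inter[OF ring_R Qi P_ideal, of 0] QS[of 0] by auto
    show "P \<subseteq> Q 1"
    proof
      fix y assume "y \<in> P"
      then have "1 * y \<in> Q 1" using ideal_prod.prod[of 1 "Q 0" y P "sub_ring R"] QS[of 0] Q0 Rcl(2) by simp
      then show "y \<in> Q 1" by simp
    qed
  qed
  have Q2: "Q 2 = PP" using QS[of 1] Q1 by (simp add: numeral_2_eq_2)
  have KR: "ring_of_integers K \<subseteq> R" using K(2) by (auto simp: ring_of_integers_def)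
  define S where "S = P \<inter> ring_of_integers K"
  have sub: "genideal (sub_ring R) S \<subseteq> I \<longleftrightarrow> S \<subseteq> I" if "ideal I (sub_ring R)" for I
  proof -
    have "S \<subseteq> genideal (sub_ring R) S" unfolding genideal_def by blast
    then show ?thesis unfolding genideal_def using that by blast
  qed
  have "(GREATEST e. genideal (sub_ring R) S \<subseteq> Q e) = 1"
  proof (rule Greatest_equality)
    show "genideal (sub_ring R) S \<subseteq> Q 1" unfolding Q1 sub[OF P_ideal] by (simp add: S_def)
    fix e assume "genideal (sub_ring R) S \<subseteq> Q e"
    then have "S \<subseteq> Q e" unfolding sub[OF Qi] .
    show "e \<le> 1"
    proof (rule ccontr)
      assume "\<not> e \<le> 1"
      then have "Q e \<subseteq> Q 2" using lift_Suc_antimono_le[of Q 2 e] Qdec by simp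
      then show False using x \<open>S \<subseteq> Q e\<close> Q2 by (auto simp: S_def)
    qed
  qed
  then show ?thesis unfolding ramification_index_def Let_def S_def Q_def .
qed

text \<open>If \<open>P\<^sup>2\<close> contained \<open>P \<inter> K\<close>, then \<open>P = P\<^sup>2\<close>. For \<open>D x = A + B th\<close> in \<open>P\<close> either \<open>B\<close> and hence \<open>A\<close> lie
  in \<open>P \<inter> K\<close>, or \<open>th\<close> is congruent modulo \<open>P\<close> to some \<open>r\<close> in \<open>K\<close>. In the second case the minimal polynomial
  of \<open>th\<close> at \<open>r\<close> lies in \<open>P \<inter> K\<close>, and its other factor is not in \<open>P\<close>, so \<open>th - r\<close> is in \<open>P\<^sup>2\<close>.\<close>

lemma unramified_criterion:
  assumes K: "subfield K complex_ring" "K \<subseteq> L" and D: "D \<in> R" "D \<notin> P"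
    and th: "th \<in> R" "s \<in> ring_of_integers K" "n \<in> ring_of_integers K" "th\<^sup>2 = s * th - n"
    and disc: "2 * th - s \<notin> P"
    and gen: "\<And>x. x \<in> R \<Longrightarrow> \<exists>A\<in>ring_of_integers K. \<exists>B\<in>ring_of_integers K. D * x = A + B * th"
  shows "ramification_index L K P = 1"
proof -
  note Kcl = ring_of_integers_closed[OF K(1)]
  have KR: "x \<in> R" if "x \<in> ring_of_integers K" for x using K(2) that by (auto simp: ring_of_integers_def)
  have "\<exists>x\<in>P. x \<in> ring_of_integers K \<and> x \<notin> PP"
  proof (rule ccontr)
    assume "\<not> ?thesis"
    then have deep: "x \<in> PP" if "x \<in> P" "x \<in> ring_of_integers K" for x using that by blast
    have "x \<in> PP" if x: "x \<in> P" for x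
    proof -
      obtain A B where AB: "A \<in> ring_of_integers K" "B \<in> ring_of_integers K" "D * x = A + B * th"
        using gen[OF P_sub[OF x]] by blast
      have Dx: "A + B * th \<in> P" using P_mult[OF D(1) x] AB(3) by simp
      have "A + B * th \<in> PP"
      proof (cases "B \<in> P")
        case True
        have "A + B * th - th * B \<in> P" by (intro P_diff Dx P_mult th True)
        then have "A \<in> PP" using deep AB(1) by (simp add: mult.commute)
        moreover have "th * B \<in> PP" by (intro PP_mult th deep True AB)
        ultimately show ?thesis using PP_add by (simp add: mult.commute)
      next
        case False
        obtain h :: "int poly" where h: "poly (map_poly of_int h) B * B - 1 \<in> P"
          by (rule inverse_mod_P[OF KR[OF AB(2)] False])
        define C where "C = poly (map_poly of_int h) B"
        have CK: "C \<in> ring_of_integers K" unfolding C_def by (rule poly_closed) (use AB Kcl in auto)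
        define r where "r = - (C * A)"
        have rK: "r \<in> ring_of_integers K" using CK AB Kcl(4,5) by (simp add: r_def)
        have "C * (A + B * th) - th * (C * B - 1) \<in> P"
          by (rule P_diff[OF P_mult[OF KR[OF CK] Dx] P_mult[OF th(1) h[folded C_def]]])
        also have "C * (A + B * th) - th * (C * B - 1) = th - r" by (simp add: r_def algebra_simps)
        finally have thr: "th - r \<in> P" .
        have w: "r - s + th \<in> R" using KR rK th Rcl(3,6) by simp
        have wP: "r - s + th \<notin> P"
        proof
          assume "r - s + th \<in> P"
          then have "r - s + th + (th - r) \<in> P" using thr by (rule P_add)
          then show False using disc by (simp add: algebra_simps)
        qed
        have fr: "(r - s + th) * (th - r) = - (r\<^sup>2 - s * r + n)"
          using th(4) by (simp add: algebra_simps power2_eq_square)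
        have "- (r\<^sup>2 - s * r + n) \<in> ring_of_integers K"
          by (intro Kcl rK th)
        then have "(r - s + th) * (th - r) \<in> PP" using deep P_mult[OF w thr] fr by simp
        then have thr2: "th - r \<in> PP" using PP_cancel[OF w wP thr] by simp
        have "A + B * th - B * (th - r) \<in> P" by (intro P_diff Dx P_mult KR AB thr)
        moreover have "A + B * r \<in> ring_of_integers K" by (intro Kcl AB rK)
        ultimately have "A + B * r \<in> PP" using deep by (simp add: algebra_simps)
        then have "A + B * r + B * (th - r) \<in> PP" by (rule PP_add[OF _ PP_mult[OF KR[OF AB(2)] thr2]])
        then show ?thesis by (simp add: algebra_simps)
      qed
      then show ?thesis using PP_cancel[OF D x] AB(3) by simp
    qed
    then show False using not_idempotent by blast
  qed
  then show ?thesis using ramification_index_eq_1[OF K] by blast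
qed

end

section \<open>Quadratic fields and the genus field\<close>

lemma Span_Nil: "ring.Span complex_ring K [] = {0}"
  using ring.Span.simps[OF ring_complex_ring, of K "[]"] by simp

lemma Span_Cons_iff:
  "x \<in> ring.Span complex_ring K (u # us) \<longleftrightarrow> (\<exists>k\<in>K. \<exists>v\<in>ring.Span complex_ring K us. x = k * u + v)"
  using ring.line_extension_mem_iff[OF ring_complex_ring, of x K u "ring.Span complex_ring K us"]
  by (simp add: ring.Span.simps[OF ring_complex_ring])

lemma quad_ext_eq_Span:
  assumes "subfield F complex_ring"
  shows "quad_ext F d = ring.Span complex_ring F [1, d]"
proof (rule Set.set_eqI)
  fix x
  have "ring.Span complex_ring F [d] = (\<lambda>v. v * d) ` F"
    by (auto simp: Span_Cons_iff Span_Nil)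
  then have "x \<in> ring.Span complex_ring F [1, d] \<longleftrightarrow> (\<exists>u\<in>F. \<exists>v\<in>F. x = u + v * d)"
    using Span_Cons_iff[of x F 1 "[d]"] by simp
  then show "x \<in> quad_ext F d \<longleftrightarrow> x \<in> ring.Span complex_ring F [1, d]" by (auto simp: quad_ext_def)
qed

text \<open>An automorphism sends \<open>d\<close> to \<open>d\<close> or \<open>- d\<close>. The
  group consists of the identity and conjugation, and the axioms reduce to a two by two composition
  table.\<close>

lemma abelian_field_quad_ext:
  assumes d: "d\<^sup>2 \<in> \<rat>" "d \<notin> \<rat>"
  shows "abelian_field (quad_ext \<rat> d)"
proof -
  define k where "k = quad_ext \<rat> d"
  have k: "subfield k complex_ring" unfolding k_def by (rule quad_ext_subfield[OF subfield_Rats d(1)])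
  note ks = subfield_complexD[OF k]
  have dk: "d \<in> k" unfolding k_def by (rule quad_ext_gen[OF subfield_Rats])
  have nf: "number_field k"
    unfolding number_field_def using k ring.Span_finite_dimension[OF ring_complex_ring subfield_Rats, of "[1, d]"]
    by (simp add: k_def quad_ext_eq_Span[OF subfield_Rats])
  obtain f where "\<forall>u\<in>\<rat>. \<forall>v\<in>\<rat>. f (u + v * d) = u - v * d"
    "\<forall>x\<in>quad_ext \<rat> d. \<forall>y\<in>quad_ext \<rat> d. f (x + y) = f x + f y"
    "\<forall>x\<in>quad_ext \<rat> d. \<forall>y\<in>quad_ext \<rat> d. f (x * y) = f x * f y"
    "\<forall>x\<in>\<rat>. f x = x" "\<forall>x\<in>quad_ext \<rat> d. f x \<in> quad_ext \<rat> d"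
    using quad_ext_conj[OF subfield_Rats d] .
  note f = this[folded k_def]
  have kE: "\<exists>u\<in>\<rat>. \<exists>v\<in>\<rat>. x = u + v * d" if "x \<in> k" for x using that by (auto simp: k_def quad_ext_def)
  have ff: "f (f x) = x" if x: "x \<in> k" for x
  proof -
    obtain u v where uv: "u \<in> \<rat>" "v \<in> \<rat>" "x = u + v * d" using kE[OF x] by blast
    then have "f x = u + (- v) * d" using f(1) by simp
    then have "f (f x) = u - (- v) * d" using f(1) uv(1,2) by (metis Rats_minus_iff)
    then show ?thesis using uv by simp
  qed
  \<comment> \<open>\<open>Bij\<close> consists of extensional maps, so both automorphisms are
    restricted to \<open>k\<close>.\<close>
  define c i where "c = restrict f k" and "i = restrict (\<lambda>x. x) k"
  let ?G = "carrier (galois_group k \<rat>)"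
  have bij: "bij_betw f k k"
    by (rule bij_betwI[where g = f]) (use f(5) ff in auto)
  have cG: "c \<in> ?G"
    using f bij ks by (auto simp: galois_group_def c_def Bij_def Ring.ring_hom_def bij_betw_restrict_eq)
  have iG: "i \<in> ?G"
    using ks by (auto simp: galois_group_def i_def Bij_def Ring.ring_hom_def bij_betw_def inj_on_def)
  have G_sub: "s = c \<or> s = i" if "s \<in> ?G" for s
  proof -
    have s: "s \<in> Bij k" "field_emb k s" "\<forall>x\<in>\<rat>. s x = x"
      using that by (auto simp: galois_group_def field_emb_iff_ring_hom)
    have "s d ^ 2 = d\<^sup>2" using field_emb_fixes(3)[OF k s(2) dk, of 2] s(3) d(1) by simp
    then have "s d = d \<or> s d = - d" by (simp add: power2_eq_iff)
    moreover have sx: "s (u + v * d) = u + v * s d" if "u \<in> \<rat>" "v \<in> \<rat>" for u v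
    proof -
      have "u \<in> k" "v \<in> k" using that ks(11) by auto
      then show ?thesis using s(2,3) that dk ks(4) by (simp add: field_emb_def)
    qed
    ultimately have "(\<forall>x\<in>k. s x = x) \<or> (\<forall>x\<in>k. s x = f x)"
    proof (elim disjE)
      assume e: "s d = d"
      have "s x = x" if x: "x \<in> k" for x using kE[OF x] sx e by auto
      then show ?thesis by blast
    next
      assume e: "s d = - d"
      have "s x = f x" if x: "x \<in> k" for x
      proof -
        obtain u v where uv: "u \<in> \<rat>" "v \<in> \<rat>" "x = u + v * d" using kE[OF x] by blast
        then show ?thesis using sx[OF uv(1,2)] f(1) e by simp
      qed
      then show ?thesis by blast
    qed
    moreover have "s x = undefined" if "x \<notin> k" for x
      using s(1) that by (simp add: Bij_def extensional_def)
    ultimately show ?thesis unfolding c_def i_def restrict_def fun_eq_iff by metis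
  qed
  have carr: "?G = {c, i}" using cG iG G_sub by auto
  have inBij: "c \<in> Bij k" "i \<in> Bij k" using cG iG by (auto simp: galois_group_def)
  have mult: "x \<otimes>\<^bsub>galois_group k \<rat>\<^esub> y = compose k x y" if "x \<in> Bij k" "y \<in> Bij k" for x y
    using that by (simp add: galois_group_def BijGroup_def)
  have tab: "compose k c c = i" "compose k c i = c" "compose k i c = c" "compose k i i = i"
    using f(5) ff by (auto simp: compose_def c_def i_def restrict_def fun_eq_iff)
  have one: "\<one>\<^bsub>galois_group k \<rat>\<^esub> = i" by (simp add: galois_group_def BijGroup_def i_def)
  note table = mult[OF inBij(1) inBij(1), unfolded tab] mult[OF inBij(1) inBij(2), unfolded tab]
    mult[OF inBij(2) inBij(1), unfolded tab] mult[OF inBij(2) inBij(2), unfolded tab]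
  have "comm_group (galois_group k \<rat>)"
    by (rule comm_groupI) (auto simp: carr one table)
  moreover have "galois_extension k \<rat>"
    unfolding galois_extension_def
  proof (intro equalityI subsetI)
    fix x assume "x \<in> {x \<in> k. \<forall>s\<in>?G. s x = x}"
    then have x: "x \<in> k" "f x = x" using cG by (auto simp: c_def)
    obtain u v where uv: "u \<in> \<rat>" "v \<in> \<rat>" "x = u + v * d" using kE[OF x(1)] by blast
    have "u - v * d = u + v * d" using f(1) uv x(2) by metis
    then have "v * d = 0" by (simp add: algebra_simps)
    then have "x = u" using uv(3) by (simp only: add_0_right)
    then show "x \<in> \<rat>" using uv(1) by simp
  next
    fix x :: complex assume "x \<in> \<rat>"
    then show "x \<in> {x \<in> k. \<forall>s\<in>?G. s x = x}" using ks(11) by (auto simp: galois_group_def)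
  qed
  ultimately show ?thesis using nf by (simp add: abelian_field_def k_def)
qed

section \<open>Unramified quadratic extensions of a pure quartic field\<close>

context pure_quartic begin

lemma qfield_span: "K \<subseteq> qvs.span {1, t, t ^ 2 / of_int c, t ^ 3 / of_int c ^ 2}" (is "_ \<subseteq> qvs.span ?B")
proof
  fix u assume "u \<in> K"
  then obtain w x y z where u: "u = qel c t w x y z" "w \<in> \<rat>" "x \<in> \<rat>" "y \<in> \<rat>" "z \<in> \<rat>"
    by (rule qfieldE)
  have *: "q * b \<in> qvs.span ?B" if "q \<in> \<rat>" "b \<in> ?B" for q b
    using that(1) qvs.span_scale[OF qvs.span_base[OF that(2)]] by (auto elim!: Rats_cases)
  have "w * 1 + x * t + y * (t ^ 2 / of_int c) + z * (t ^ 3 / of_int c ^ 2) \<in> qvs.span ?B"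
    by (intro qvs.span_add *) (use u in auto)
  then show "u \<in> qvs.span ?B" by (simp add: u(1) qel_def)
qed

text \<open>Take \<open>t\<close> when \<open>p\<close> divides \<open>b\<close>, and
  \<open>t ^ 3 / of_int c ^ 2\<close> when it divides \<open>c\<close>; squarefreeness leaves
  exactly one factor \<open>p\<close> in the fourth power.\<close>

lemma totally_ramified_root:
  assumes p: "Factorial_Ring.prime p" "p dvd b * c"
  obtains l m where "l \<in> ring_of_integers K" "l ^ 4 = of_int (p * m)" "\<not> p dvd m"
proof -
  have p2: "\<not> p\<^sup>2 dvd b * c"
    using sqfree p(1) not_prime_unit unfolding squarefree_def by blast
  have *: "\<not> p dvd e' * f ^ 3" if e: "e = p * e'" and ef: "e * f = b * c" for e e' f
  proof -
    have "p\<^sup>2 dvd e * f" if "p dvd e'"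
      using mult_dvd_mono[OF dvd_refl[of p] that] unfolding e by (simp add: power2_eq_square)
    moreover have "p\<^sup>2 dvd e * f" if "p dvd f"
      using mult_dvd_mono[OF _ that, of p e] e by (simp add: power2_eq_square)
    ultimately have "\<not> p dvd e'" "\<not> p dvd f" using p2 ef by auto
    then show ?thesis using p(1) by (auto simp: prime_dvd_mult_iff prime_dvd_power_iff)
  qed
  consider "p dvd b" | "p dvd c" using p by (auto simp: prime_dvd_mult_iff)
  then show ?thesis
  proof cases
    case 1
    then obtain e' where e: "b = p * e'" by auto
    have "t \<in> ring_of_integers K" using qel_integral[of 0 1 0 0] by (simp add: qel_basis)
    moreover have "t ^ 4 = of_int (p * (e' * c ^ 3))" using root e by (simp add: mult.assoc)
    ultimately show ?thesis using that *[OF e refl] by blast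
  next
    case 2
    then obtain e' where e: "c = p * e'" by auto
    have "t ^ 3 / of_int c ^ 2 \<in> ring_of_integers K" using qel_integral[of 0 0 0 1] by (simp add: qel_basis)
    moreover have "(t ^ 3 / of_int c ^ 2) ^ 4 = of_int (c * b ^ 3)" by (rule pure_quartic.root[OF swap])
    then have "(t ^ 3 / of_int c ^ 2) ^ 4 = of_int (p * (e' * b ^ 3))" by (simp only: e mult.assoc)
    ultimately show ?thesis using that *[OF e mult.commute] by blast
  qed
qed

text \<open>Away from \<open>p\<close> the local generator is \<open>(1 + r)/2\<close>, whose discriminant is \<open>d\<close>. Above \<open>p\<close> it is \<open>l\<^sup>2/r\<close> for a
  fourth root \<open>l\<close> of \<open>p m\<close>, whose square \<open>s m\<close> is prime to \<open>p\<close>.\<close>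

lemma ramification_index_quad_ext:
  assumes p: "Factorial_Ring.prime p" "p dvd b * c" "odd p"
    and d: "d = s * p" "s = 1 \<or> s = - 1" "d mod 4 = 1" and r: "r\<^sup>2 = of_int d"
    and P: "primeideal P (sub_ring (ring_of_integers (quad_ext K r)))" "P \<noteq> {0}"
  shows "ramification_index (quad_ext K r) K P = 1"
proof -
  define L where "L = quad_ext K r"
  note Ks = subfield_complexD[OF qfield_subfield] and Kcl = ring_of_integers_closed[OF qfield_subfield]
  have rK: "r\<^sup>2 \<in> K" unfolding r by (rule Ks(10))
  have L: "subfield L complex_ring" unfolding L_def by (rule quad_ext_subfield[OF qfield_subfield rK])
  note Ls = subfield_complexD[OF L] and Lcl = ring_of_integers_closed[OF L]
  have KL: "K \<subseteq> L" unfolding L_def by (rule quad_ext_base[OF qfield_subfield])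
  have rL: "r \<in> L" unfolding L_def by (rule quad_ext_gen[OF qfield_subfield])
  have ri: "algebraic_int r" by (rule algebraic_int_of_power[of _ 2]) (simp_all add: r)
  have d0: "d \<noteq> 0" using d(3) by auto
  have r0: "r \<noteq> 0" using r d0 by auto
  define B where "B = {1, t, t ^ 2 / of_int c, t ^ 3 / of_int c ^ 2}"
  have "L \<subseteq> qvs.span (B \<union> (\<lambda>x. x * r) ` B)"
  proof
    fix x assume "x \<in> L"
    then obtain u v where uv: "x = u + v * r" "u \<in> K" "v \<in> K" by (auto simp: L_def quad_ext_def)
    have "u \<in> qvs.span B" "v \<in> qvs.span B" using uv qfield_span by (auto simp: B_def)
    then have "u \<in> qvs.span (B \<union> (\<lambda>x. x * r) ` B)" using qvs.span_mono[of B] by blast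
    moreover have "v * r \<in> qvs.span (B \<union> (\<lambda>x. x * r) ` B)"
      using \<open>v \<in> qvs.span B\<close>
    proof (induction rule: qvs.span_induct_alt)
      case base then show ?case by (simp add: qvs.span_zero)
    next
      case (step q b v)
      have "(of_rat q * b + v) * r = of_rat q * (b * r) + v * r" by (simp add: algebra_simps)
      moreover have "b * r \<in> qvs.span (B \<union> (\<lambda>x. x * r) ` B)" using step by (intro qvs.span_base) auto
      ultimately show ?case using step qvs.span_add qvs.span_scale by metis
    qed
    ultimately show "x \<in> qvs.span (B \<union> (\<lambda>x. x * r) ` B)" unfolding uv(1) by (rule qvs.span_add)
  qed
  then have "\<exists>B. finite B \<and> L \<subseteq> qvs.span B"
    by (intro exI[of _ "B \<union> (\<lambda>x. x * r) ` B"]) (simp add: B_def)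
  then interpret np: number_field_prime L P
    using L P by (intro number_field_prime.intro) (simp_all add: L_def)
  have conj: "algebraic_int (u - v * r)" if "r \<notin> K" "u \<in> K" "v \<in> K" "algebraic_int (u + v * r)" for u v
    by (rule quad_ext_conj_algebraic_int[OF qfield_subfield rK that(1-4)])
  show ?thesis
  proof (cases "of_int p \<in> P")
    case False
    define th where "th = (1 + r) / 2"
    obtain e where e: "1 - d = 4 * e" using div_mult_mod_eq[of d 4] d(3) by (intro that[of "- (d div 4)"]) linarith
    have e': "of_int d = (1 - 4 * of_int e :: complex)"
    proof -
      have "d = 1 - 4 * e" using e by simp
      then show ?thesis by simp
    qed
    have "th\<^sup>2 - (1 * th - of_int e) = (r\<^sup>2 - (1 - 4 * of_int e)) / 4"
      by (simp add: th_def power2_eq_square field_simps)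
    then have th2: "th\<^sup>2 = 1 * th - of_int e" unfolding r e' by simp
    have "algebraic_int (th * (th - 1))"
    proof -
      have "th * (th - 1) = of_int (- e)" using th2 by (simp add: algebra_simps power2_eq_square)
      then show ?thesis by (simp only: algebraic_int_of_int)
    qed
    then have thi: "algebraic_int th"
      by (rule algebraic_int_root[where p = "[:0, -1, 1:]"])
        (auto simp: algebra_simps coeff_pCons split: nat.splits)
    have "2 \<in> L" using Ls(10)[of 2] by simp
    then have thL: "th \<in> L" unfolding th_def using Ls(2,3,8) rL by blast
    have dP: "of_int d \<notin> P"
    proof
      assume "of_int d \<in> P"
      then have "of_int s * of_int d \<in> P" by (rule np.P_mult[OF Lcl(8)])
      moreover have "s * d = p" using d by auto
      then have "of_int s * of_int d = (of_int p :: complex)" by (metis of_int_mult)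
      ultimately show False using False by simp
    qed
    have "ramification_index L K P = 1"
    proof (rule np.unramified_criterion[OF qfield_subfield KL, of "of_int d" th 1 "of_int e"])
      show "of_int d \<in> np.R" "of_int d \<notin> P" using Lcl(8) dP by auto
      show "th \<in> np.R" using thi thL by (simp add: ring_of_integers_def)
      show "1 \<in> ring_of_integers K" "of_int e \<in> ring_of_integers K" using Kcl by auto
      show "th\<^sup>2 = 1 * th - of_int e" by (rule th2)
      show "2 * th - 1 \<notin> P"
      proof
        assume "2 * th - 1 \<in> P"
        then have "r \<in> P" by (simp add: th_def)
        then have "r * r \<in> P" using np.P_mult np.P_sub by blast
        then show False using dP r by (simp add: power2_eq_square)
      qed
      fix x assume x: "x \<in> np.R"
      then obtain u v where uv: "x = u + v * r" "u \<in> K" "v \<in> K" and xi: "algebraic_int (u + v * r)"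
        by (auto simp: ring_of_integers_def L_def quad_ext_def)
      show "\<exists>A\<in>ring_of_integers K. \<exists>B\<in>ring_of_integers K. of_int d * x = A + B * th"
      \<comment> \<open>If \<open>r\<close> lies in \<open>K\<close>, there is no nontrivial
        conjugation, but \<open>x\<close> itself lies in \<open>K\<close> and the coefficient of
        \<open>th\<close> can be 0.\<close>
      proof (cases "r \<in> K")
        case True
        then have "of_int d * x \<in> ring_of_integers K"
          unfolding uv(1) ring_of_integers_def
          using Ks(4)[OF Ks(10)[of d] Ks(3)[OF uv(2) Ks(4)[OF uv(3) True]]]
            algebraic_int_mult[OF algebraic_int_of_int[of d] xi] by simp
        then show ?thesis using Kcl(1) by (intro bexI[of _ "of_int d * x"] bexI[of _ 0]) auto
      next
        case rn: False
        \<comment> \<open>Forced by comparing coefficients of \<open>r\<close>. It equals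
          \<open>r\<close> times the difference of \<open>x\<close> and its conjugate, hence is
          integral, and the remaining part \<open>of_int d * (u - v)\<close> is then integral as
          well.\<close>
        define B' where "B' = 2 * v * of_int d"
        have "((u + v * r) - (u - v * r)) * r = 2 * v * r\<^sup>2" by (simp add: power2_eq_square algebra_simps)
        then have "B' = ((u + v * r) - (u - v * r)) * r" by (simp only: B'_def r)
        moreover have "algebraic_int (((u + v * r) - (u - v * r)) * r)"
          by (rule algebraic_int_mult[OF algebraic_int_diff[OF xi conj[OF rn uv(2,3) xi]] ri])
        ultimately have B'i: "algebraic_int B'" by simp
        have "(2::complex) \<in> K" using Ks(10)[of 2] by simp
        then have "B' \<in> K" unfolding B'_def by (intro Ks(4) uv Ks(10))
        then have B': "B' \<in> ring_of_integers K" using B'i by (simp add: ring_of_integers_def)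
        have "of_int d * x - B' * th = of_int d * (u - v)"
          unfolding uv(1) B'_def th_def by (simp add: algebra_simps)
        moreover have "algebraic_int (of_int d * x - B' * th)"
          unfolding uv(1) by (intro algebraic_int_diff algebraic_int_mult algebraic_int_of_int xi B'i thi)
        moreover have "of_int d * (u - v) \<in> K" by (intro Ks(4,7) Ks(10) uv)
        ultimately have "of_int d * x - B' * th \<in> ring_of_integers K"
          by (simp add: ring_of_integers_def)
        then show ?thesis using B' by (intro bexI[of _ "of_int d * x - B' * th"] bexI[of _ B']) auto
      qed
    qed
    then show ?thesis by (simp add: L_def)
  next
    case pP: True
    obtain l m where l: "l \<in> ring_of_integers K" "l ^ 4 = of_int (p * m)" "\<not> p dvd m"
      using totally_ramified_root[OF p(1,2)] .
    have lK: "l \<in> K" and li: "algebraic_int l" using l by (auto simp: ring_of_integers_def)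
    have p0: "(of_int p :: complex) \<noteq> 0" using p(1) by auto
    have ss: "s * s = 1" using d(2) by auto
    then have ss': "of_int s * of_int s = (1 :: complex)" by (metis of_int_1 of_int_mult)
    define th where "th = l\<^sup>2 / r"
    have rs: "r\<^sup>2 = of_int s * of_int p" using r d(1) by simp
    have "th\<^sup>2 = l ^ 4 / r\<^sup>2" by (simp add: th_def power_divide flip: power_mult)
    also have "\<dots> = of_int s * of_int m"
      unfolding l(2) rs using p0 ss' d(2) by (auto simp: field_simps)
    finally have th2: "th\<^sup>2 = of_int (s * m)" by simp
    have thi: "algebraic_int th" by (rule algebraic_int_of_power[of _ 2]) (simp_all only: th2 algebraic_int_of_int zero_less_numeral)
    have thL: "th \<in> L" unfolding th_def using Ls(8,9) rL lK KL by blast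
    have smP: "of_int (s * m) \<notin> P"
      using np.int_in_prime_iff[OF p(1) pP, of "s * m"] l(3) d(2) by auto
    have "ramification_index L K P = 1"
    proof (rule np.unramified_criterion[OF qfield_subfield KL, of "of_int (2 * m)" th 0 "of_int (- (s * m))"])
      show "of_int (2 * m) \<in> np.R" by (rule Lcl(8))
      have "\<not> p dvd 2 * m"
      proof
        assume "p dvd 2 * m"
        then have "p dvd 2" using p(1) l(3) by (simp add: prime_dvd_mult_iff)
        then have "p = 2" using p(1) primes_dvd_imp_eq[of p 2] by simp
        then show False using p(3) by simp
      qed
      then show "of_int (2 * m) \<notin> P" using np.int_in_prime_iff[OF p(1) pP] by blast
      show "th \<in> np.R" using thi thL by (simp add: ring_of_integers_def)
      show "0 \<in> ring_of_integers K" "of_int (- (s * m)) \<in> ring_of_integers K" by (rule Kcl(1), rule Kcl(8))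
      show "th\<^sup>2 = 0 * th - of_int (- (s * m))" using th2 by simp
      show "2 * th - 0 \<notin> P"
      proof
        assume "2 * th - 0 \<in> P"
        then have "2 * th * th \<in> P" using np.P_mult[of th "2 * th"] thi thL by (simp add: ring_of_integers_def mult_ac)
        then have "of_int (2 * (s * m)) \<in> P" using th2 by (simp add: power2_eq_square mult.assoc)
        then have "p dvd 2 * (s * m)" using np.int_in_prime_iff[OF p(1) pP] by blast
        then have "p dvd 2 * m" using d(2) by auto
        then show False using \<open>\<not> p dvd 2 * m\<close> by simp
      qed
      fix x assume x: "x \<in> np.R"
      then obtain u v where uv: "x = u + v * r" "u \<in> K" "v \<in> K" and xi: "algebraic_int (u + v * r)"
        by (auto simp: ring_of_integers_def L_def quad_ext_def)
      show "\<exists>A\<in>ring_of_integers K. \<exists>B\<in>ring_of_integers K. of_int (2 * m) * x = A + B * th"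
      proof (cases "r \<in> K")
        case True
        then have "of_int (2 * m) * x \<in> ring_of_integers K"
          unfolding uv(1) ring_of_integers_def
          using Ks(4)[OF Ks(10)[of "2 * m"] Ks(3)[OF uv(2) Ks(4)[OF uv(3) True]]]
            algebraic_int_mult[OF algebraic_int_of_int[of "2 * m"] xi] by simp
        then show ?thesis using Kcl(1) by (intro bexI[of _ "of_int (2 * m) * x"] bexI[of _ 0]) auto
      next
        case rn: False
        have ci: "algebraic_int (u - v * r)" by (rule conj[OF rn uv(2,3) xi])
        \<comment> \<open>Twice \<open>x\<close> is the sum of its trace and its difference from the
          conjugate. The trace gives \<open>A'\<close>; multiplying the difference by
          \<open>m\<close>, which is \<open>s\<close> times the square of \<open>th\<close>, gives
          \<open>B' * th\<close>.\<close>
        define A' where "A' = of_int m * ((u + v * r) + (u - v * r))"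
        define B' where "B' = of_int s * ((u + v * r) - (u - v * r)) * th"
        have "A' = of_int (2 * m) * u" by (simp add: A'_def algebra_simps)
        then have "A' \<in> K" by (simp only: Ks(4)[OF Ks(10) uv(2)])
        moreover have "algebraic_int A'" unfolding A'_def by (intro algebraic_int_intros algebraic_int_of_int xi ci)
        ultimately have A': "A' \<in> ring_of_integers K" by (simp add: ring_of_integers_def)
        have "B' = of_int (2 * s) * v * l\<^sup>2" using r0 by (simp add: B'_def th_def)
        then have "B' \<in> K" by (simp only: Ks(4)[OF Ks(4)[OF Ks(10) uv(3)] Ks(9)[OF lK]])
        moreover have "algebraic_int B'" unfolding B'_def by (intro algebraic_int_intros algebraic_int_of_int xi ci thi)
        ultimately have B': "B' \<in> ring_of_integers K" by (simp add: ring_of_integers_def)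
        have "B' * th = of_int s * (2 * v * r) * th\<^sup>2" by (simp add: B'_def power2_eq_square)
        also have "\<dots> = (of_int s * of_int s) * of_int m * (2 * v * r)" by (simp add: th2)
        finally have "of_int (2 * m) * x = A' + B' * th" by (simp add: ss' A'_def uv(1) algebra_simps)
        then show ?thesis using A' B' by blast
      qed
    qed
    then show ?thesis by (simp add: L_def)
  qed
qed

lemma quad_ext_genus_extension:
  assumes p: "Factorial_Ring.prime p" "p dvd b * c" "odd p"
    and d: "d = s * p" "s = 1 \<or> s = - 1" "d mod 4 = 1" and r: "r\<^sup>2 = of_int d"
  shows "quad_ext K r \<in> genus_extensions K"
proof -
  \<comment> \<open>A rational integral \<open>r\<close> would be an integer with square
    \<open>d\<close>, but \<open>p\<close> divides \<open>d\<close> only once.\<close>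
  have "r \<notin> \<rat>"
  proof
    assume "r \<in> \<rat>"
    moreover have "algebraic_int r" by (rule algebraic_int_of_power[of _ 2]) (simp_all add: r)
    ultimately obtain k where "r = of_int k" using rational_algebraic_int_is_int by (metis Ints_cases)
    then have "of_int (k\<^sup>2) = (of_int d :: complex)" using r by simp
    then have "k\<^sup>2 = d" by (simp only: of_int_eq_iff)
    then have "p dvd k\<^sup>2" using d by auto
    then have "p\<^sup>2 dvd k\<^sup>2" using p(1) by (simp add: prime_dvd_power_iff)
    then have "p * p dvd s * p" using \<open>k\<^sup>2 = d\<close> d(1) by (simp add: power2_eq_square)
    then have "p dvd s" using p(1) by (simp add: dvd_mult_cancel_right)
    then show False using d(2) p(1) not_prime_unit by auto
  qed
  then have ab: "abelian_field (quad_ext \<rat> r)" by (intro abelian_field_quad_ext) (simp_all add: r)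
  have rK: "r\<^sup>2 \<in> K" unfolding r by (rule subfield_complexD(10)[OF qfield_subfield])
  have comp: "compositum K (quad_ext \<rat> r) = quad_ext K r"
    unfolding compositum_def
  proof (rule generate_field_complex_eqI[OF quad_ext_subfield[OF qfield_subfield rK]])
    have "\<rat> \<subseteq> K" by (rule subfield_complexD(11)[OF qfield_subfield])
    then show "K \<union> quad_ext \<rat> r \<subseteq> quad_ext K r"
      using quad_ext_base[OF qfield_subfield] by (auto simp: quad_ext_def)
    fix F assume F: "subfield F complex_ring" "K \<union> quad_ext \<rat> r \<subseteq> F"
    then show "quad_ext K r \<subseteq> F" using quad_ext_least[OF F(1)] quad_ext_gen[OF subfield_Rats] by blast
  qed
  have un: "unramified (quad_ext K r) K"
    unfolding unramified_def using ramification_index_quad_ext[OF assms] by blast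
  show ?thesis unfolding genus_extensions_def mem_Collect_eq
    by (rule exI[of _ "quad_ext \<rat> r"]) (simp add: comp ab un)
qed

end

section \<open>Multiplicative independence of square roots of primes\<close>

lemma sqrt_notin_products:
  fixes s :: "int \<Rightarrow> int"
  assumes p: "Factorial_Ring.prime p" "p \<notin> T" and T: "finite T" "\<And>l. l \<in> T \<Longrightarrow> Factorial_Ring.prime l"
    and s: "\<And>l. l \<in> insert p T \<Longrightarrow> s l = 1 \<or> s l = - 1"
    and r: "\<And>l. l \<in> insert p T \<Longrightarrow> (r l)\<^sup>2 = of_int (s l * l)" and q: "q \<in> \<rat>"
  shows "r p \<noteq> (q * prod r T :: complex)"
proof
  assume eq: "r p = q * prod r T"
  define M where "M = (\<Prod>l\<in>T. s l * l)"
  obtain m n where mn: "n > 0" "Rings.coprime m n" "q = of_int m / of_int n" using q by (auto elim: Rats_cases')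
  have "(\<Prod>l\<in>T. (r l)\<^sup>2) = (\<Prod>l\<in>T. of_int (s l * l))" using r by (intro prod.cong) auto
  then have "(prod r T)\<^sup>2 = of_int M" by (simp only: M_def prod_power_distrib of_int_prod)
  then have "of_int (s p * p) = q\<^sup>2 * of_int M"
    using r[of p] eq by (simp add: power_mult_distrib)
  then have "of_int (s p * p) * (of_int n)\<^sup>2 = ((of_int m)\<^sup>2 * of_int M :: complex)"
    using mn(1,3) by (simp add: power_divide divide_simps)
  then have "(of_int (s p * p * n\<^sup>2) :: complex) = of_int (m\<^sup>2 * M)" by simp
  then have e: "s p * p * n\<^sup>2 = m\<^sup>2 * M" by (simp only: of_int_eq_iff)
  \<comment> \<open>Once this is known, \<open>e\<close> is contradictory: \<open>p\<close> divides
    its left side to an odd power and its right side to an even one.\<close>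
  have "\<not> p dvd M"
  proof
    assume "p dvd M"
    then obtain l where l: "l \<in> T" "p dvd s l * l"
      unfolding M_def prime_dvd_prod_iff[OF T(1) p(1)] by blast
    then have "p dvd l" using s[of l] by auto
    then have "p = l" using p(1) T(2)[OF l(1)] primes_dvd_imp_eq by blast
    then show False using l(1) p(2) by simp
  qed
  moreover have "p dvd m\<^sup>2 * M" unfolding e[symmetric] by simp
  ultimately have pm: "p dvd m" using p(1) by (auto simp: prime_dvd_mult_iff prime_dvd_power_iff)
  then obtain m' where m': "m = p * m'" by auto
  have "p * (s p * n\<^sup>2) = p * (p * (m'\<^sup>2 * M))" using e unfolding m' by (simp add: power2_eq_square mult_ac)
  then have "s p * n\<^sup>2 = p * (m'\<^sup>2 * M)" using p(1) by auto
  then have "p dvd s p * n\<^sup>2" by simp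
  then have "p dvd n\<^sup>2" using s[of p] by auto
  then have "p dvd n" using p(1) by (simp add: prime_dvd_power_iff)
  then show False using pm mn(2) p(1) by (meson coprime_common_divisor not_prime_unit)
qed

text \<open>The description of elements with rational square is what the induction carries: with
  \<open>sqrt_notin_products\<close> it shows that the next square root is new, and then
  independence doubles in the quadratic step.\<close>

lemma sqrt_products:
  fixes s :: "int \<Rightarrow> int" and r :: "int \<Rightarrow> complex"
  assumes "finite S" "\<And>p. p \<in> S \<Longrightarrow> Factorial_Ring.prime p" "\<And>p. p \<in> S \<Longrightarrow> s p = 1 \<or> s p = - 1"
    "\<And>p. p \<in> S \<Longrightarrow> (r p)\<^sup>2 = of_int (s p * p)"
  shows "\<exists>E. subfield E complex_ring \<and> r ` S \<subseteq> E \<and>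
    (\<forall>x\<in>E. x\<^sup>2 \<in> \<rat> \<longrightarrow> (\<exists>q\<in>\<rat>. \<exists>T\<subseteq>S. x = q * prod r T)) \<and>
    (\<forall>k :: int set \<Rightarrow> rat. (\<Sum>T\<in>Pow S. of_rat (k T) * prod r T) = 0 \<longrightarrow> (\<forall>T\<in>Pow S. k T = 0))"
  using assms
proof (induction S rule: finite_induct)
  case empty
  show ?case using subfield_Rats by (intro exI[of _ \<rat>]) auto
next
  case (insert p S)
  obtain E where E: "subfield E complex_ring" and rE: "r ` S \<subseteq> E"
    and sq: "\<And>x. x \<in> E \<Longrightarrow> x\<^sup>2 \<in> \<rat> \<Longrightarrow> \<exists>q\<in>\<rat>. \<exists>T\<subseteq>S. x = q * prod r T"
    and ind: "\<And>k T. (\<Sum>T\<in>Pow S. of_rat (k T) * prod r T) = 0 \<Longrightarrow> T \<subseteq> S \<Longrightarrow> k T = (0::rat)"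
    using insert.IH insert.prems by auto
  note Es = subfield_complexD[OF E]
  have rp: "(r p)\<^sup>2 = of_int (s p * p)" using insert.prems(3)[of p] by blast
  have rp0: "r p \<noteq> 0" using rp insert.prems(1,2)[of p] by auto
  have rpn: "r p \<notin> E"
  proof
    assume "r p \<in> E"
    moreover have "(r p)\<^sup>2 \<in> \<rat>" unfolding rp by simp
    ultimately obtain q T where qT: "q \<in> \<rat>" "T \<subseteq> S" "r p = q * prod r T" using sq by blast
    have "r p \<noteq> q * prod r T"
      by (rule sqrt_notin_products[of p T s r q])
        (use insert.prems insert.hyps qT finite_subset[OF qT(2)] in auto)
    then show False using qT(3) by simp
  qed
  have rpE: "(r p)\<^sup>2 \<in> E" unfolding rp by (rule Es(10))
  define E' where "E' = quad_ext E (r p)"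
  have E': "subfield E' complex_ring" unfolding E'_def by (rule quad_ext_subfield[OF E rpE])
  show ?case
  proof (rule exI[of _ E'], intro conjI ballI allI impI)
    show "subfield E' complex_ring" by (rule E')
    show "r ` insert p S \<subseteq> E'" using rE quad_ext_base[OF E] quad_ext_gen[OF E] by (auto simp: E'_def)
  next
    fix x assume "x \<in> E'" and x2: "x\<^sup>2 \<in> \<rat>"
    then obtain u v where uv: "x = u + v * r p" "u \<in> E" "v \<in> E" by (auto simp: E'_def quad_ext_def)
    \<comment> \<open>A rational square has no component along the new root, so \<open>u\<close> or
      \<open>v\<close> vanishes and \<open>x\<close> is an element of \<open>E\<close> or such an
      element times \<open>r p\<close>.\<close>
    have "(u\<^sup>2 + v\<^sup>2 * (r p)\<^sup>2) + (2 * u * v) * r p = x\<^sup>2 + 0 * r p"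
      by (simp add: uv(1) power2_eq_square algebra_simps)
    moreover have "u\<^sup>2 + v\<^sup>2 * (r p)\<^sup>2 \<in> E" by (intro Es(3,4,9) uv rpE)
    moreover have "(2::complex) \<in> E" using Es(10)[of 2] by simp
    then have "2 * u * v \<in> E" by (intro Es(4) uv)
    moreover have "x\<^sup>2 \<in> E" using x2 Es(11) by blast
    ultimately have "2 * u * v = 0" using quad_ext_unique[OF E rpn _ _ _ Es(1)] by blast
    then consider "v = 0" | "u = 0" by auto
    then show "\<exists>q\<in>\<rat>. \<exists>T\<subseteq>insert p S. x = q * prod r T"
    proof cases
      case 1
      then have "x = u" using uv(1) by simp
      then show ?thesis using sq[of x] x2 uv(2) by blast
    next
      case 2
      then have x: "x = v * r p" using uv(1) by simp
      have "v\<^sup>2 = x\<^sup>2 / (r p)\<^sup>2" using rp0 by (simp add: x power_mult_distrib)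
      then have "v\<^sup>2 \<in> \<rat>" unfolding rp using x2 by simp
      then obtain q T where qT: "q \<in> \<rat>" "T \<subseteq> S" "v = q * prod r T" using sq uv(3) by blast
      have "p \<notin> T" "finite T" using qT(2) insert.hyps finite_subset by auto
      then have "x = q * prod r (insert p T)" by (simp add: x qT(3))
      then show ?thesis using qT by blast
    qed
  next
    fix k :: "int set \<Rightarrow> rat" and T
    assume 0: "(\<Sum>T\<in>Pow (insert p S). of_rat (k T) * prod r T) = 0" and T: "T \<in> Pow (insert p S)"
    define A where "A = (\<Sum>T\<in>Pow S. of_rat (k T) * prod r T)"
    define B where "B = (\<Sum>T\<in>Pow S. of_rat (k (insert p T)) * prod r T)"
    have inE: "(\<Sum>T\<in>Pow S. of_rat (h T) * prod r T) \<in> E" for h :: "int set \<Rightarrow> rat"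
    proof -
      interpret EL: int_lattice E using Es by unfold_locales auto
      have "prod r T \<in> E" if "T \<in> Pow S" for T
      proof -
        have "finite T" "T \<subseteq> S" using that insert.hyps finite_subset by auto
        then show ?thesis by (induction T rule: finite_induct) (use Es(2,4) rE in auto)
      qed
      moreover have "of_rat q \<in> E" for q using Es(11) by auto
      ultimately show ?thesis by (intro EL.sum Es(4))
    qed
    have fin: "finite (Pow S)" using insert.hyps by simp
    have "(\<Sum>T\<in>insert p ` Pow S. of_rat (k T) * prod r T) = (\<Sum>T\<in>Pow S. of_rat (k (insert p T)) * prod r (insert p T))"
      by (rule sum.reindex_cong[of "insert p"]) (use insert.hyps in \<open>auto simp: inj_on_def\<close>)
    also have "\<dots> = (\<Sum>T\<in>Pow S. of_rat (k (insert p T)) * prod r T * r p)"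
    proof (rule sum.cong)
      fix T assume "T \<in> Pow S"
      then have "finite T" "p \<notin> T" using insert.hyps finite_subset by auto
      then show "of_rat (k (insert p T)) * prod r (insert p T) = of_rat (k (insert p T)) * prod r T * r p"
        by (simp add: mult_ac)
    qed simp
    also have "\<dots> = B * r p" by (simp add: B_def sum_distrib_right)
    finally have B: "(\<Sum>T\<in>insert p ` Pow S. of_rat (k T) * prod r T) = B * r p" .
    have "(\<Sum>T\<in>Pow (insert p S). of_rat (k T) * prod r T) = A + B * r p"
      unfolding Pow_insert A_def B[symmetric]
      by (rule sum.union_disjoint) (use fin insert.hyps in auto)
    then have "A + B * r p = 0 + 0 * r p" using 0 by simp
    moreover have "A \<in> E" unfolding A_def by (rule inE)
    moreover have "B \<in> E" unfolding B_def by (rule inE[of "\<lambda>T. k (insert p T)"])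
    ultimately have AB: "A = 0 \<and> B = 0"
      using quad_ext_unique[OF E rpn _ _ Es(1) Es(1), of A B] by simp
    show "k T = 0"
    proof (cases "p \<in> T")
      case True
      then have "T - {p} \<subseteq> S" "insert p (T - {p}) = T" using T by auto
      then show ?thesis using ind[of "\<lambda>T. k (insert p T)" "T - {p}"] AB by (simp add: B_def)
    next
      case False
      then have "T \<subseteq> S" using T by auto
      then show ?thesis using ind[of k T] AB by (simp add: A_def)
    qed
  qed
qed

text \<open>A lower bound for the degree of \<open>F\<close> over the rationals, phrased through a
  spanning set so that it combines directly with \<open>ext_degree_span\<close>.\<close>

lemma card_le_if_sqrts_in_span:
  fixes s :: "int \<Rightarrow> int" and r :: "int \<Rightarrow> complex"
  assumes S: "finite S" "\<And>p. p \<in> S \<Longrightarrow> Factorial_Ring.prime p" "\<And>p. p \<in> S \<Longrightarrow> s p = 1 \<or> s p = - 1"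
    "\<And>p. p \<in> S \<Longrightarrow> (r p)\<^sup>2 = of_int (s p * p)"
    and F: "subfield F complex_ring" "r ` S \<subseteq> F" and B: "finite B" "F \<subseteq> qvs.span B"
  shows "2 ^ card S \<le> card B"
proof -
  have ind: "k T = 0" if "(\<Sum>T\<in>Pow S. of_rat (k T) * prod r T) = 0" "T \<subseteq> S" for k :: "int set \<Rightarrow> rat" and T
    using sqrt_products[OF S] that by blast
  have fin: "finite (Pow S)" using S(1) by simp
  have inj: "inj_on (prod r) (Pow S)"
  proof (rule inj_onI, rule ccontr)
    fix T U assume TU: "T \<in> Pow S" "U \<in> Pow S" "prod r T = prod r U" "T \<noteq> U"
    define k where "k V = (if V = T then 1 else if V = U then - 1 else 0 :: rat)" for V
    have "(\<Sum>V\<in>Pow S. of_rat (k V) * prod r V) = (\<Sum>V\<in>{T, U}. of_rat (k V) * prod r V)"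
      by (rule sum.mono_neutral_right) (use TU fin in \<open>auto simp: k_def\<close>)
    also have "\<dots> = 0" using TU by (simp add: k_def)
    finally have "k T = 0" using ind TU(1) by blast
    then show False by (simp add: k_def)
  qed
  have "qvs.independent (prod r ` Pow S)"
  proof
    assume "qvs.dependent (prod r ` Pow S)"
    then obtain u where u: "\<exists>v\<in>prod r ` Pow S. u v \<noteq> 0" "(\<Sum>v\<in>prod r ` Pow S. of_rat (u v) * v) = 0"
      using qvs.dependent_finite[of "prod r ` Pow S"] fin by auto
    have "(\<Sum>T\<in>Pow S. of_rat (u (prod r T)) * prod r T) = 0" using u(2) by (simp add: sum.reindex[OF inj])
    then have "u (prod r T) = 0" if "T \<subseteq> S" for T using ind[of "\<lambda>T. u (prod r T)"] that by blast
    then show False using u(1) by auto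
  qed
  moreover have "prod r ` Pow S \<subseteq> qvs.span B"
  proof -
    have "prod r T \<in> F" if T: "T \<subseteq> S" for T
    proof -
      have "finite T" using T S(1) finite_subset by blast
      then show ?thesis using T
        by (induction T rule: finite_induct) (use F(2) subfield_complexD(2,4)[OF F(1)] in auto)
    qed
    then show ?thesis using B(2) by auto
  qed
  ultimately have "card (prod r ` Pow S) \<le> card B" using qvs.independent_span_bound[OF B(1)] by blast
  then show ?thesis using card_image[OF inj] card_Pow[OF S(1)] by simp
qed

lemma Span_subset_span:
  assumes "\<And>u k. u \<in> set us \<Longrightarrow> k \<in> K \<Longrightarrow> k * u \<in> qvs.span B"
  shows "ring.Span complex_ring K us \<subseteq> qvs.span B"
  using assms
proof (induction us)
  case Nil
  show ?case by (simp only: Span_Nil) (simp add: qvs.span_zero)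
next
  case (Cons u us)
  have "ring.Span complex_ring K us \<subseteq> qvs.span B" using Cons by auto
  then show ?case using Cons.prems by (auto simp: Span_Cons_iff intro!: qvs.span_add)
qed

section \<open>The genus number and the odd primes of b c\<close>

context pure_quartic begin

text \<open>The upper half of the tower law: products of the four basis elements of \<open>K\<close>
  with a basis of \<open>F\<close> over \<open>K\<close> span \<open>F\<close> over the rationals. A
  nonzero \<open>ext_degree\<close> excludes its default value for infinite extensions.\<close>

lemma ext_degree_span:
  assumes "ext_degree F K \<noteq> 0"
  obtains B where "finite B" "F \<subseteq> qvs.span B" "card B \<le> 4 * ext_degree F K"
proof -
  interpret cr: ring complex_ring by (rule ring_complex_ring)
  have fd: "cr.finite_dimension K F" and ed: "ext_degree F K = cr.dim K F"
    using assms by (auto simp: ext_degree_def split: if_splits)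
  have "cr.dimension (cr.dim K F) K F"
    using cr.finite_dimensionE[OF qfield_subfield fd] by (simp add: over_def)
  then obtain us where us: "length us = cr.dim K F" "cr.Span K us = F"
    using cr.exists_base[OF qfield_subfield] by blast
  define C where "C = {1, t, t ^ 2 / of_int c, t ^ 3 / of_int c ^ 2}"
  define B where "B = (\<lambda>(k, u). k * u) ` (C \<times> set us)"
  have "card C \<le> 4" unfolding C_def by (intro order.trans[OF card_insert_le_m1]) auto
  moreover have "card B \<le> card (C \<times> set us)" unfolding B_def by (rule card_image_le) (simp add: C_def)
  moreover have "card (set us) \<le> ext_degree F K" using card_length[of us] us(1) ed by simp
  ultimately have "card B \<le> 4 * ext_degree F K"
    unfolding card_cartesian_product by (meson mult_le_mono order.trans)
  moreover have "F \<subseteq> qvs.span B"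
    unfolding us(2)[symmetric]
  proof (rule Span_subset_span)
    fix u k assume u: "u \<in> set us" and "k \<in> K"
    then have "k \<in> qvs.span C" using qfield_span by (auto simp: C_def)
    then show "k * u \<in> qvs.span B"
    proof (induction rule: qvs.span_induct_alt)
      case base then show ?case by (simp add: qvs.span_zero)
    next
      case (step q x k)
      have "(of_rat q * x + k) * u = of_rat q * (x * u) + k * u" by (simp add: algebra_simps)
      moreover have "x * u \<in> qvs.span B" using step(1) u by (intro qvs.span_base) (auto simp: B_def)
      ultimately show ?case using step(2) qvs.span_add qvs.span_scale by metis
    qed
  qed
  moreover have "finite B" by (simp add: B_def C_def)
  ultimately show ?thesis using that by blast
qed

text \<open>The genus field contains the square roots of \<open>\<plusminus>p \<equiv> 1 (mod 4)\<close> for all odd \<open>p\<close> dividing \<open>b c\<close>, and the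
  products of these are linearly independent over \<open>\<rat>\<close>.\<close>

lemma genus_number_bound:
  assumes g: "genus_number K = 2 ^ a"
  shows "card {p. Factorial_Ring.prime p \<and> odd p \<and> p dvd b * c} \<le> a + 2"
proof -
  define S where "S = {p. Factorial_Ring.prime p \<and> odd p \<and> p dvd b * c}"
  have "S \<subseteq> prime_factors (b * c)" using bc_nz by (auto simp: S_def prime_factors_dvd)
  then have S: "finite S" using finite_subset by blast
  \<comment> \<open>The value \<open>2 ^ a\<close> differs from the default 0 of
    \<open>genus_number\<close>, so a genus field exists; as the greatest member of
    \<open>genus_extensions\<close> it is unique.\<close>
  have ex: "\<exists>F. is_genus_field K F" using g by (auto simp: genus_number_def split: if_splits)
  then obtain F where F: "is_genus_field K F" by blast
  have uniq: "F' = F" if "is_genus_field K F'" for F'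
  proof (rule equalityI)
    show "F' \<subseteq> F" "F \<subseteq> F'" using that F unfolding is_genus_field_def by blast+
  qed
  have "(THE F. is_genus_field K F) = F" by (rule the_equality, rule F, rule uniq)
  then have deg: "ext_degree F K = 2 ^ a" using g ex by (simp add: genus_number_def)
  obtain B where B: "finite B" "F \<subseteq> qvs.span B" "card B \<le> 4 * ext_degree F K"
    by (rule ext_degree_span[of F]) (simp add: deg)
  obtain k where "F = compositum K k" using F by (auto simp: is_genus_field_def genus_extensions_def)
  then have Fs: "subfield F complex_ring" unfolding compositum_def by (simp only: generate_field_complex(1))
  define s :: "int \<Rightarrow> int" where "s p = (if p mod 4 = 1 then 1 else - 1)" for p
  define r where "r p = csqrt (of_int (s p * p))" for p
  have "r p \<in> F" if p: "p \<in> S" for p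
  proof -
    have "odd p" using p by (simp add: S_def)
    then have "s p * p mod 4 = 1" unfolding s_def by presburger
    then have "quad_ext K (r p) \<in> genus_extensions K"
      by (intro quad_ext_genus_extension[of p "s p * p" "s p" "r p"]) (use p in \<open>auto simp: S_def s_def r_def\<close>)
    then have "quad_ext K (r p) \<subseteq> F" using F by (auto simp: is_genus_field_def)
    then show ?thesis using quad_ext_gen[OF qfield_subfield] by blast
  qed
  then have "2 ^ card S \<le> card B"
    by (intro card_le_if_sqrts_in_span[OF S _ _ _ Fs _ B(1,2), of s r]) (auto simp: S_def s_def r_def)
  also have "\<dots> \<le> 2 ^ (a + 2)" using B(3) deg by (simp add: power_add)
  finally have "card S \<le> a + 2" by (rule power_le_imp_le_exp[rotated]) simp
  then show ?thesis by (simp add: S_def)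
qed

end

section \<open>The family of pure quartic fields\<close>

text \<open>Primes with exponent 1 modulo 4 go into \<open>b\<close>, those with exponent 3 into
  \<open>c\<close>, and the quotients of the exponents by 4 into \<open>d\<close>. The sign of
  \<open>a\<close> goes into \<open>b\<close>, so that \<open>c\<close> is positive.\<close>

lemma odd_exponents_normal_form:
  fixes a :: int
  assumes a: "a \<noteq> 0" "\<not> is_unit a" and odd: "\<And>p. Factorial_Ring.prime p \<Longrightarrow> p dvd a \<Longrightarrow> odd (multiplicity p a)"
  obtains b c d where "a = b * c ^ 3 * d ^ 4" "squarefree (b * c)" "\<not> is_unit (b * c)" "c > 0" "d \<noteq> 0"
proof -
  define S where "S = prime_factors a"
  define m where "m p = multiplicity p a" for p
  have pS: "Factorial_Ring.prime p" "odd (m p)" if "p \<in> S" for p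
    using that odd by (auto simp: S_def m_def prime_factors_dvd)
  define f g where "f p = (if m p mod 4 = 1 then p else 1)" and "g p = (if m p mod 4 = 1 then 1 else p)" for p
  define B C D where "B = prod f S" and "C = prod g S" and "D = (\<Prod>p\<in>S. p ^ (m p div 4))"
  have "p ^ m p = f p * g p ^ 3 * (p ^ (m p div 4)) ^ 4" if "p \<in> S" for p
  proof -
    have "m p mod 4 = 1 \<or> m p mod 4 = 3" using pS(2)[OF that] by presburger
    then have "f p * g p ^ 3 = p ^ (m p mod 4)" by (auto simp: f_def g_def)
    moreover have "p ^ m p = p ^ (m p mod 4) * (p ^ (m p div 4)) ^ 4"
      by (simp only: power_mult[symmetric] power_add[symmetric] mod_div_mult_eq)
    ultimately show ?thesis by simp
  qed
  then have "\<bar>a\<bar> = (\<Prod>p\<in>S. f p * g p ^ 3 * (p ^ (m p div 4)) ^ 4)"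
    using prod_prime_factors[OF a(1)] by (simp add: S_def m_def)
  also have "\<dots> = B * C ^ 3 * D ^ 4"
    by (simp add: B_def C_def D_def prod.distrib prod_power_distrib)
  finally have abs: "\<bar>a\<bar> = B * C ^ 3 * D ^ 4" .
  have "B * C = (\<Prod>p\<in>S. f p * g p)" by (simp add: B_def C_def prod.distrib)
  also have "\<dots> = \<Prod>S" by (rule prod.cong) (auto simp: f_def g_def)
  finally have BC: "B * C = \<Prod>S" .
  have sq: "squarefree (\<Prod>S)"
    by (rule squarefree_prod_coprime) (use pS in \<open>auto intro: primes_coprime squarefree_prime\<close>)
  have "\<exists>p\<in>S. p dvd \<Prod>S"
  proof -
    obtain p where "Factorial_Ring.prime p" "p dvd a" using prime_divisor_exists[OF a] by blast
    then have "p \<in> S" using a(1) by (simp add: S_def prime_factors_dvd)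
    then show ?thesis by (intro bexI[of _ p] dvd_prodI) (auto simp: S_def)
  qed
  then have nu: "\<not> is_unit (\<Prod>S)" using pS(1) not_prime_unit dvd_trans by blast
  have Cpos: "C > 0" unfolding C_def g_def using pS(1) by (intro prod_pos) (auto simp: prime_gt_0_int)
  have D0: "D \<noteq> 0" using abs a(1) by auto
  have s: "sgn a = 1 \<or> sgn a = - 1" using a(1) by (auto simp: sgn_if)
  have "a = sgn a * \<bar>a\<bar>" by (simp add: sgn_mult_abs)
  then have "a = (sgn a * B) * C ^ 3 * D ^ 4" using abs by (metis mult.assoc)
  moreover have "squarefree ((sgn a * B) * C)" "\<not> is_unit ((sgn a * B) * C)"
    using s sq nu BC by (auto simp: mult.assoc)
  ultimately show ?thesis using Cpos D0 that by blast
qed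

lemma admissible_normal_form:
  assumes "admissible a"
  obtains b c d where "a = b * c ^ 3 * d ^ 4" "squarefree (b * c)" "\<not> is_unit (b * c)" "c > 0" "d \<noteq> 0"
proof (rule odd_exponents_normal_form[of a])
  show "a \<noteq> 0" "\<not> is_unit a" using assms by (auto simp: admissible_def)
  fix p assume "Factorial_Ring.prime p" "p dvd a"
  then have "gcd (multiplicity p a) 4 = 1" using assms by (auto simp: admissible_def)
  then have g: "\<not> 2 dvd gcd (multiplicity p a) 4" by simp
  show "odd (multiplicity p a)"
  proof
    assume "even (multiplicity p a)"
    then have "2 dvd gcd (multiplicity p a) 4" by (intro gcd_greatest) auto
    then show False using g by contradiction
  qed
qed (rule that)

lemma generate_field_scale:
  assumes "d \<in> \<rat>" "d \<noteq> (0::complex)"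
  shows "generate_field complex_ring (insert (t * d) \<rat>) = generate_field complex_ring (insert t \<rat>)"
proof (rule generate_field_complex_eqI)
  let ?K = "generate_field complex_ring (insert t \<rat>)"
  show K: "subfield ?K complex_ring" by (rule generate_field_complex(1))
  have *: "insert t \<rat> \<subseteq> ?K" by (rule generate_field_complex(2))
  show "insert (t * d) \<rat> \<subseteq> ?K" using * assms(1) subfield_complexD(4)[OF K] by auto
  fix F assume F: "subfield F complex_ring" "insert (t * d) \<rat> \<subseteq> F"
  then have "t * d / d \<in> F" using assms(1) subfield_complexD(8)[OF F(1)] by blast
  then have "insert t \<rat> \<subseteq> F" using F assms(2) by auto
  then show "?K \<subseteq> F" by (rule generate_field_complex(3)[OF F(1)])
qed

lemma pure_quartic_fields_normal_form:
  assumes "F \<in> pure_quartic_fields x"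
  obtains b c t where "pure_quartic b c t" "c > 0" "F = qfield c t" "real_of_int \<bar>discriminant F\<bar> \<le> x"
proof -
  obtain a u where a: "admissible a" "u ^ 4 = of_int a" "F = generate_field complex_ring (insert u \<rat>)"
    and D: "real_of_int \<bar>discriminant F\<bar> \<le> x"
    using assms by (auto simp: pure_quartic_fields_def)
  obtain b c d where bc: "a = b * c ^ 3 * d ^ 4" "squarefree (b * c)" "\<not> is_unit (b * c)" "c > 0" "d \<noteq> 0"
    using admissible_normal_form[OF a(1)] .
  define t where "t = u / of_int d"
  have "t ^ 4 = of_int (b * c ^ 3)" using a(2) bc(1,5) by (simp add: t_def power_divide)
  then interpret pure_quartic b c t by unfold_locales (use bc in auto)
  have "u = t * of_int d" using bc(5) by (simp add: t_def)
  then have "F = K" unfolding a(3) qfield_eq using generate_field_scale[of "of_int d" t] bc(5) by simp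
  then show ?thesis using that[of b c t] pure_quartic_axioms bc(4) D by blast
qed

lemma ramified_primes_le_genus:
  assumes "pure_quartic b c t" "card {p. Factorial_Ring.prime p \<and> odd p \<and> p dvd b * c} \<le> n"
  shows "card (prime_factors (b * c)) \<le> n + 1"
proof -
  have nz: "b * c \<noteq> 0" using pure_quartic.bc_nz[OF assms(1)] by simp
  have "prime_factors (b * c) \<subseteq> insert 2 {p. Factorial_Ring.prime p \<and> odd p \<and> p dvd b * c}"
  proof
    fix p assume "p \<in> prime_factors (b * c)"
    then have p: "Factorial_Ring.prime p" "p dvd b * c" by (auto simp: prime_factors_dvd)
    have "p = 2" if "even p" using primes_dvd_imp_eq[of 2 p] p(1) that by simp
    then show "p \<in> insert 2 {p. Factorial_Ring.prime p \<and> odd p \<and> p dvd b * c}" using p by blast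
  qed
  moreover have fin: "finite {p. Factorial_Ring.prime p \<and> odd p \<and> p dvd b * c}"
    by (rule finite_subset[of _ "prime_factors (b * c)"]) (use nz in \<open>auto simp: prime_factors_dvd\<close>)
  ultimately have "card (prime_factors (b * c)) \<le> card (insert 2 {p. Factorial_Ring.prime p \<and> odd p \<and> p dvd b * c})"
    by (intro card_mono) auto
  also have "\<dots> \<le> Suc n" using fin assms(2) by (simp add: card_insert_if)
  finally show ?thesis by simp
qed

text \<open>For one prime: the possible values 0, 1 and 3 of \<open>b + 3 * c\<close> are distinct
  modulo 4.\<close>

lemma exponents_mod_4_unique:
  fixes b c b' c' m n :: nat
  assumes "b + c \<le> 1" "b' + c' \<le> 1" "4 * n + (b + 3 * c) = 4 * m + (b' + 3 * c')"
  shows "b = b' \<and> c = c'"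
proof -
  have "(b = 0 \<and> c = 0) \<or> (b = 1 \<and> c = 0) \<or> (b = 0 \<and> c = 1)"
    "(b' = 0 \<and> c' = 0) \<or> (b' = 1 \<and> c' = 0) \<or> (b' = 0 \<and> c' = 1)" using assms(1,2) by linarith+
  then show ?thesis using assms(3) by (elim disjE) (simp; presburger)+
qed

text \<open>Each class of integers modulo fourth powers has a representative \<open>b c\<^sup>3\<close> with \<open>b c\<close> squarefree, so the
  next lemma identifies \<open>b\<close> and \<open>c\<close> from that class.\<close>

lemma normal_form_unique:
  fixes b c b' c' m n :: int
  assumes pos: "b > 0" "c > 0" "b' > 0" "c' > 0" and nz: "m \<noteq> 0" "n \<noteq> 0"
    and sq: "squarefree (b * c)" "squarefree (b' * c')" and eq: "n ^ 4 * (b * c ^ 3) = m ^ 4 * (b' * c' ^ 3)"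
  shows "b = b' \<and> c = c'"
proof -
  have "multiplicity p b = multiplicity p b' \<and> multiplicity p c = multiplicity p c'"
    if p: "Factorial_Ring.prime p" for p
  proof -
    have le: "multiplicity p (e * f) \<le> 1" if "squarefree (e * f)" for e f :: int
      using that p squarefree_factorial_semiring''[of "e * f"] by (cases "e * f = 0") auto
    have pe: "prime_elem p" using p by (rule prime_imp_prime_elem)
    note mult = prime_elem_multiplicity_mult_distrib[OF pe] prime_elem_multiplicity_power_distrib[OF pe]
    have "multiplicity p b + multiplicity p c \<le> 1" using le[OF sq(1)] pos by (simp add: mult)
    moreover have "multiplicity p b' + multiplicity p c' \<le> 1" using le[OF sq(2)] pos by (simp add: mult)
    moreover have "4 * multiplicity p n + (multiplicity p b + 3 * multiplicity p c) =
        4 * multiplicity p m + (multiplicity p b' + 3 * multiplicity p c')"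
      using arg_cong[OF eq, of "multiplicity p"] pos nz by (simp add: mult)
    ultimately show ?thesis by (intro exponents_mod_4_unique)
  qed
  then show ?thesis using pos by (auto intro: multiplicity_eq_int)
qed

lemma real_fourth_power_eq:
  fixes s t :: complex
  assumes "s \<in> \<real>" "t \<in> \<real>" "s ^ 4 = t ^ 4"
  shows "s = t \<or> s = - t"
proof -
  obtain x y where xy: "s = of_real x" "t = of_real y" using assms(1,2) by (auto elim!: Reals_cases)
  then have "x ^ 4 = y ^ 4" using assms(3) by (metis of_real_eq_iff of_real_power)
  then have "\<bar>x\<bar> ^ 4 = \<bar>y\<bar> ^ 4" by (simp add: power_even_abs)
  then have "\<bar>x\<bar> = \<bar>y\<bar>" using power_eq_iff_eq_base[of 4 "\<bar>x\<bar>" "\<bar>y\<bar>"] by simp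
  then show ?thesis using xy by (auto simp: abs_eq_iff)
qed

lemma normal_form_unique_complex:
  fixes b c b' c' :: int and x :: complex
  assumes pos: "b > 0" "c > 0" "b' > 0" "c' > 0" and x: "x \<in> \<rat>" "x \<noteq> 0"
    and sq: "squarefree (b * c)" "squarefree (b' * c')" and eq: "of_int (b * c ^ 3) = x ^ 4 * of_int (b' * c' ^ 3)"
  shows "b = b' \<and> c = c'"
proof -
  obtain m n where mn: "n > 0" "x = of_int m / of_int n" using x(1) by (auto elim: Rats_cases')
  have "of_int n ^ 4 * (of_int (b * c ^ 3) :: complex) = of_int m ^ 4 * of_int (b' * c' ^ 3)"
    unfolding eq using mn by (simp add: power_divide)
  then have "(of_int (n ^ 4 * (b * c ^ 3)) :: complex) = of_int (m ^ 4 * (b' * c' ^ 3))"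
    by (simp only: of_int_mult of_int_power)
  then have eq': "n ^ 4 * (b * c ^ 3) = m ^ 4 * (b' * c' ^ 3)" by (simp only: of_int_eq_iff)
  have "m \<noteq> 0" "n \<noteq> 0" using mn x(2) by auto
  then show ?thesis using normal_form_unique[OF pos _ _ sq eq'] by simp
qed

section \<open>Isomorphisms between real pure quartic fields\<close>

context pure_quartic begin

lemma qfield_real:
  assumes "t \<in> \<real>" "u \<in> K"
  shows "u \<in> \<real>"
proof -
  obtain w x y z where u: "u = qel c t w x y z" "w \<in> \<rat>" "x \<in> \<rat>" "y \<in> \<rat>" "z \<in> \<rat>"
    using assms(2) by (rule qfieldE)
  have R: "\<rat> \<subseteq> (\<real> :: complex set)" by (auto elim!: Rats_cases')
  have "of_int c \<in> (\<real> :: complex set)" by simp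
  then show ?thesis using assms(1) u R unfolding u(1) qel_def
    by (intro Reals_add Reals_mult Reals_divide Reals_power) auto
qed

text \<open>A real radical lying in a real pure quartic field is a monomial in the generator: the embedding
  \<open>t \<mapsto> i t\<close> multiplies it by a power of \<open>i\<close>, and comparing real and imaginary parts leaves one coordinate.\<close>

lemma real_radical_monomial:
  assumes t: "t \<in> \<real>" and s: "s \<in> K" "s ^ 4 \<in> \<rat>"
  shows "\<exists>q\<in>\<rat>. s \<in> {q, q * t, q * (t ^ 2 / of_int c), q * (t ^ 3 / of_int c ^ 2)}"
proof -
  note Ks = subfield_complexD[OF qfield_subfield]
  obtain w x y z where u: "s = qel c t w x y z" and R: "w \<in> \<rat>" "x \<in> \<rat>" "y \<in> \<rat>" "z \<in> \<rat>"
    using s(1) by (rule qfieldE)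
  have it: "\<i> * t \<in> roots" by (simp add: roots_def)
  define e where "e = cemb (\<i> * t)"
  have "e s ^ 4 = e (s ^ 4)"
    using field_emb_fixes(3)[OF qfield_subfield cemb_field_emb[OF it] s(1), of 4] by (simp add: e_def)
  also have "\<dots> = s ^ 4"
    using field_emb_fixes(2)[OF qfield_subfield cemb_field_emb[OF it] s(2)] by (simp add: e_def)
  finally have e4: "e s ^ 4 = s ^ 4" .
  have "e s ^ 4 - s ^ 4 = (e s - s) * (e s + s) * ((e s - \<i> * s) * (e s + \<i> * s))"
    by (simp add: algebra_simps eval_nat_numeral)
  then have cases: "e s - s = 0 \<or> e s + s = 0 \<or> e s - \<i> * s = 0 \<or> e s + \<i> * s = 0"
    using e4 by auto
  define B C D where "B = x * t" and "C = y * (t ^ 2 / of_int c)" and "D = z * (t ^ 3 / of_int c ^ 2)"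
  \<comment> \<open>The embedding multiplies the four summands of \<open>s\<close> by 1, i, -1 and
    -i; all of them are real.\<close>
  have es: "e s = (w - C) + \<i> * (B - D)"
    unfolding e_def u cemb_qel[OF R]
    by (simp add: qel_def B_def C_def D_def power_mult_distrib algebra_simps eval_nat_numeral)
  have ss: "s = w + B + C + D" by (simp add: u qel_def B_def C_def D_def)
  have "qel c t w 0 0 0 \<in> K" "qel c t 0 x 0 0 \<in> K" "qel c t 0 0 y 0 \<in> K" "qel c t 0 0 0 z \<in> K"
    using R by (simp_all add: qelI)
  then have real: "w \<in> \<real>" "B \<in> \<real>" "C \<in> \<real>" "D \<in> \<real>"
    using qfield_real[OF t] by (simp_all only: qel_def B_def C_def D_def) simp_all
  have split: "u = 0 \<and> v = 0" if "u \<in> \<real>" "v \<in> \<real>" "u = \<i> * v" for u v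
    using that by (auto simp: complex_is_Real_iff complex_eq_iff)
  \<comment> \<open>These summands are rational multiples of different basis elements, so they agree
    only when both vanish.\<close>
  have BD: "B = 0 \<and> D = 0" if "B = D"
  proof -
    have "qel c t 0 x 0 (- z) = 0" using that by (simp add: qel_def B_def D_def)
    then show ?thesis using qel_eq_0[of 0 x 0 "- z"] R by (simp add: B_def D_def)
  qed
  have AC: "w = 0 \<and> C = 0" if "w = C"
  proof -
    have "qel c t w 0 (- y) 0 = 0" using that by (simp add: qel_def C_def)
    then show ?thesis using qel_eq_0[of w 0 "- y" 0] R by (simp add: C_def)
  qed
  from cases consider "e s = s" | "e s = - s" | "e s = \<i> * s" | "e s = - (\<i> * s)"
    by (auto simp: eq_neg_iff_add_eq_0)
  then have "s \<in> {w, B, C, D}"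
  proof cases
    case 1
    then have "B + C + D + C = \<i> * (B - D)" unfolding es by (subst (asm) ss) (simp add: algebra_simps)
    then have "B + C + D + C = 0 \<and> B - D = 0" by (rule split[rotated 2]) (use real in simp_all)
    then have "B = D" "B + C + D + C = 0" by auto
    then have "B = 0" "D = 0" "C = 0" using BD by auto
    then show ?thesis using ss by simp
  next
    case 2
    then have "- (w + w + B + D) = \<i> * (B - D)" unfolding es by (subst (asm) ss) (simp add: algebra_simps)
    then have "- (w + w + B + D) = 0 \<and> B - D = 0" by (rule split[rotated 2]) (use real in simp_all)
    then have "B = D" "- (w + w + B + D) = 0" by auto
    then have "B = 0" "D = 0" "w = 0" using BD by auto
    then show ?thesis using ss by simp
  next
    case 3
    then have "w - C = \<i> * (w + C + D + D)" unfolding es by (subst (asm) ss) (simp add: algebra_simps)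
    then have h: "w - C = 0 \<and> w + C + D + D = 0" by (rule split[rotated 2]) (use real in simp_all)
    then have wC: "w = 0 \<and> C = 0" using AC by simp
    then have "D = 0" using conjunct2[OF h] by simp
    then show ?thesis using ss wC by simp
  next
    case 4
    then have "w - C = \<i> * - (B + B + w + C)" unfolding es by (subst (asm) ss) (simp add: algebra_simps)
    then have h: "w - C = 0 \<and> - (B + B + w + C) = 0" by (rule split[rotated 2]) (use real in simp_all)
    then have wC: "w = 0 \<and> C = 0" using AC by simp
    then have "B = 0" using conjunct2[OF h] by simp
    then show ?thesis using ss wC by simp
  qed
  then have "s \<in> {w, x * t, y * (t ^ 2 / of_int c), z * (t ^ 3 / of_int c ^ 2)}" by (simp only: B_def C_def D_def)
  then show ?thesis using R by blast
qed

lemma not_rational: "t \<notin> \<rat>" "t ^ 2 \<notin> \<rat>"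
proof -
  show "t \<notin> \<rat>"
  proof
    assume R: "t \<in> \<rat>"
    have "qel c t t (- 1) 0 0 = 0" by (simp add: qel_def)
    then show False using qel_eq_0[of t "- 1" 0 0] R by simp
  qed
  show "t ^ 2 \<notin> \<rat>"
  proof
    assume R: "t ^ 2 \<in> \<rat>"
    have "qel c t (t ^ 2 / of_int c) 0 (- 1) 0 = 0" by (simp add: qel_def)
    then show False using qel_eq_0[of "t ^ 2 / of_int c" 0 "- 1" 0] R by simp
  qed
qed

end

text \<open>An isomorphism sends \<open>t\<close> to a real fourth root of the same integer, which
  is \<open>t\<close> or \<open>- t\<close>; so \<open>t\<close> lies in the other field and is one
  of four monomials there. Degrees rule out the constant and the quadratic one; the linear one gives
  equal pairs and the cubic one exchanged pairs.\<close>

lemma iso_real_pure_quartic: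
  assumes q: "pure_quartic b c t" "pure_quartic b' c' t'" and real: "t \<in> \<real>" "t' \<in> \<real>"
    and pos: "b > 0" "c > 0" "b' > 0" "c' > 0"
    and iso: "sub_ring (qfield c t) \<simeq> sub_ring (qfield c' t')"
  shows "b = b' \<and> c = c' \<or> b = c' \<and> c = b'"
proof -
  interpret A: pure_quartic b c t by fact
  interpret B: pure_quartic b' c' t' by fact
  obtain f where "f \<in> ring_iso (sub_ring A.K) (sub_ring B.K)"
    using iso by (auto simp: is_ring_iso_def)
  then have f: "field_emb A.K f" "f \<in> A.K \<rightarrow> B.K"
    by (auto simp: ring_iso_def field_emb_iff_ring_hom)
  have fx: "f (t ^ 4) = f t ^ 4" "f (of_int n) = of_int n" for n
    using field_emb_fixes(3)[OF A.qfield_subfield f(1) A.t_in] field_emb_fixes(1)[OF A.qfield_subfield f(1)] by blast+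
  have "f t \<in> B.K" using f(2) A.t_in by blast
  moreover have "f t ^ 4 = t ^ 4" using fx A.root by metis
  then have "f t = t \<or> f t = - t"
    using real_fourth_power_eq[OF B.qfield_real[OF real(2) \<open>f t \<in> B.K\<close>] real(1)] by blast
  ultimately have tB: "t \<in> B.K" using subfield_complexD(5)[OF B.qfield_subfield] by (metis minus_minus)
  have "t ^ 4 \<in> \<rat>" unfolding A.root by simp
  then obtain q where Q: "q \<in> \<rat>" and "t \<in> {q, q * t', q * (t' ^ 2 / of_int c'), q * (t' ^ 3 / of_int c' ^ 2)}"
    using B.real_radical_monomial[OF real(2) tB] by blast
  then consider "t = q" | "t = q * t'" | "t = q * (t' ^ 2 / of_int c')" | "t = q * (t' ^ 3 / of_int c' ^ 2)" by blast
  then show ?thesis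
  proof cases
    case 1
    then show ?thesis using A.not_rational(1) Q by simp
  next
    case 2
    have "q \<noteq> 0" using 2 A.t_nz by auto
    moreover have "of_int (b * c ^ 3) = q ^ 4 * of_int (b' * c' ^ 3)"
      unfolding A.root[symmetric] B.root[symmetric] 2 by (rule power_mult_distrib)
    ultimately show ?thesis using normal_form_unique_complex[OF pos Q _ A.sqfree B.sqfree] by blast
  next
    case 3
    have "t ^ 2 = q ^ 2 * of_int (b' * c')" unfolding 3 power_mult_distrib B.beta_sq ..
    then have "t ^ 2 \<in> \<rat>" using Q by simp
    then show ?thesis using A.not_rational(2) by simp
  next
    case 4
    interpret C: pure_quartic c' b' "t' ^ 3 / of_int c' ^ 2" by (rule B.swap)
    have "q \<noteq> 0" using 4 A.t_nz by auto
    moreover have "of_int (b * c ^ 3) = q ^ 4 * of_int (c' * b' ^ 3)"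
      unfolding A.root[symmetric] C.root[symmetric] 4 by (rule power_mult_distrib)
    ultimately show ?thesis
      using normal_form_unique_complex[OF pos(1,2,4,3) Q _ A.sqfree C.sqfree] by blast
  qed
qed

section \<open>Counting\<close>

lemma card_multiples_le: "m > 0 \<Longrightarrow> real (card {b \<in> {1..N}. m dvd b}) \<le> real N / real (m::nat)"
proof -
  assume m: "m > 0"
  have "{b \<in> {1..N}. m dvd b} \<subseteq> (\<lambda>k. m * k) ` {1..N div m}"
  proof
    fix b assume "b \<in> {b \<in> {1..N}. m dvd b}"
    then obtain k where k: "b = m * k" "1 \<le> m * k" "m * k \<le> N" by auto
    then have "k \<le> N div m" "1 \<le> k" using m by (auto simp: less_eq_div_iff_mult_less_eq mult.commute Suc_le_eq)
    then show "b \<in> (\<lambda>k. m * k) ` {1..N div m}" using k by auto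
  qed
  then have "card {b \<in> {1..N}. m dvd b} \<le> card {1..N div m}"
    by (meson surj_card_le finite_atLeastAtMost)
  then have "real (card {b \<in> {1..N}. m dvd b}) \<le> real (N div m)" by simp
  also have "\<dots> \<le> real N / real m" by (rule of_nat_div_le_of_nat)
  finally show ?thesis .
qed

text \<open>Telescoping that starts from equality at \<open>N = 2\<close>, where both sides are
  1/4.\<close>

lemma sum_inverse_squares_le: "N \<ge> 2 \<Longrightarrow> (\<Sum>d\<in>{2..N}. 1 / (real d)\<^sup>2) \<le> 3 / 4 - 1 / real N"
proof (induction N rule: nat_induct_at_least)
  case base
  show ?case by (simp add: power2_eq_square)
next
  case (Suc N)
  have "1 / (real (Suc N))\<^sup>2 \<le> 1 / (real N * real (Suc N))"
    using Suc.hyps by (intro divide_left_mono) (auto simp: power2_eq_square)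
  also have "\<dots> = 1 / real N - 1 / real (Suc N)" using Suc.hyps by (simp add: field_simps)
  finally show ?case using Suc by simp
qed

text \<open>Multiples of squares remove at most 3/4 of the numbers and multiples of \<open>q\<close>
  at most 1/11, hence at most 1/8. This is why small primes are excluded.\<close>

lemma card_squarefree_coprime_ge:
  fixes q N :: nat
  assumes "q \<ge> 11"
  shows "real N / 8 \<le> real (card {b \<in> {1..N}. squarefree b \<and> \<not> q dvd b})"
proof -
  define G where "G = {b \<in> {1..N}. squarefree b \<and> \<not> q dvd b}"
  have "{1..N} \<subseteq> G \<union> ((\<Union>d\<in>{2..N}. {b \<in> {1..N}. d\<^sup>2 dvd b}) \<union> {b \<in> {1..N}. q dvd b})"
  proof
    fix b assume b: "b \<in> {1..N}"
    have "\<exists>d\<in>{2..N}. d\<^sup>2 dvd b" if nsq: "\<not> squarefree b"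
    proof -
      obtain d where "d\<^sup>2 dvd b" "\<not> is_unit d" using not_squarefreeE[OF nsq] by blast
      then have d: "d\<^sup>2 dvd b" "d \<noteq> 1" by auto
      have "d \<noteq> 0"
      proof
        assume "d = 0"
        then show False using d(1) b by simp
      qed
      have "d \<le> d\<^sup>2" by (simp add: power2_nat_le_imp_le)
      also have "\<dots> \<le> b" using d(1) b by (intro dvd_imp_le) auto
      finally show ?thesis using d b \<open>d \<noteq> 0\<close> by (intro bexI[of _ d]) auto
    qed
    then show "b \<in> G \<union> ((\<Union>d\<in>{2..N}. {b \<in> {1..N}. d\<^sup>2 dvd b}) \<union> {b \<in> {1..N}. q dvd b})"
      using b by (auto simp: G_def)
  qed
  then have "card {1..N} \<le> card (G \<union> ((\<Union>d\<in>{2..N}. {b \<in> {1..N}. d\<^sup>2 dvd b}) \<union> {b \<in> {1..N}. q dvd b}))"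
    by (intro card_mono) (auto simp: G_def)
  also have "\<dots> \<le> card G + (card (\<Union>d\<in>{2..N}. {b \<in> {1..N}. d\<^sup>2 dvd b}) + card {b \<in> {1..N}. q dvd b})"
    by (intro order.trans[OF card_Un_le] add_left_mono card_Un_le)
  also have "card (\<Union>d\<in>{2..N}. {b \<in> {1..N}. d\<^sup>2 dvd b}) \<le> (\<Sum>d\<in>{2..N}. card {b \<in> {1..N}. d\<^sup>2 dvd b})"
    by (rule card_UN_le) simp
  finally have "N \<le> card G + ((\<Sum>d\<in>{2..N}. card {b \<in> {1..N}. d\<^sup>2 dvd b}) + card {b \<in> {1..N}. q dvd b})"
    by simp
  then have "real N \<le> real (card G) + ((\<Sum>d\<in>{2..N}. real (card {b \<in> {1..N}. d\<^sup>2 dvd b})) + real (card {b \<in> {1..N}. q dvd b}))"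
    by (simp only: of_nat_le_iff flip: of_nat_add of_nat_sum)
  also have "(\<Sum>d\<in>{2..N}. real (card {b \<in> {1..N}. d\<^sup>2 dvd b})) \<le> (\<Sum>d\<in>{2..N}. real N * (1 / (real d)\<^sup>2))"
    by (intro sum_mono order.trans[OF card_multiples_le]) auto
  also have "\<dots> \<le> real N * (3 / 4)"
  proof (cases "N \<ge> 2")
    case True
    have "(\<Sum>d\<in>{2..N}. 1 / (real d)\<^sup>2) \<le> 3 / 4"
      using sum_inverse_squares_le[OF True] by (rule order.trans) simp
    then show ?thesis unfolding sum_distrib_left[symmetric] by (rule mult_left_mono) simp
  qed simp
  also have "real (card {b \<in> {1..N}. q dvd b}) \<le> real N * (1 / 8)"
    using card_multiples_le[of q N] assms order.trans[OF _ divide_left_mono[of 8 "real q" "real N"]] by simp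
  finally show ?thesis unfolding G_def by simp
qed

lemma prod_prime_factors_squarefree:
  fixes n :: "'a :: factorial_semiring_multiplicative"
  assumes "squarefree n"
  shows "\<Prod>(prime_factors n) = normalize n"
proof -
  have n0: "n \<noteq> 0" using assms by auto
  have "(\<Prod>p\<in>prime_factors n. p ^ multiplicity p n) = \<Prod>(prime_factors n)"
    using assms n0 by (intro prod.cong) (auto simp: squarefree_factorial_semiring')
  then show ?thesis using prod_prime_factors[OF n0] by simp
qed

text \<open>Such a number is determined by the set of primes of its squarefree part, a subset of the
  numbers below \<open>k\<close>, and by its square part, which is at most
  \<open>2 ^ (k + 2)\<close>.\<close>

lemma card_smooth_le:
  "card {n \<in> {1..4 ^ (k + 2)}. \<forall>p. Factorial_Ring.prime p \<longrightarrow> p dvd n \<longrightarrow> p < k} \<le> 2 ^ (2 * k + 2)"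
    (is "card ?A \<le> _")
proof -
  define f :: "nat \<Rightarrow> nat set \<times> nat" where "f n = (prime_factors (squarefree_part n), square_part n)" for n
  have "inj_on f ?A"
  proof (rule inj_onI)
    fix m n assume "f m = f n"
    then have "prime_factors (squarefree_part m) = prime_factors (squarefree_part n)" and sq: "square_part m = square_part n"
      by (simp_all add: f_def)
    then have "\<Prod>(prime_factors (squarefree_part m)) = \<Prod>(prime_factors (squarefree_part n))" by simp
    then have "squarefree_part m = squarefree_part n"
      unfolding prod_prime_factors_squarefree[OF squarefree_squarefree_part] by simp
    then have "squarefree_part m * (square_part m)\<^sup>2 = squarefree_part n * (square_part n)\<^sup>2" using sq by simp
    then show "m = n" unfolding squarefree_decompose[symmetric] .
  qed
  moreover have "f ` ?A \<subseteq> Pow {..<k} \<times> {1..2 ^ (k + 2)}"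
  proof
    fix y assume "y \<in> f ` ?A"
    then obtain n where n: "n \<in> ?A" "y = f n" by blast
    have "prime_factors (squarefree_part n) \<subseteq> {..<k}"
    proof
      fix p assume p: "p \<in> prime_factors (squarefree_part n)"
      have "squarefree_part n dvd n" using squarefree_decompose[of n] by (metis dvd_triv_left)
      then have "Factorial_Ring.prime p" "p dvd n" using p dvd_trans by (auto simp: prime_factors_dvd)
      then show "p \<in> {..<k}" using n(1) by blast
    qed
    moreover have "(square_part n)\<^sup>2 \<le> (2 ^ (k + 2))\<^sup>2"
    proof -
      have "(square_part n)\<^sup>2 \<le> n" using n(1) by (intro dvd_imp_le) auto
      also have "n \<le> 4 ^ (k + 2)" using n(1) by simp
      also have "(4::nat) ^ (k + 2) = (2 ^ (k + 2))\<^sup>2" by (simp add: power2_eq_square flip: power_mult_distrib)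
      finally show ?thesis .
    qed
    then have "square_part n \<le> 2 ^ (k + 2)" by (rule power2_le_imp_le) simp
    moreover have "square_part n \<noteq> 0" using n(1) by simp
    then have "1 \<le> square_part n" by (cases "square_part n") simp_all
    ultimately show "y \<in> Pow {..<k} \<times> {1..2 ^ (k + 2)}" unfolding n(2) f_def by simp
  qed
  ultimately have "card ?A \<le> card (Pow {..<k} \<times> {1..2 ^ (k + 2) :: nat})"
    by (intro card_inj_on_le[of f]) auto
  also have "\<dots> = 2 ^ k * 2 ^ (k + 2)" by (simp add: card_cartesian_product card_Pow)
  also have "\<dots> = 2 ^ (2 * k + 2)" by (simp flip: power_add)
  finally show ?thesis .
qed

text \<open>Erdos' argument: if the tail beyond \<open>k\<close> were less than a half, more than half of all \<open>n \<le> 4\<^bsup>k+2\<^esup>\<close> would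
  have all prime factors below \<open>k\<close>, but there are at most \<open>2\<^bsup>k\<^esup> \<cdot> 2\<^bsup>k+2\<^esup>\<close> such numbers.\<close>

lemma not_summable_prime_reciprocals:
  "\<not> summable (\<lambda>n::nat. if Factorial_Ring.prime n then 1 / real n else 0)"
proof
  define f where "f = (\<lambda>n::nat. if Factorial_Ring.prime n then 1 / real n else 0)"
  assume "summable (\<lambda>n::nat. if Factorial_Ring.prime n then 1 / real n else 0)"
  then have f: "summable f" by (simp add: f_def)
  obtain k where k: "norm (suminf (\<lambda>i. f (i + k))) < 1 / 2"
    using suminf_exist_split[of "1 / 2" f] f by auto
  \<comment> \<open>This size makes the bound \<open>2 ^ (2 * k + 2)\<close> for the smooth numbers
    a quarter of \<open>N\<close>, so the two shares 1/4 and 1/2 cannot cover everything.\<close>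
  define N :: nat where "N = 4 ^ (k + 2)"
  have f0: "f n \<ge> 0" for n by (simp add: f_def)
  have tail: "(\<Sum>p\<in>{k..N}. f p) < 1 / 2"
  proof -
    have "(\<Sum>p\<in>{k..N}. f p) \<le> (\<Sum>i<Suc N. f (i + k))"
    proof -
      have "(\<Sum>p\<in>{k..N}. f p) \<le> (\<Sum>p\<in>(\<lambda>i. i + k) ` {..<Suc N}. f p)"
      proof (rule sum_mono2)
        show "{k..N} \<subseteq> (\<lambda>i. i + k) ` {..<Suc N}"
        proof
          fix p assume "p \<in> {k..N}"
          then show "p \<in> (\<lambda>i. i + k) ` {..<Suc N}" by (intro image_eqI[of _ _ "p - k"]) auto
        qed
      qed (auto simp: f0)
      also have "\<dots> = (\<Sum>i<Suc N. f (i + k))" by (subst sum.reindex) (auto simp: inj_on_def)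
      finally show ?thesis .
    qed
    also have "\<dots> \<le> suminf (\<lambda>i. f (i + k))"
      by (rule sum_le_suminf) (use f f0 in \<open>auto simp: summable_iff_shift\<close>)
    finally show ?thesis using k by simp
  qed
  define A where "A = {n \<in> {1..N}. \<forall>p. Factorial_Ring.prime p \<longrightarrow> p dvd n \<longrightarrow> p < k}"
  define P where "P = {p \<in> {k..N}. Factorial_Ring.prime p}"
  have "{1..N} \<subseteq> A \<union> (\<Union>p\<in>P. {n \<in> {1..N}. p dvd n})"
  proof
    fix n assume n: "n \<in> {1..N}"
    show "n \<in> A \<union> (\<Union>p\<in>P. {n \<in> {1..N}. p dvd n})"
    proof (cases "n \<in> A")
      case False
      then obtain p where p: "Factorial_Ring.prime p" "p dvd n" "k \<le> p" using n by (auto simp: A_def not_less)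
      then have "p \<le> n" using n by (intro dvd_imp_le) auto
      then have "p \<in> P" using p n by (simp add: P_def)
      then show ?thesis using p(2) n by blast
    qed simp
  qed
  then have "card {1..N} \<le> card (A \<union> (\<Union>p\<in>P. {n \<in> {1..N}. p dvd n}))"
    by (intro card_mono) (auto simp: A_def P_def)
  also have "\<dots> \<le> card A + card (\<Union>p\<in>P. {n \<in> {1..N}. p dvd n})" by (rule card_Un_le)
  also have "card (\<Union>p\<in>P. {n \<in> {1..N}. p dvd n}) \<le> (\<Sum>p\<in>P. card {n \<in> {1..N}. p dvd n})"
    by (rule card_UN_le) (simp add: P_def)
  finally have "N \<le> card A + (\<Sum>p\<in>P. card {n \<in> {1..N}. p dvd n})" by simp
  then have "real N \<le> real (card A) + (\<Sum>p\<in>P. real (card {n \<in> {1..N}. p dvd n}))"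
    by (simp only: of_nat_le_iff flip: of_nat_add of_nat_sum)
  also have "(\<Sum>p\<in>P. real (card {n \<in> {1..N}. p dvd n})) \<le> (\<Sum>p\<in>P. real N * f p)"
  proof (rule sum_mono)
    fix p assume "p \<in> P"
    then have "Factorial_Ring.prime p" by (simp add: P_def)
    then show "real (card {n \<in> {1..N}. p dvd n}) \<le> real N * f p"
      using card_multiples_le[of p N] prime_gt_0_nat[of p] by (simp add: f_def)
  qed
  also have "\<dots> = real N * (\<Sum>p\<in>P. f p)" by (simp add: sum_distrib_left)
  also have "(\<Sum>p\<in>P. f p) = (\<Sum>p\<in>{k..N}. f p)"
    by (rule sum.mono_neutral_left) (auto simp: P_def f_def)
  also have "real N * (\<Sum>p\<in>{k..N}. f p) \<le> real N * (1 / 2)" using tail by (intro mult_left_mono) auto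
  also have "real (card A) \<le> real N / 4"
  proof -
    have "real (card A) \<le> real (2 ^ (2 * k + 2))"
      using card_smooth_le[of k] by (simp only: A_def N_def of_nat_le_iff)
    also have "\<dots> = real N / 4" by (simp add: N_def power_add power_mult)
    finally show ?thesis .
  qed
  finally have "real N \<le> real N / 4 + real N * (1 / 2)" by simp
  then show False by (simp add: N_def)
qed

lemma prime_reciprocals_unbounded:
  "\<exists>Q :: nat set. finite Q \<and> (\<forall>q\<in>Q. Factorial_Ring.prime q \<and> q \<ge> 11) \<and> M \<le> (\<Sum>q\<in>Q. 1 / real q)"
proof (rule ccontr)
  assume neg: "\<not> ?thesis"
  define f where "f = (\<lambda>n::nat. if Factorial_Ring.prime n then 1 / real n else 0)"
  have "(\<Sum>n<N. f n) \<le> (\<Sum>n<11. f n) + M" for N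
  proof -
    define Q where "Q = {q \<in> {11..<N}. Factorial_Ring.prime q}"
    have "(\<Sum>n<N. f n) \<le> (\<Sum>n\<in>{..<11} \<union> {11..<N}. f n)"
      by (rule sum_mono2) (auto simp: f_def)
    also have "\<dots> = (\<Sum>n<11. f n) + (\<Sum>n\<in>{11..<N}. f n)" by (rule sum.union_disjoint) auto
    also have "(\<Sum>n\<in>{11..<N}. f n) = (\<Sum>q\<in>Q. 1 / real q)"
      by (rule sum.mono_neutral_cong_right) (auto simp: Q_def f_def)
    also have "\<dots> \<le> M"
    proof (rule ccontr)
      assume "\<not> (\<Sum>q\<in>Q. 1 / real q) \<le> M"
      moreover have "finite Q" "\<forall>q\<in>Q. Factorial_Ring.prime q \<and> q \<ge> 11" by (auto simp: Q_def)
      ultimately show False using neg by (meson linorder_le_cases)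
    qed
    finally show ?thesis by simp
  qed
  then have "summable f" by (intro summableI_nonneg_bounded) (auto simp: f_def)
  then show False using not_summable_prime_reciprocals by (simp add: f_def)
qed

section \<open>Counting the fields\<close>

lemma squarefree_int_iff: "squarefree (int n) \<longleftrightarrow> squarefree n"
proof
  assume s: "squarefree (int n)"
  show "squarefree n"
  proof (rule squarefreeI)
    fix x assume "x\<^sup>2 dvd n"
    then have "(int x)\<^sup>2 dvd int n" by (metis of_nat_dvd_iff of_nat_power)
    then have "is_unit (int x)" using s squarefreeD by blast
    then show "is_unit x" by simp
  qed
next
  assume s: "squarefree n"
  show "squarefree (int n)"
  proof (rule squarefreeI)
    fix x assume "x\<^sup>2 dvd int n"
    then have "int ((nat \<bar>x\<bar>)\<^sup>2) dvd int n" by simp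
    then have "is_unit (nat \<bar>x\<bar>)" using s squarefreeD by (metis of_nat_dvd_iff)
    then show "is_unit x" by simp
  qed
qed

text \<open>A pair is recovered from \<open>\<bar>b * c\<bar>\<close>, the sign of \<open>b\<close>
  and the set of primes dividing \<open>c\<close>, which leaves at most \<open>2 * 2 ^ w\<close>
  pairs for each product.\<close>

lemma squarefree_parts_card:
  "finite {(b, c). c > 0 \<and> squarefree (b * c) \<and> \<bar>b * c\<bar> \<le> int N \<and> card (prime_factors (b * c)) \<le> w}"
  "card {(b, c). c > 0 \<and> squarefree (b * c) \<and> \<bar>b * c\<bar> \<le> int N \<and> card (prime_factors (b * c)) \<le> w} \<le> N * (2 * 2 ^ w)"
proof -
  define A where "A = {(b, c). c > 0 \<and> squarefree (b * c) \<and> \<bar>b * c\<bar> \<le> int N \<and> card (prime_factors (b * c)) \<le> w}"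
  define M where "M = {n \<in> {1..N}. card (prime_factors (int n)) \<le> w}"
  define D where "D = (SIGMA n:M. {1, - 1 :: int} \<times> Pow (prime_factors (int n)))"
  define h :: "nat \<times> int \<times> int set \<Rightarrow> int \<times> int" where "h = (\<lambda>(n, s, T). (s * (int n div \<Prod>T), \<Prod>T))"
  have sub: "A \<subseteq> h ` D"
  proof
    fix y assume "y \<in> A"
    then obtain b c where y: "y = (b, c)" and bc: "c > 0" "squarefree (b * c)" "\<bar>b * c\<bar> \<le> int N"
      "card (prime_factors (b * c)) \<le> w" by (auto simp: A_def)
    have b0: "b \<noteq> 0" using bc(2) by auto
    have "squarefree c" using bc(2) squarefree_multD by blast
    then have T: "\<Prod>(prime_factors c) = c" using prod_prime_factors_squarefree bc(1) by fastforce
    have c0: "c \<noteq> 0" using bc(1) by simp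
    define n where "n = nat \<bar>b * c\<bar>"
    have "int n = b * c \<or> int n = - (b * c)" by (auto simp: n_def)
    then have pn: "prime_factors (int n) = prime_factors (b * c)" by (elim disjE) (simp_all only: prime_factorization_uminus)
    have "n \<in> M" using bc b0 pn by (auto simp: M_def n_def Suc_le_eq)
    moreover have "prime_factors c \<subseteq> prime_factors (int n)" unfolding pn using b0 c0
      by (auto simp: prime_factors_dvd)
    moreover have "sgn b \<in> {1, - 1}" using b0 by (simp add: sgn_if)
    moreover have "int n div c = \<bar>b\<bar>" using bc(1) by (simp add: n_def abs_mult)
    then have "sgn b * (int n div \<Prod>(prime_factors c)) = b" unfolding T by (simp add: sgn_mult_abs)
    ultimately show "y \<in> h ` D"
      unfolding y by (intro image_eqI[of _ _ "(n, sgn b, prime_factors c)"]) (auto simp: h_def D_def T)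
  qed
  have finD: "finite D" by (simp add: D_def M_def)
  have "card D = (\<Sum>n\<in>M. card ({1, - 1 :: int} \<times> Pow (prime_factors (int n))))"
    unfolding D_def by (rule card_SigmaI) (auto simp: M_def)
  also have "\<dots> \<le> (\<Sum>n\<in>M. 2 * 2 ^ w)"
  proof (rule sum_mono)
    fix n assume "n \<in> M"
    then have "(2::nat) ^ card (prime_factors (int n)) \<le> 2 ^ w" by (intro power_increasing) (auto simp: M_def)
    moreover have "card ({1, - 1 :: int} \<times> Pow (prime_factors (int n))) = 2 * 2 ^ card (prime_factors (int n))"
      by (simp add: card_cartesian_product card_Pow)
    ultimately show "card ({1, - 1 :: int} \<times> Pow (prime_factors (int n))) \<le> 2 * 2 ^ w"
      by (simp only: mult_le_mono2)
  qed
  also have "\<dots> \<le> N * (2 * 2 ^ w)"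
  proof -
    have "card M \<le> card {1..N}" by (rule card_mono) (auto simp: M_def)
    then show ?thesis by simp
  qed
  finally have cD: "card D \<le> N * (2 * 2 ^ w)" .
  show "finite {(b, c). c > 0 \<and> squarefree (b * c) \<and> \<bar>b * c\<bar> \<le> int N \<and> card (prime_factors (b * c)) \<le> w}"
    using finite_subset[OF sub] finD by (simp add: A_def)
  have "card A \<le> card (h ` D)" using sub finD by (intro card_mono) auto
  also have "\<dots> \<le> card D" by (rule card_image_le[OF finD])
  finally show "card {(b, c). c > 0 \<and> squarefree (b * c) \<and> \<bar>b * c\<bar> \<le> int N \<and> card (prime_factors (b * c)) \<le> w} \<le> N * (2 * 2 ^ w)"
    using cD by (simp add: A_def)
qed

lemma pure_quartic_conductor_le:
  assumes "pure_quartic b c t" "real_of_int \<bar>discriminant (qfield c t)\<bar> \<le> x"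
  shows "\<bar>b * c\<bar> \<le> int (nat \<lfloor>root 3 (256 * x)\<rfloor>)"
proof -
  have "real_of_int (\<bar>b * c\<bar> ^ 3) \<le> real_of_int (256 * \<bar>discriminant (qfield c t)\<bar>)"
    using pure_quartic.discriminant_bounds(1)[OF assms(1)] by (simp only: of_int_le_iff)
  also have "\<dots> \<le> 256 * x" using assms(2) by simp
  finally have "real_of_int \<bar>b * c\<bar> ^ 3 \<le> 256 * x" by (simp only: of_int_power)
  then have "root 3 (real_of_int \<bar>b * c\<bar> ^ 3) \<le> root 3 (256 * x)" by simp
  then have "real_of_int \<bar>b * c\<bar> \<le> root 3 (256 * x)" by (simp add: real_root_power_cancel)
  then have "\<bar>b * c\<bar> \<le> \<lfloor>root 3 (256 * x)\<rfloor>" by (simp only: le_floor_iff)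
  moreover have "z \<le> int (nat z)" for z by (cases "z \<ge> 0") auto
  ultimately show ?thesis by (rule order.trans)
qed

text \<open>Counts fields rather than isomorphism classes; the factor 4 accounts for the choice of
  the fourth root \<open>t\<close>.\<close>

lemma quartic_count_upper:
  assumes G: "G \<subseteq> pure_quartic_fields x"
    and w: "\<And>b c t. pure_quartic b c t \<Longrightarrow> qfield c t \<in> G \<Longrightarrow> card (prime_factors (b * c)) \<le> w"
  defines "N \<equiv> nat \<lfloor>root 3 (256 * x)\<rfloor>"
  shows "finite G" "card G \<le> 4 * (N * (2 * 2 ^ w))"
proof -
  define A where "A = {(b, c). c > 0 \<and> squarefree (b * c) \<and> \<bar>b * c\<bar> \<le> int N \<and> card (prime_factors (b * c)) \<le> w}"
  define H where "H = (\<lambda>(b, c). qfield c ` {t. t ^ 4 = of_int (b * c ^ 3)})"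
  note A = squarefree_parts_card[of N w, folded A_def]
  have sub: "G \<subseteq> (\<Union>p\<in>A. H p)"
  proof
    fix F assume F: "F \<in> G"
    then obtain b c t where q: "pure_quartic b c t" "c > 0" "F = qfield c t" "real_of_int \<bar>discriminant F\<bar> \<le> x"
      using G pure_quartic_fields_normal_form by blast
    have "\<bar>b * c\<bar> \<le> int N" using pure_quartic_conductor_le[OF q(1)] q(3,4) by (simp add: N_def)
    then have "(b, c) \<in> A" using q w[OF q(1)] F pure_quartic.sqfree[OF q(1)] by (simp add: A_def)
    moreover have "F \<in> H (b, c)" using q(3) pure_quartic.root[OF q(1)] unfolding H_def by blast
    ultimately show "F \<in> (\<Union>p\<in>A. H p)" by blast
  qed
  have H: "finite (H p) \<and> card (H p) \<le> 4" if p: "p \<in> A" for p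
  proof -
    obtain b c where bc: "p = (b, c)" "squarefree (b * c)" using p by (auto simp: A_def)
    then have nz: "(of_int (b * c ^ 3) :: complex) \<noteq> 0" by auto
    have fin: "finite {t :: complex. t ^ 4 = of_int (b * c ^ 3)}" by (rule finite_nth_roots) simp
    have "card {t :: complex. t ^ 4 = of_int (b * c ^ 3)} = 4" by (rule card_nth_roots[OF nz]) simp
    then show ?thesis using fin card_image_le[OF fin, of "qfield c"] unfolding H_def bc(1) by simp
  qed
  have fin: "finite (\<Union>p\<in>A. H p)" using A(1) H by blast
  show "finite G" using sub fin by (rule finite_subset)
  have "card G \<le> card (\<Union>p\<in>A. H p)" by (rule card_mono[OF fin sub])
  also have "\<dots> \<le> (\<Sum>p\<in>A. card (H p))" by (rule card_UN_le[OF A(1)])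
  also have "\<dots> \<le> (\<Sum>p\<in>A. 4)" using H by (intro sum_mono) blast
  also have "\<dots> \<le> 4 * (N * (2 * 2 ^ w))" using A(2) by simp
  finally show "card G \<le> 4 * (N * (2 * 2 ^ w))" .
qed

lemma iso_classes_eq_image:
  "iso_classes G = (\<lambda>F. {(F, L). F \<in> G \<and> L \<in> G \<and> sub_ring F \<simeq> sub_ring L} `` {F}) ` G"
  by (auto simp: iso_classes_def quotient_def)

text \<open>The crude bound \<open>N\<close> for the number of primes of \<open>b * c\<close>
  suffices, because they all lie between 1 and \<open>N\<close>.\<close>

lemma finite_pure_quartic_fields: "finite (pure_quartic_fields x)"
proof -
  define N where "N = nat \<lfloor>root 3 (256 * x)\<rfloor>"
  have "card (prime_factors (b * c)) \<le> N" if q: "pure_quartic b c t" and F: "qfield c t \<in> pure_quartic_fields x" for b c t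
  proof -
    have nz: "b * c \<noteq> 0" using pure_quartic.bc_nz[OF q] by simp
    have "real_of_int \<bar>discriminant (qfield c t)\<bar> \<le> x" using F by (simp add: pure_quartic_fields_def)
    from pure_quartic_conductor_le[OF q this] have le: "\<bar>b * c\<bar> \<le> int N" by (simp add: N_def)
    have "prime_factors (b * c) \<subseteq> {1..int N}"
    proof
      fix p assume "p \<in> prime_factors (b * c)"
      then have p: "Factorial_Ring.prime p" "p dvd b * c" by (auto simp: prime_factors_dvd)
      have "\<bar>p\<bar> \<le> \<bar>b * c\<bar>" by (rule dvd_imp_le_int[OF nz p(2)])
      then show "p \<in> {1..int N}" using prime_gt_0_int[OF p(1)] le by simp
    qed
    then have "card (prime_factors (b * c)) \<le> card {1..int N}" by (intro card_mono) auto
    then show ?thesis by simp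
  qed
  then show ?thesis by (rule quartic_count_upper(1)[OF order_refl])
qed

text \<open>At most \<open>a + 2\<close> odd primes together with 2 give \<open>w = a + 3\<close>,
  and \<open>4 * 2 * 2 ^ (a + 3)\<close> is \<open>2 ^ (a + 6)\<close>.\<close>

lemma card_genus_classes_le:
  "card (iso_classes {F \<in> pure_quartic_fields x. genus_number F = 2 ^ a}) \<le> 2 ^ (a + 6) * nat \<lfloor>root 3 (256 * x)\<rfloor>"
proof -
  define G where "G = {F \<in> pure_quartic_fields x. genus_number F = 2 ^ a}"
  have sub: "G \<subseteq> pure_quartic_fields x" by (auto simp: G_def)
  have w: "card (prime_factors (b * c)) \<le> a + 3" if q: "pure_quartic b c t" and F: "qfield c t \<in> G" for b c t
  proof -
    have "genus_number (qfield c t) = 2 ^ a" using F by (simp add: G_def)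
    from ramified_primes_le_genus[OF q pure_quartic.genus_number_bound[OF q this]] show ?thesis by simp
  qed
  have "card (iso_classes G) \<le> card G"
    unfolding iso_classes_eq_image by (rule card_image_le[OF quartic_count_upper(1)[OF sub w]])
  also have "\<dots> \<le> 4 * (nat \<lfloor>root 3 (256 * x)\<rfloor> * (2 * 2 ^ (a + 3)))" by (rule quartic_count_upper(2)[OF sub w])
  also have "\<dots> = 2 ^ (a + 6) * nat \<lfloor>root 3 (256 * x)\<rfloor>" by (simp add: power_add)
  finally show ?thesis by (simp only: G_def)
qed

lemma admissible_squarefree_parts:
  assumes "squarefree (b * c)" "\<not> is_unit (b * c)"
  shows "admissible (b * c ^ 3)"
proof -
  have nz: "b \<noteq> 0" "c \<noteq> 0" using assms(1) by auto
  have "b * c dvd b * c ^ 3" by (simp add: power3_eq_cube)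
  then have nu: "\<not> is_unit (b * c ^ 3)" using assms(2) dvd_trans by blast
  have "gcd (multiplicity p (b * c ^ 3)) 4 = 1" if p: "Factorial_Ring.prime p" "p dvd b * c ^ 3" for p
  proof -
    have pe: "prime_elem p" using p(1) by (rule prime_imp_prime_elem)
    note mult = prime_elem_multiplicity_mult_distrib[OF pe] prime_elem_multiplicity_power_distrib[OF pe]
    have "multiplicity p (b * c) \<le> 1" using assms(1) p(1) nz squarefree_factorial_semiring''[of "b * c"] by auto
    then have le: "multiplicity p b + multiplicity p c \<le> 1" using nz by (simp add: mult)
    have e: "multiplicity p (b * c ^ 3) = multiplicity p b + 3 * multiplicity p c" using nz by (simp add: mult)
    have "multiplicity p (b * c ^ 3) > 0" 
      by (rule iffD2[OF prime_multiplicity_gt_zero_iff[OF pe] p(2)]) (use nz in simp)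
    then have "multiplicity p (b * c ^ 3) = 1 \<or> multiplicity p (b * c ^ 3) = 3" using le unfolding e
      by (cases "multiplicity p b"; cases "multiplicity p c") auto
    moreover have "gcd (3::nat) 4 = 1" by (simp add: gcd_non_0_nat)
    ultimately show ?thesis by auto
  qed
  moreover have "b * c ^ 3 \<noteq> 1" "b * c ^ 3 \<noteq> - 1" using nu by auto
  ultimately show ?thesis using nz by (simp add: admissible_def)
qed

text \<open>The fields come from pairs of a prime \<open>q\<close> in \<open>Q\<close> and a
  squarefree \<open>b\<close> prime to \<open>q\<close>, with \<open>C < b\<close> and
  \<open>b * q \<le> y\<close>. Requiring \<open>C < b\<close> keeps exchanged pairs out of the
  family; it costs at most \<open>C\<close> values of \<open>b\<close> for each \<open>q\<close>,
  and rounding costs at most 1.\<close>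

lemma quartic_count_lower:
  fixes Q :: "nat set"
  assumes Q: "finite Q" "\<And>q. q \<in> Q \<Longrightarrow> Factorial_Ring.prime q \<and> q \<ge> 11 \<and> q \<le> C" and y: "y \<ge> 0" "256 * y ^ 3 \<le> x"
  shows "(\<Sum>q\<in>Q. y / (8 * real q) - 1 - real C) \<le> real (card (iso_classes (pure_quartic_fields x)))"
proof -
  define S where "S q = {b \<in> {C<..nat \<lfloor>y / real q\<rfloor>}. squarefree b \<and> \<not> q dvd b}" for q
  define t where "t q b = complex_of_real (root 4 (real b * real q ^ 3))" for q b
  define F where "F = (\<lambda>(q, b). qfield (int q) (t q b))"
  define cl where "cl F = {(F, L). F \<in> pure_quartic_fields x \<and> L \<in> pure_quartic_fields x \<and> sub_ring F \<simeq> sub_ring L} `` {F}" for F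
  have pq: "pure_quartic (int b) (int q) (t q b)" "b > C" "real b * real q \<le> y" if "q \<in> Q" "b \<in> S q" for q b
  proof -
    have q: "Factorial_Ring.prime q" "q \<ge> 11" using Q(2) that(1) by auto
    have b: "C < b" "b \<le> nat \<lfloor>y / real q\<rfloor>" "squarefree b" "\<not> q dvd b" using that(2) by (auto simp: S_def)
    show "b > C" by (rule b(1))
    have "real b \<le> real (nat \<lfloor>y / real q\<rfloor>)" using b(2) by simp
    also have "\<dots> \<le> y / real q" by (rule of_nat_floor) (use y(1) in simp)
    finally have "real b \<le> y / real q" .
    then show "real b * real q \<le> y" using q(2) by (simp add: field_simps)
    have "Rings.coprime b q" using q(1) b(4) prime_imp_coprime coprime_commute by blast
    then have "squarefree (b * q)" using squarefree_mult_coprime b(3) squarefree_prime[OF q(1)] by blast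
    then have "squarefree (int b * int q)" using squarefree_int_iff[of "b * q"] by simp
    moreover have "b * q \<noteq> 1" using q(2) by simp
    then have "\<not> is_unit (int b * int q)" by (metis int_dvd_int_iff nat_dvd_1_iff_1 of_nat_1 of_nat_mult)
    moreover have "t q b ^ 4 = of_int (int b * int q ^ 3)"
    proof -
      have "root 4 (real b * real q ^ 3) ^ 4 = real b * real q ^ 3" by (rule real_root_pow_pos2) auto
      then have "t q b ^ 4 = complex_of_real (real b * real q ^ 3)" unfolding t_def by (metis of_real_power)
      then show ?thesis by simp
    qed
    ultimately show "pure_quartic (int b) (int q) (t q b)" by unfold_locales
  qed
  have treal: "t q b \<in> \<real>" for q b by (simp add: t_def)
  have FP: "F (q, b) \<in> pure_quartic_fields x" if "q \<in> Q" "b \<in> S q" for q b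
  proof -
    interpret pure_quartic "int b" "int q" "t q b" by (rule pq(1)[OF that])
    have "real_of_int \<bar>discriminant K\<bar> \<le> real_of_int (256 * \<bar>int b * int q\<bar> ^ 3)"
      using discriminant_bounds(2) by (simp only: of_int_le_iff)
    also have "\<dots> = 256 * (real b * real q) ^ 3" by simp
    also have "\<dots> \<le> 256 * y ^ 3" using pq(3)[OF that] by (intro mult_left_mono power_mono) auto
    also have "\<dots> \<le> x" by (rule y(2))
    finally have D: "real_of_int \<bar>discriminant K\<bar> \<le> x" .
    show ?thesis unfolding pure_quartic_fields_def F_def prod.case mem_Collect_eq
      using admissible_squarefree_parts[OF sqfree nonunit] root qfield_eq D by blast
  qed
  define P where "P = Sigma Q S"
  have "inj_on (\<lambda>p. cl (F p)) P"
  proof (rule inj_onI)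
    fix p p' assume p: "p \<in> P" "p' \<in> P" and eq: "cl (F p) = cl (F p')"
    obtain q b where qb: "p = (q, b)" "q \<in> Q" "b \<in> S q" using p(1) by (auto simp: P_def)
    obtain q' b' where qb': "p' = (q', b')" "q' \<in> Q" "b' \<in> S q'" using p(2) by (auto simp: P_def)
    \<comment> \<open>Reflexivity alone turns equality of the two classes into an isomorphism of the
      fields.\<close>
    have "F p' \<in> cl (F p')" using FP[OF qb'(2,3)] ring_iso_refl qb'(1) by (auto simp: cl_def)
    then have "F p' \<in> cl (F p)" using eq by simp
    then have iso: "sub_ring (F p) \<simeq> sub_ring (F p')" by (auto simp: cl_def)
    have pos: "b > 0" "q > 0" "b' > 0" "q' > 0"
      using pq(2)[OF qb(2,3)] pq(2)[OF qb'(2,3)] Q(2)[OF qb(2)] Q(2)[OF qb'(2)] by auto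
    have "int b = int b' \<and> int q = int q' \<or> int b = int q' \<and> int q = int b'"
      by (rule iso_real_pure_quartic[OF pq(1)[OF qb(2,3)] pq(1)[OF qb'(2,3)] treal treal])
        (use pos iso in \<open>simp_all add: F_def qb(1) qb'(1)\<close>)
    moreover have "b > q'" using pq(2)[OF qb(2,3)] Q(2)[OF qb'(2)] by linarith
    ultimately show "p = p'" using qb(1) qb'(1) by auto
  qed
  then have "card P = card ((\<lambda>p. cl (F p)) ` P)" by (rule card_image[symmetric])
  also have "\<dots> \<le> card (iso_classes (pure_quartic_fields x))"
  proof (rule card_mono)
    show "finite (iso_classes (pure_quartic_fields x))"
      unfolding iso_classes_eq_image by (rule finite_imageI[OF finite_pure_quartic_fields])
    show "(\<lambda>p. cl (F p)) ` P \<subseteq> iso_classes (pure_quartic_fields x)"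
      unfolding iso_classes_eq_image cl_def[symmetric] using FP by (auto simp: P_def)
  qed
  finally have le: "card P \<le> card (iso_classes (pure_quartic_fields x))" .
  have "card P = (\<Sum>q\<in>Q. card (S q))" unfolding P_def by (rule card_SigmaI) (use Q in \<open>auto simp: S_def\<close>)
  then have cP: "real (card P) = (\<Sum>q\<in>Q. real (card (S q)))" by simp
  have "y / (8 * real q) - 1 - real C \<le> real (card (S q))" if q: "q \<in> Q" for q
  proof -
    define N where "N = nat \<lfloor>y / real q\<rfloor>"
    have "{b \<in> {1..N}. squarefree b \<and> \<not> q dvd b} \<subseteq> {1..C} \<union> S q" by (auto simp: S_def N_def)
    then have "card {b \<in> {1..N}. squarefree b \<and> \<not> q dvd b} \<le> card ({1..C} \<union> S q)"
      by (intro card_mono) (auto simp: S_def)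
    also have "\<dots> \<le> C + card (S q)" using card_Un_le[of "{1..C}" "S q"] by simp
    finally have "real (card {b \<in> {1..N}. squarefree b \<and> \<not> q dvd b}) \<le> real C + real (card (S q))"
      by (simp only: of_nat_le_iff flip: of_nat_add)
    moreover have "real N / 8 \<le> real (card {b \<in> {1..N}. squarefree b \<and> \<not> q dvd b})"
      by (rule card_squarefree_coprime_ge) (use Q(2)[OF q] in blast)
    moreover have "y / real q \<ge> 0" using y(1) by simp
    then have "real N > y / real q - 1" unfolding N_def by linarith
    moreover have "y / (8 * real q) = (y / real q) / 8" by simp
    ultimately show ?thesis by linarith
  qed
  then have "(\<Sum>q\<in>Q. y / (8 * real q) - 1 - real C) \<le> (\<Sum>q\<in>Q. real (card (S q)))" by (rule sum_mono)
  also have "\<dots> \<le> real (card (iso_classes (pure_quartic_fields x)))" using le cP by simp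
  finally show ?thesis .
qed

theorem theorem1p5:
  fixes a :: nat
  shows "((\<lambda>x :: real.
            real (card (iso_classes {K \<in> pure_quartic_fields x. genus_number K = 2 ^ a})) /
            real (card (iso_classes (pure_quartic_fields x)))) \<longlongrightarrow> 0) at_top"
proof (rule tendstoI)
  fix e :: real assume e: "e > 0"
  \<comment> \<open>The factor \<open>2 ^ (a + 6)\<close> from \<open>card_genus_classes_le\<close>
    times 64, the bound for the cube root of \<open>256 * x\<close> in units of
    \<open>y\<close>.\<close>
  define B :: real where "B = 2 ^ (a + 12)"
  have B: "B > 0" by (simp add: B_def)
  \<comment> \<open>The final ratio is at most \<open>16 * B / s\<close>; this threshold makes it at
    most \<open>e / 2\<close>.\<close>
  obtain Q :: "nat set" where Q: "finite Q" "\<forall>q\<in>Q. Factorial_Ring.prime q \<and> q \<ge> 11" and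
    Qs: "32 * B / e \<le> (\<Sum>q\<in>Q. 1 / real q)" using prime_reciprocals_unbounded by blast
  define s where "s = (\<Sum>q\<in>Q. 1 / real q)"
  have s: "32 * B / e \<le> s" "s > 0"
  proof -
    show "32 * B / e \<le> s" using Qs by (simp add: s_def)
    moreover have "32 * B / e > 0" using B e by simp
    ultimately show "s > 0" by linarith
  qed
  define C where "C = Max (insert 0 Q)"
  have QC: "q \<le> C" if "q \<in> Q" for q unfolding C_def using Q(1) that by (intro Max_ge) auto
  define T where "T = real (card Q) * (1 + real C)"
  \<comment> \<open>\<open>T\<close> is the total loss in the lower count. From here on it is at
    most half of the main term \<open>y * s / 8\<close>; the summand 1 keeps \<open>y0\<close>
    positive.\<close>
  define y0 where "y0 = 16 * T / s + 1"
  have T0: "T \<ge> 0" by (simp add: T_def)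
  have y0: "y0 > 0" using T0 s(2) by (simp add: y0_def add_nonneg_pos)
  show "\<forall>\<^sub>F x in at_top. dist (real (card (iso_classes {K \<in> pure_quartic_fields x. genus_number K = 2 ^ a})) /
            real (card (iso_classes (pure_quartic_fields x)))) 0 < e"
    using eventually_ge_at_top[of "256 * y0 ^ 3"]
  proof eventually_elim
    case (elim x)
    \<comment> \<open>Chosen so that \<open>256 * y ^ 3 = x\<close>, the largest value allowed in
      \<open>quartic_count_lower\<close>.\<close>
    define y where "y = root 3 (x / 256)"
    have x0: "x \<ge> 0" using elim y0 by (meson order.trans less_imp_le mult_nonneg_nonneg zero_le_numeral zero_le_power)
    have y3: "256 * y ^ 3 = x" using x0 by (simp add: y_def real_root_pow_pos2)
    have yy0: "y \<ge> y0"
    proof -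
      have "root 3 (y0 ^ 3) \<le> root 3 (x / 256)" using elim by simp
      then show ?thesis using y0 by (simp add: y_def real_root_power_cancel)
    qed
    then have ypos: "y > 0" using y0 by linarith
    define num den where "num = real (card (iso_classes {K \<in> pure_quartic_fields x. genus_number K = 2 ^ a}))"
      and "den = real (card (iso_classes (pure_quartic_fields x)))"
    have "num \<le> real (2 ^ (a + 6) * nat \<lfloor>root 3 (256 * x)\<rfloor>)"
      unfolding num_def of_nat_le_iff by (rule card_genus_classes_le)
    also have "\<dots> \<le> 2 ^ (a + 6) * (64 * y)"
    proof -
      \<comment> \<open>A generous rounding to a cube: \<open>64 ^ 3 / 256\<close> is 1024, which
        exceeds 256.\<close>
      have "root 3 (256 * x) \<le> root 3 (64 ^ 3 * (x / 256))" using x0 by simp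
      also have "\<dots> = 64 * y" by (simp only: real_root_mult y_def) (simp add: real_root_power_cancel)
      finally have "root 3 (256 * x) \<le> 64 * y" .
      then have "real (nat \<lfloor>root 3 (256 * x)\<rfloor>) \<le> 64 * y" using ypos by linarith
      then show ?thesis by simp
    qed
    finally have num: "num \<le> B * y" by (simp add: B_def power_add)
    have "(\<Sum>q\<in>Q. y / (8 * real q) - 1 - real C) \<le> den"
      unfolding den_def by (rule quartic_count_lower) (use Q QC ypos y3 in auto)
    moreover have "(\<Sum>q\<in>Q. y / (8 * real q) - 1 - real C) = y * s / 8 - T"
      by (simp add: s_def T_def sum_subtractf sum_distrib_left sum_divide_distrib algebra_simps)
    moreover have "T \<le> y * s / 16"
    proof -
      have "16 * T / s \<le> y" using yy0 by (simp add: y0_def)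
      then show ?thesis using s(2) by (simp add: field_simps)
    qed
    ultimately have den: "y * s / 16 \<le> den" by linarith
    have pos: "y * s / 16 > 0" using ypos s(2) by simp
    have "num / den \<le> (B * y) / (y * s / 16)"
      using num den pos B ypos by (intro frac_le) auto
    also have "\<dots> = 16 * B / s" using ypos by simp
    also have "\<dots> < e"
    proof -
      have "32 * B \<le> s * e" using s(1) e by (simp add: field_simps)
      then have "16 * B < s * e" using B by linarith
      then show ?thesis using s(2) by (simp add: field_simps)
    qed
    finally have "num / den < e" .
    moreover have "num / den \<ge> 0" by (simp add: num_def den_def)
    ultimately show ?case by (simp add: num_def den_def)
  qed
qed

end
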